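(* Let $p$ be an odd prime, $K_0$ a field of characteristic $p$, and $K_4/K_0$ a Galois extension of degree $p^4$ with non-Abelian Galois group. Identify $\mathrm{Gal}(K_4/K_0)$ with one of the groups $G_{\vec a,\vec b}$ ($(\vec a,\vec b)$ one of the admissible parameter values for $p$ listed in the context) or with the group $H$, so that $\sigma_1,\sigma_2,\sigma_3,\sigma_4\in \mathrm{Gal}(K_4/K_0)$ are the corresponding generators. Let $K_3,K_2,K_1$ be the fixed fields of $\langle\sigma_4\rangle$, $\langle\sigma_3,\sigma_4\rangle$, $\langle\sigma_2,\sigma_3,\sigma_4\rangle$ respectively, and consider elements $x_i\in K_i$ ($1\le i\le 4$) such that $K_i=K_{i-1}(x_i)$, $\wp(x_i)\in K_{i-1}$, $(\sigma_i-1)x_i=1$, and $(\sigma_1-1)x_2=0$. Then $x_1$ and $x_2$ can be chosen so that $\wp(x_1)\in K_0$ and $\wp(x_2)\in K_0$. Write $\beta_1=\wp(x_1)$ and $\beta_2=\wp(x_2)$. (1) If $\mathrm{Gal}(K_4/K_0)\cong G_{\vec a,\vec b}$, then $x_3$ and $x_4$ can be selected such that, for some $\beta_3,\beta_4\in K_0$, \begin{align*} \wp(x_3)&=a_0\beta_2x_1+a_1D_1(x_1)+\beta_3,\\ \wp(x_4)&=b_0\beta_2x_1+b_1D_1(x_1)+b_2D_1(x_2)+b_3\left(a_0\beta_2\binom{x_1}{2}+\beta_3x_1\right)+\beta_4 . \end{align*} (2) Otherwise, $\mathrm{Gal}(K_4/K_0)\cong H$, and $x_3$ and $x_4$ can be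 selected such that, for some $\beta_3,\beta_4\in K_0$, \begin{align*} \wp(x_3)&=D_1(x_1)+\beta_3,\\ \wp(x_4)&=\beta_2x_1+D_2(x_1,x_3)+\beta_4 . \end{align*} Conversely, let $K_4/K_0$ be an algebraic extension of degree $p^4$ with $K_0$ of characteristic $p$ and $K_4=K_0(x_1,x_2,x_3,x_4)$, where $\wp(x_1)=\beta_1$, $\wp(x_2)=\beta_2$ and, for some $\beta_1,\beta_2,\beta_3,\beta_4\in K_0$, the elements $x_3,x_4$ satisfy the two equations in (1) for some admissible $(\vec a,\vec b)$ (respectively, the two equations in (2)). Then $K_4/K_0$ is a Galois extension with $\mathrm{Gal}(K_4/K_0)\cong G_{\vec a,\vec b}$ (respectively, $\mathrm{Gal}(K_4/K_0)\cong H$).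
   Context: Throughout $p$ is an odd prime. $\wp(x)=x^p-x$. For an automorphism $\sigma$ and an element $x$, $(\sigma-1)x=\sigma(x)-x$. $\binom{x}{2}=x(x-1)/2$. The integers $a_i,b_j$ are read modulo $p$ when they appear as scalars in $K_0$. **Groups.** For $\vec a=(a_0,a_1)$, $\vec b=(b_0,b_1,b_2,b_3)$, $$G_{\vec a,\vec b}=\langle \sigma_1,\sigma_2,\sigma_3,\sigma_4:\ \sigma_1^p=\sigma_3^{a_1}\sigma_4^{b_1},\ \sigma_2^p=\sigma_4^{b_2},\ \sigma_3^p=\sigma_4^p=1,\ \sigma_4\in Z(G_{\vec a,\vec b}),\ \sigma_3\sigma_2=\sigma_2\sigma_3,\ \sigma_3\sigma_1=\sigma_1\sigma_3\sigma_4^{b_3},\ \sigma_2\sigma_1=\sigma_1\sigma_2\sigma_3^{a_0}\sigma_4^{b_0}\rangle ,$$ $$H=\langle \sigma_1,\sigma_2,\sigma_3,\sigma_4:\ \sigma_3=\sigma_1^p,\ \sigma_4=\sigma_1^{p^2},\ \sigma_1^{p^3}=\sigma_2^p=1,\ \sigma_2\sigma_1=\sigma_1^{1+p^2}\sigma_2\rangle .$$ **Admissible parameters.** Let $\alpha$ be a fixed quadratic non-residue modulo $p$ (for $p=3$, $\alpha\equiv-1$). The admissible values of $(a_0,a_1;\,b_0,b_1,b_2,b_3)$ are: - $(0,0;\,1,0,0,0)$ - $(0,0;\,1,1,0,0)$ - $(0,0;\,0,0,1,1)$ - $(1,0;\,0,0,\alpha,1)$ if $p=3$; $(1,0;\,0,0,0,1)$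 if $p>3$ - $(1,0;\,0,1,0,0)$ - $(1,0;\,0,1,0,1)$ - $(1,0;\,0,1,1,1)$ - $(1,0;\,0,1,\alpha,1)$ - $(1,1;\,0,0,1,0)$ By Burnside's classification (a known background fact), the nine groups $G_{\vec a,\vec b}$ with admissible parameters together with $H$ represent all ten isomorphism classes of non-Abelian groups of order $p^4$. **Polynomials.** $D_1\in\mathbb F_p[x]$ is the reduction modulo $p$ of the integer polynomial $$\frac{x^p+(x^p-x)^p-(x+(x^p-x))^p}{p}.$$ Thus if $\wp(x)=\beta$, then $D_1(x)=-\sum_{i=1}^{p-1}\frac{1}{p}\binom{p}{i}x^i\beta^{p-i}$. $D_2(x_1,x_3)$ is $$D_2(x_1,x_3)=\frac{x_1^{p^2}+\beta_1^{p^2}-(x_1+\beta_1)^{p^2}+p\left(x_3^p+\beta_3^p-(x_3+D_1(x_1)+\beta_3)^p\right)}{p^2},$$ interpreted as follows: regard $x_1,x_3,\beta_1,\beta_3$ as indeterminates over $\mathbb Z$ and replace $D_1(x_1)$ by its integral form $\frac{x_1^p+\beta_1^p-(x_1+\beta_1)^p}{p}$; the displayed expression is then a polynomial with integer coefficients (a Witt polynomial), which is reduced modulo $p$ and evaluated at the actual elements $x_1,x_3,\beta_1,\beta_3$ (where $\beta_1=\wp(x_1)$ and $\beta_3=\wp(x_3)-D_1(x_1)$). *)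

theory Defs
  imports
    "HOL-Algebra.Algebraic_Closure_Type"
    "HOL-Algebra.Generated_Fields"
    "HOL-Number_Theory.Residues"
begin

section \<open>Groups given by generators and relations\<close>

text \<open>A word is a list of letters; \<open>(g, True)\<close> stands for the generator \<open>g\<close> and \<open>(g, False)\<close> for
  its inverse. The generators are all the elements of the type \<open>'g\<close>.\<close>

type_synonym 'g word = "('g \<times> bool) list"

definition word_inv :: "'g word \<Rightarrow> 'g word" where
  "word_inv w = rev (map (\<lambda>(g, e). (g, \<not> e)) w)"

definition word_pow :: "'g word \<Rightarrow> int \<Rightarrow> 'g word" where
  "word_pow w k = concat (replicate (nat \<bar>k\<bar>) (if k \<ge> 0 then w else word_inv w))"

abbreviation letter_pow :: "'g \<Rightarrow> int \<Rightarrow> 'g word" where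
  "letter_pow g k \<equiv> word_pow [(g, True)] k"

text \<open>A relation \<open>u = v\<close> is the pair \<open>(u, v)\<close>.\<close>

inductive word_eq :: "('g word \<times> 'g word) set \<Rightarrow> 'g word \<Rightarrow> 'g word \<Rightarrow> bool"
  for R :: "('g word \<times> 'g word) set" where
  refl: "word_eq R u u"
| sym: "word_eq R u v \<Longrightarrow> word_eq R v u"
| trans: "word_eq R u v \<Longrightarrow> word_eq R v w \<Longrightarrow> word_eq R u w"
| append: "word_eq R u u' \<Longrightarrow> word_eq R v v' \<Longrightarrow> word_eq R (u @ v) (u' @ v')"
| cancel: "word_eq R [(g, e), (g, \<not> e)] []"
| rel: "(u, v) \<in> R \<Longrightarrow> word_eq R u v"

definition word_class :: "('g word \<times> 'g word) set \<Rightarrow> 'g word \<Rightarrow> 'g word set" where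
  "word_class R w = {v. word_eq R w v}"

definition presented_group :: "('g word \<times> 'g word) set \<Rightarrow> 'g word set monoid" where
  "presented_group R =
    \<lparr> carrier = range (word_class R),
      monoid.mult = (\<lambda>A B. {w. \<exists>u\<in>A. \<exists>v\<in>B. word_eq R (u @ v) w}),
      one = word_class R [] \<rparr>"

definition presented_gen :: "('g word \<times> 'g word) set \<Rightarrow> 'g \<Rightarrow> 'g word set" where
  "presented_gen R g = word_class R [(g, True)]"


section \<open>The groups of order \<open>p^4\<close>\<close>

datatype gen = S1 | S2 | S3 | S4

text \<open>The parameters are listed as \<open>(a\<^sub>0, a\<^sub>1, b\<^sub>0, b\<^sub>1, b\<^sub>2, b\<^sub>3)\<close>.\<close>

type_synonym params = "int \<times> int \<times> int \<times> int \<times> int \<times> int"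

fun relations_G :: "nat \<Rightarrow> params \<Rightarrow> (gen word \<times> gen word) set" where
  "relations_G p (a0, a1, b0, b1, b2, b3) =
    {(letter_pow S1 (int p), letter_pow S3 a1 @ letter_pow S4 b1),
     (letter_pow S2 (int p), letter_pow S4 b2),
     (letter_pow S3 (int p), []),
     (letter_pow S4 (int p), [])}
    \<union> range (\<lambda>g. (letter_pow S4 1 @ letter_pow g 1, letter_pow g 1 @ letter_pow S4 1))
    \<union> {(letter_pow S3 1 @ letter_pow S2 1, letter_pow S2 1 @ letter_pow S3 1),
       (letter_pow S3 1 @ letter_pow S1 1,
        letter_pow S1 1 @ letter_pow S3 1 @ letter_pow S4 b3),
       (letter_pow S2 1 @ letter_pow S1 1,
        letter_pow S1 1 @ letter_pow S2 1 @ letter_pow S3 a0 @ letter_pow S4 b0)}"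

definition relations_H :: "nat \<Rightarrow> (gen word \<times> gen word) set" where
  "relations_H p =
    {(letter_pow S3 1, letter_pow S1 (int p)),
     (letter_pow S4 1, letter_pow S1 (int (p\<^sup>2))),
     (letter_pow S1 (int (p^3)), []),
     (letter_pow S2 (int p), []),
     (letter_pow S2 1 @ letter_pow S1 1, letter_pow S1 (1 + int (p\<^sup>2)) @ letter_pow S2 1)}"

text \<open>Here \<open>\<alpha>\<close> is to be a quadratic non-residue modulo \<open>p\<close>.\<close>

definition admissible_params :: "nat \<Rightarrow> int \<Rightarrow> params set" where
  "admissible_params p \<alpha> =
    {(0, 0, 1, 0, 0, 0),
     (0, 0, 1, 1, 0, 0),
     (0, 0, 0, 0, 1, 1),
     (if p = 3 then (1, 0, 0, 0, \<alpha>, 1) else (1, 0, 0, 0, 0, 1)),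
     (1, 0, 0, 1, 0, 0),
     (1, 0, 0, 1, 0, 1),
     (1, 0, 0, 1, 1, 1),
     (1, 0, 0, 1, \<alpha>, 1),
     (1, 1, 0, 0, 1, 0)}"


section \<open>Field extensions\<close>

text \<open>The top field of an extension is a whole type \<open>'a\<close> of class \<open>field\<close>. \<open>top_field\<close> is the same
  field in record form, which makes subfields, generated subfields, dimension and algebraicity
  available from \<open>HOL-Algebra\<close>.\<close>

abbreviation top_field :: "'a::field ring" where
  "top_field \<equiv> ring_of_type_algebra"

abbreviation ext_degree :: "'a::field set \<Rightarrow> nat \<Rightarrow> bool" where
  "ext_degree K n \<equiv> ring.dimension top_field n K UNIV"

abbreviation algebraic_ext :: "'a::field set \<Rightarrow> bool" where
  "algebraic_ext K \<equiv> (\<forall>x. (ring.algebraic top_field over K) x)"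

definition galois_group :: "'a::field set \<Rightarrow> ('a \<Rightarrow> 'a) monoid" where
  "galois_group K =
    \<lparr> carrier = {\<sigma> \<in> ring_iso top_field top_field. \<forall>x\<in>K. \<sigma> x = x},
      monoid.mult = (\<circ>),
      one = id \<rparr>"

definition fixed_field :: "('a \<Rightarrow> 'a) set \<Rightarrow> 'a set" where
  "fixed_field S = {x. \<forall>\<sigma>\<in>S. \<sigma> x = x}"

definition galois_ext :: "'a::field set \<Rightarrow> bool" where
  "galois_ext K \<longleftrightarrow> algebraic_ext K \<and> fixed_field (carrier (galois_group K)) = K"


section \<open>Artin-Schreier generators and the polynomials \<open>D\<^sub>1\<close> and \<open>D\<^sub>2\<close>\<close>

definition AS :: "nat \<Rightarrow> 'a::field \<Rightarrow> 'a" where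
  "AS p x = x ^ p - x"

definition witt_carry :: "nat \<Rightarrow> 'a::idom_divide \<Rightarrow> 'a \<Rightarrow> 'a" where
  "witt_carry p x y = (x ^ p + y ^ p - (x + y) ^ p) div of_nat p"

definition D1_int :: "nat \<Rightarrow> int poly" where
  "D1_int p = witt_carry p [:0, 1:] ([:0, 1:] ^ p - [:0, 1:])"

text \<open>Below, \<open>of_int\<close> performs the reduction modulo \<open>p\<close>, as \<open>'a\<close> will have characteristic \<open>p\<close>.\<close>

definition D1 :: "nat \<Rightarrow> 'a::field \<Rightarrow> 'a" where
  "D1 p x = poly (map_poly of_int (D1_int p)) x"

text \<open>Polynomials in four indeterminates are nested univariate ones: from the innermost to the
  outermost level the indeterminates stand for \<open>x\<^sub>1\<close>, \<open>x\<^sub>3\<close>, \<open>\<beta>\<^sub>1\<close>, \<open>\<beta>\<^sub>3\<close>. The division by \<open>p\<^sup>2\<close> is exact.\<close>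

definition D2_int :: "nat \<Rightarrow> int poly poly poly poly" where
  "D2_int p =
    (let x1 = [:[:[:[:0, 1:]:]:]:]; x3 = [:[:[:0, 1:]:]:]; \<beta>1 = [:[:0, 1:]:]; \<beta>3 = [:0, 1:] in
     (x1 ^ p\<^sup>2 + \<beta>1 ^ p\<^sup>2 - (x1 + \<beta>1) ^ p\<^sup>2
       + of_nat p * (x3 ^ p + \<beta>3 ^ p - (x3 + witt_carry p x1 \<beta>1 + \<beta>3) ^ p)) div of_nat (p\<^sup>2))"

definition eval4 :: "int poly poly poly poly \<Rightarrow> 'a::field \<Rightarrow> 'a \<Rightarrow> 'a \<Rightarrow> 'a \<Rightarrow> 'a" where
  "eval4 P x1 x3 \<beta>1 \<beta>3 =
    poly (map_poly (\<lambda>Q. poly (map_poly (\<lambda>R. poly (map_poly (\<lambda>S.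
      poly (map_poly of_int S) x1) R) x3) Q) \<beta>1) P) \<beta>3"

definition D2 :: "nat \<Rightarrow> 'a::field \<Rightarrow> 'a \<Rightarrow> 'a" where
  "D2 p x1 x3 = eval4 (D2_int p) x1 x3 (AS p x1) (AS p x3 - D1 p x1)"

fun system_G :: "nat \<Rightarrow> params \<Rightarrow> 'a::field \<Rightarrow> 'a \<Rightarrow> 'a \<Rightarrow> 'a \<Rightarrow> 'a \<Rightarrow> 'a \<Rightarrow> 'a \<Rightarrow> bool" where
  "system_G p (a0, a1, b0, b1, b2, b3) \<beta>2 \<beta>3 \<beta>4 x1 x2 x3 x4 \<longleftrightarrow>
    AS p x3 = of_int a0 * \<beta>2 * x1 + of_int a1 * D1 p x1 + \<beta>3 \<and>
    AS p x4 = of_int b0 * \<beta>2 * x1 + of_int b1 * D1 p x1 + of_int b2 * D1 p x2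
      + of_int b3 * (of_int a0 * \<beta>2 * (x1 * (x1 - 1) / 2) + \<beta>3 * x1) + \<beta>4"

definition system_H :: "nat \<Rightarrow> 'a::field \<Rightarrow> 'a \<Rightarrow> 'a \<Rightarrow> 'a \<Rightarrow> 'a \<Rightarrow> 'a \<Rightarrow> bool" where
  "system_H p \<beta>2 \<beta>3 \<beta>4 x1 x3 x4 \<longleftrightarrow>
    AS p x3 = D1 p x1 + \<beta>3 \<and>
    AS p x4 = \<beta>2 * x1 + D2 p x1 x3 + \<beta>4"

text \<open>\<open>step_gen p K L \<tau> x\<close>: \<open>L = K(x)\<close> with \<open>x^p - x \<in> K\<close>, and \<open>x\<close> is normalised with respect to \<open>\<tau>\<close>.\<close>

definition step_gen :: "nat \<Rightarrow> 'a::field set \<Rightarrow> 'a set \<Rightarrow> ('a \<Rightarrow> 'a) \<Rightarrow> 'a \<Rightarrow> bool" where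
  "step_gen p K L \<tau> x \<longleftrightarrow>
    x \<in> L \<and> L = generate_field top_field (insert x K) \<and> AS p x \<in> K \<and> \<tau> x - x = 1"

text \<open>The fixed field of the subgroup generated by the \<open>\<sigma> g\<close> for \<open>g \<in> S\<close>; \<open>K\<^sub>1\<close>, \<open>K\<^sub>2\<close>, \<open>K\<^sub>3\<close> are
  obtained for \<open>S = {S2, S3, S4}\<close>, \<open>{S3, S4}\<close>, \<open>{S4}\<close>.\<close>

definition stage :: "'a::field set \<Rightarrow> (gen \<Rightarrow> 'a \<Rightarrow> 'a) \<Rightarrow> gen set \<Rightarrow> 'a set" where
  "stage K \<sigma> S = fixed_field (generate (galois_group K) (\<sigma> ` S))"

definition lower_gens :: "nat \<Rightarrow> 'a::field set \<Rightarrow> (gen \<Rightarrow> 'a \<Rightarrow> 'a) \<Rightarrow> 'a \<Rightarrow> 'a \<Rightarrow> bool" where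
  "lower_gens p K \<sigma> x1 x2 \<longleftrightarrow>
    step_gen p K (stage K \<sigma> {S2, S3, S4}) (\<sigma> S1) x1 \<and>
    step_gen p (stage K \<sigma> {S2, S3, S4}) (stage K \<sigma> {S3, S4}) (\<sigma> S2) x2 \<and>
    \<sigma> S1 x2 - x2 = 0"

definition upper_gens :: "nat \<Rightarrow> 'a::field set \<Rightarrow> (gen \<Rightarrow> 'a \<Rightarrow> 'a) \<Rightarrow> 'a \<Rightarrow> 'a \<Rightarrow> bool" where
  "upper_gens p K \<sigma> x3 x4 \<longleftrightarrow>
    step_gen p (stage K \<sigma> {S3, S4}) (stage K \<sigma> {S4}) (\<sigma> S3) x3 \<and>
    step_gen p (stage K \<sigma> {S4}) UNIV (\<sigma> S4) x4"

end

(*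
  Let f be a function on the generators of a presented group acting on K4. Extended to words as a
  crossed homomorphism, f descends to the group as soon as it respects the relations, and then the
  additive Hilbert 90 yields x with sigma_g x = x + f g for every generator g. Applied level by
  level with f g = (sigma_g - 1) x_i, this produces x1, ..., x4, and the Artin-Schreier equations
  hold because both sides change by the same amount under each sigma_g.

  Conversely, the degree p^4 forces every step of the tower to have degree p, so that an
  automorphism of K_(i-1) extends to K_i by x_i |-> x_i + f g whenever f g satisfies the same
  compatibility; this gives the sigma_g. The relations hold by the same check on crossed
  homomorphisms, the shifts of x1, ..., x4 make the map from the presented group to the Galois group
  injective on normal forms, and dividing out shifts makes it surjective.

  The only arithmetic input is the behaviour of D1 and D2 under x1 |-> x1 + 1. For this D1 and D2
  are read as the second and third component of a sum of Witt vectors; the required identities are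
  the associativity of Witt vector addition and the value of the p-fold sum of 1, and are proved
  over the integers, where one can multiply by p^2.
*)

theory Submission
  imports Defs
begin

section \<open>Witt vector addition over commutative rings\<close>

text \<open>Let F be Frobenius and X = (x1, x3). In the case H the pair (\<beta>1, \<beta>3) is the
  Witt vector F X - X, because x1 + \<beta>1 = x1^p and x3 + D1(x1) + \<beta>3 = x3^p. Hence D1 and
  D2 are the carries of X + (F X - X), and adding to X a vector fixed by F changes each of them by
  an Artin-Schreier value. Carries contain a division by p, which is meaningless in characteristic
  p; so the identities are proved in a polynomial ring over the integers and then specialised. In
  the case G, the term b3 (a0 \<beta>2 binom(x1, 2) + \<beta>3 x1) grows by b3
  \<open>AS p x3\<close> under x1 -> x1 + 1, provided that b3 times the equation of x3 is free of
  D1. This is the condition a1 = 0 or b3 = 0, true of every admissible tuple. One locale treats G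
  and H together. Its rules for the right-hand sides speak of homomorphisms on a subring, since the
  converse applies them to automorphisms that so far exist on K_i only. The presented groups are
  known by their relations alone; collecting words into normal form bounds their order by p^4 and
  makes the acting group finite.\<close>

locale subring_set =
  fixes S :: "'r::comm_ring_1 set"
  assumes one_closed: "1 \<in> S"
    and add_closed: "x \<in> S \<Longrightarrow> y \<in> S \<Longrightarrow> x + y \<in> S"
    and mult_closed: "x \<in> S \<Longrightarrow> y \<in> S \<Longrightarrow> x * y \<in> S"
    and uminus_closed: "x \<in> S \<Longrightarrow> - x \<in> S"
begin

lemma zero_closed: "0 \<in> S"
  using add_closed[OF one_closed uminus_closed[OF one_closed]] by simp

lemma diff_closed: "x \<in> S \<Longrightarrow> y \<in> S \<Longrightarrow> x - y \<in> S"
  using add_closed uminus_closed by (metis diff_conv_add_uminus)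

lemma sum_closed: "(\<And>i. i \<in> A \<Longrightarrow> f i \<in> S) \<Longrightarrow> sum f A \<in> S"
  by (induction A rule: infinite_finite_induct) (auto intro: zero_closed add_closed)

lemma power_closed: "x \<in> S \<Longrightarrow> x ^ n \<in> S"
  by (induction n) (auto intro: one_closed mult_closed)

lemma of_nat_closed: "of_nat n \<in> S"
  by (induction n) (auto intro: zero_closed one_closed add_closed)

lemma of_int_closed: "of_int k \<in> S"
  by (cases k rule: int_cases2) (auto intro: of_nat_closed uminus_closed)

lemmas closed = zero_closed one_closed add_closed mult_closed uminus_closed diff_closed
  sum_closed power_closed of_nat_closed of_int_closed

end

text \<open>An automorphism under construction lives on one subfield of the tower, while HOL
  functions are total; the laws are therefore required on \<open>S\<close> only.\<close>

locale ring_hom_on = subring_set S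
  for S :: "'r::comm_ring_1 set" and h :: "'r \<Rightarrow> 's::comm_ring_1" +
  assumes hom_one: "h 1 = 1"
    and hom_add: "x \<in> S \<Longrightarrow> y \<in> S \<Longrightarrow> h (x + y) = h x + h y"
    and hom_mult: "x \<in> S \<Longrightarrow> y \<in> S \<Longrightarrow> h (x * y) = h x * h y"
begin

lemma hom_zero: "h 0 = 0"
  using hom_add[OF zero_closed zero_closed] by simp

lemma hom_uminus: "x \<in> S \<Longrightarrow> h (- x) = - h x"
  using hom_add[of x "- x"] uminus_closed[of x] hom_zero by (simp add: eq_neg_iff_add_eq_0 add.commute)

lemma hom_diff: "x \<in> S \<Longrightarrow> y \<in> S \<Longrightarrow> h (x - y) = h x - h y"
  using hom_add[of x "- y"] hom_uminus[of y] uminus_closed[of y] by simp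

lemma hom_sum: "(\<And>i. i \<in> A \<Longrightarrow> f i \<in> S) \<Longrightarrow> h (sum f A) = (\<Sum>i\<in>A. h (f i))"
  by (induction A rule: infinite_finite_induct) (auto simp: hom_zero hom_add sum_closed)

lemma hom_power: "x \<in> S \<Longrightarrow> h (x ^ n) = h x ^ n"
  by (induction n) (auto simp: hom_one hom_mult power_closed)

lemma hom_of_nat: "h (of_nat n) = of_nat n"
  by (induction n) (auto simp: hom_zero hom_one hom_add of_nat_closed one_closed)

lemma hom_of_int: "h (of_int k) = of_int k"
  by (cases k rule: int_cases2) (auto simp: hom_of_nat hom_uminus of_nat_closed)

lemmas hom = hom_zero hom_one hom_add hom_mult hom_uminus hom_diff hom_sum hom_power
  hom_of_nat hom_of_int

lemma poly_map_poly_closed: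
  assumes "\<And>c. f c \<in> S" "f 0 = 0" "x \<in> S"
  shows "poly (map_poly f P) x \<in> S"
  by (induction P) (auto simp: assms map_poly_pCons closed)

lemma hom_poly_map_poly:
  assumes "\<And>c. f c \<in> S" "f 0 = 0" "x \<in> S"
  shows "h (poly (map_poly f P) x) = poly (map_poly (\<lambda>c. h (f c)) P) (h x)"
  by (induction P) (auto simp: assms map_poly_pCons closed hom poly_map_poly_closed[where f = f, OF assms])

end

abbreviation ring_hom_total :: "('r::comm_ring_1 \<Rightarrow> 's::comm_ring_1) \<Rightarrow> bool" where
  "ring_hom_total \<equiv> ring_hom_on UNIV"

lemma ring_hom_totalI:
  assumes "h 1 = 1" "\<And>x y. h (x + y) = h x + h y" "\<And>x y. h (x * y) = h x * h y"
  shows "ring_hom_total h"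
  using assms by unfold_locales auto

lemma ring_hom_total_of_int: "ring_hom_total (of_int :: int \<Rightarrow> 'r::comm_ring_1)"
  by (rule ring_hom_totalI) auto

lemma ring_hom_total_poly_map_poly:
  assumes "ring_hom_total f"
  shows "ring_hom_total (\<lambda>P. poly (map_poly f P) x)"
proof -
  interpret ring_hom_on UNIV f by (fact assms)
  have add: "map_poly f (P + Q) = map_poly f P + map_poly f Q" for P Q
    by (rule poly_eqI) (simp add: coeff_map_poly hom)
  have mult: "map_poly f (P * Q) = map_poly f P * map_poly f Q" for P Q
    by (rule poly_eqI) (simp add: coeff_map_poly coeff_mult hom)
  show ?thesis
    by (rule ring_hom_totalI) (simp_all add: add mult hom map_poly_1)
qed

section \<open>Evaluation of integer polynomials in four indeterminates\<close>

definition eval1 :: "int poly \<Rightarrow> 'r::comm_ring_1 \<Rightarrow> 'r" where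
  "eval1 P x1 = poly (map_poly of_int P) x1"

definition eval2 :: "int poly poly \<Rightarrow> 'r::comm_ring_1 \<Rightarrow> 'r \<Rightarrow> 'r" where
  "eval2 P x1 x3 = poly (map_poly (\<lambda>S. eval1 S x1) P) x3"

definition eval3 :: "int poly poly poly \<Rightarrow> 'r::comm_ring_1 \<Rightarrow> 'r \<Rightarrow> 'r \<Rightarrow> 'r" where
  "eval3 P x1 x3 y1 = poly (map_poly (\<lambda>S. eval2 S x1 x3) P) y1"

text \<open>\<open>eval4\<close> demands a field. The same formula over a commutative ring can also
  be evaluated inside the polynomial ring itself, where the integral identities are proved.\<close>

definition peval :: "int poly poly poly poly \<Rightarrow> 'r::comm_ring_1 \<Rightarrow> 'r \<Rightarrow> 'r \<Rightarrow> 'r \<Rightarrow> 'r" where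
  "peval P x1 x3 y1 y3 = poly (map_poly (\<lambda>S. eval3 S x1 x3 y1) P) y3"

lemma eval4_eq_peval: "eval4 P x1 x3 y1 y3 = peval P x1 x3 y1 y3"
  by (simp add: eval4_def peval_def eval3_def eval2_def eval1_def)

lemma ring_hom_total_eval1: "ring_hom_total (\<lambda>P. eval1 P x1)"
  unfolding eval1_def by (intro ring_hom_total_poly_map_poly ring_hom_total_of_int)

lemma ring_hom_total_eval2: "ring_hom_total (\<lambda>P. eval2 P x1 x3)"
  unfolding eval2_def by (intro ring_hom_total_poly_map_poly ring_hom_total_eval1)

lemma ring_hom_total_eval3: "ring_hom_total (\<lambda>P. eval3 P x1 x3 y1)"
  unfolding eval3_def by (intro ring_hom_total_poly_map_poly ring_hom_total_eval2)

lemma ring_hom_total_peval: "ring_hom_total (\<lambda>P. peval P x1 x3 y1 y3)"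
  unfolding peval_def by (intro ring_hom_total_poly_map_poly ring_hom_total_eval3)

abbreviation "X1 \<equiv> [:[:[:[:0, 1:]:]:]:] :: int poly poly poly poly"
abbreviation "X3 \<equiv> [:[:[:0, 1:]:]:] :: int poly poly poly poly"
abbreviation "Y1 \<equiv> [:[:0, 1:]:] :: int poly poly poly poly"
abbreviation "Y3 \<equiv> [:0, 1:] :: int poly poly poly poly"

lemma peval_indets:
  "peval X1 x1 x3 y1 y3 = x1" "peval X3 x1 x3 y1 y3 = x3"
  "peval Y1 x1 x3 y1 y3 = y1" "peval Y3 x1 x3 y1 y3 = y3"
proof -
  note z = ring_hom_on.hom_zero[OF ring_hom_total_eval1] ring_hom_on.hom_one[OF ring_hom_total_eval1]
    ring_hom_on.hom_zero[OF ring_hom_total_eval2] ring_hom_on.hom_one[OF ring_hom_total_eval2]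
    ring_hom_on.hom_zero[OF ring_hom_total_eval3] ring_hom_on.hom_one[OF ring_hom_total_eval3]
  have 1: "eval1 [:0, 1:] x1 = x1"
    by (simp add: eval1_def map_poly_pCons)
  have 2: "eval2 [:[:0, 1:]:] x1 x3 = x1" "eval2 [:0, 1:] x1 x3 = x3"
    by (simp_all add: eval2_def map_poly_pCons z 1)
  have 3: "eval3 [:[:[:0, 1:]:]:] x1 x3 y1 = x1" "eval3 [:[:0, 1:]:] x1 x3 y1 = x3"
      "eval3 [:0, 1:] x1 x3 y1 = y1"
    by (simp_all add: eval3_def map_poly_pCons z 2)
  show "peval X1 x1 x3 y1 y3 = x1" "peval X3 x1 x3 y1 y3 = x3"
      "peval Y1 x1 x3 y1 y3 = y1" "peval Y3 x1 x3 y1 y3 = y3"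
    by (simp_all add: peval_def map_poly_pCons z 3)
qed

context ring_hom_on
begin

lemma
  assumes "x1 \<in> S" "x3 \<in> S" "y1 \<in> S" "y3 \<in> S"
  shows peval_closed: "peval P x1 x3 y1 y3 \<in> S"
    and hom_peval: "h (peval P x1 x3 y1 y3) = peval P (h x1) (h x3) (h y1) (h y3)"
proof -
  note z = ring_hom_on.hom_zero[OF ring_hom_total_eval1] ring_hom_on.hom_zero[OF ring_hom_total_eval2]
    ring_hom_on.hom_zero[OF ring_hom_total_eval3]
  have 1: "eval1 Q x1 \<in> S" for Q
    unfolding eval1_def by (rule poly_map_poly_closed) (auto simp: closed assms)
  have 2: "eval2 Q x1 x3 \<in> S" for Q
    unfolding eval2_def by (rule poly_map_poly_closed) (auto simp: 1 assms z)
  have 3: "eval3 Q x1 x3 y1 \<in> S" for Q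
    unfolding eval3_def by (rule poly_map_poly_closed) (auto simp: 2 assms z)
  show "peval P x1 x3 y1 y3 \<in> S"
    unfolding peval_def by (rule poly_map_poly_closed) (auto simp: 3 assms z)
  have h1: "h (eval1 Q x1) = eval1 Q (h x1)" for Q
    unfolding eval1_def by (subst hom_poly_map_poly) (auto simp: closed assms hom)
  have h2: "h (eval2 Q x1 x3) = eval2 Q (h x1) (h x3)" for Q
    unfolding eval2_def by (subst hom_poly_map_poly) (auto simp: 1 h1 assms z)
  have h3: "h (eval3 Q x1 x3 y1) = eval3 Q (h x1) (h x3) (h y1)" for Q
    unfolding eval3_def by (subst hom_poly_map_poly) (auto simp: 2 h2 assms z)
  show "h (peval P x1 x3 y1 y3) = peval P (h x1) (h x3) (h y1) (h y3)"
    unfolding peval_def by (subst hom_poly_map_poly) (auto simp: 3 h3 assms z)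
qed

end

section \<open>The first carry of Witt vector addition\<close>

text \<open>An explicit form of \<^const>\<open>witt_carry\<close> that makes sense without division.\<close>

definition carry :: "nat \<Rightarrow> 'r::comm_ring_1 \<Rightarrow> 'r \<Rightarrow> 'r" where
  "carry p x y = - (\<Sum>i\<in>{1..<p}. of_nat ((p choose i) div p) * x ^ i * y ^ (p - i))"

lemma (in subring_set) carry_closed: "x \<in> S \<Longrightarrow> y \<in> S \<Longrightarrow> carry p x y \<in> S"
  unfolding carry_def by (intro closed)

lemma (in ring_hom_on) hom_carry: "x \<in> S \<Longrightarrow> y \<in> S \<Longrightarrow> h (carry p x y) = carry p (h x) (h y)"
  by (simp add: carry_def hom closed)

lemma of_nat_mult_carry:
  assumes "prime p"
  shows "of_nat p * carry p x y = x ^ p + y ^ p - (x + y) ^ p"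
proof -
  have p: "p > 1" using assms prime_gt_1_nat by auto
  have "{..p} = insert 0 (insert p {1..<p})" using p by auto
  then have "(x + y) ^ p = y ^ p + x ^ p + (\<Sum>i\<in>{1..<p}. of_nat (p choose i) * x ^ i * y ^ (p - i))"
    using p by (simp add: binomial_ring add_ac)
  moreover have "of_nat p * carry p x y = - (\<Sum>i\<in>{1..<p}. of_nat (p choose i) * x ^ i * y ^ (p - i))"
  proof -
    have "of_nat p * (of_nat ((p choose i) div p) * x ^ i * y ^ (p - i))
        = of_nat (p choose i) * x ^ i * y ^ (p - i)" if "i \<in> {1..<p}" for i
    proof -
      have "p dvd p choose i" using that assms by (intro dvd_choose_prime) auto
      then show ?thesis by (metis dvd_mult_div_cancel mult.assoc of_nat_mult)
    qed
    then show ?thesis by (simp add: carry_def sum_distrib_left)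
  qed
  ultimately show ?thesis by simp
qed

lemma dvd_carry_right: "y dvd carry p x y"
proof -
  have "y dvd of_nat ((p choose i) div p) * x ^ i * y ^ (p - i)" if "i \<in> {1..<p}" for i
    using that by (intro dvd_mult) auto
  then show ?thesis unfolding carry_def dvd_minus_iff by (rule dvd_sum)
qed

lemma carry_0_right: "carry p x 0 = 0"
  using dvd_carry_right[of 0 p x] by simp

text \<open>The difference is \<open>y ^ p - of_nat p * carry p x y\<close>. Since \<open>y\<close>
  divides the carry, the second term gains a factor p; for the first,
  \<open>k * p \<ge> Suc k\<close>.\<close>

lemma power_dvd_power_add_diff:
  fixes x y :: "'r::comm_ring_1"
  assumes "prime p" "k > 0" "of_nat p ^ k dvd y"
  shows "of_nat p ^ Suc k dvd (x + y) ^ p - x ^ p"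
proof -
  have p: "p \<ge> 2" using assms(1) prime_ge_2_nat by auto
  have "of_nat p ^ Suc k dvd of_nat p * carry p x y"
    using dvd_trans[OF assms(3) dvd_carry_right] by (simp add: mult_dvd_mono)
  moreover have "of_nat p ^ Suc k dvd y ^ p"
  proof -
    have "Suc k \<le> k * p" using p assms(2) mult_le_mono2[OF p, of k] by linarith
    then have "of_nat p ^ Suc k dvd (of_nat p ^ (k * p) :: 'r)" by (rule le_imp_power_dvd)
    also have "\<dots> dvd y ^ p" using dvd_power_same[OF assms(3)] by (simp add: power_mult)
    finally show ?thesis .
  qed
  ultimately have "of_nat p ^ Suc k dvd y ^ p - of_nat p * carry p x y" by (intro dvd_diff)
  then show ?thesis by (simp add: of_nat_mult_carry[OF assms(1)])
qed

lemma frobenius_sum_dvd: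
  fixes f :: "'i \<Rightarrow> 'r::comm_ring_1"
  assumes "prime p"
  shows "of_nat p dvd (\<Sum>i\<in>A. f i) ^ p - (\<Sum>i\<in>A. f i ^ p)"
proof (induction A rule: infinite_finite_induct)
  case (insert a A)
  have "(f a + sum f A) ^ p - (f a ^ p + (\<Sum>i\<in>A. f i ^ p))
     = (sum f A ^ p - (\<Sum>i\<in>A. f i ^ p)) - of_nat p * carry p (f a) (sum f A)"
    by (simp add: of_nat_mult_carry[OF assms])
  then show ?case using insert
    by (simp only: sum.insert[OF insert.hyps] dvd_diff dvd_triv_left)
qed (simp_all add: zero_power prime_gt_0_nat assms)

lemma of_nat_power_prime_dvd:
  assumes "prime p"
  shows "(of_nat p :: 'r::comm_ring_1) dvd of_nat n ^ p - of_nat n"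
proof (induction n)
  case (Suc n)
  have "(of_nat (Suc n) ^ p - of_nat (Suc n) :: 'r) = (of_nat n ^ p - of_nat n) - of_nat p * carry p 1 (of_nat n)"
    by (simp add: of_nat_mult_carry[OF assms])
  then show ?case using Suc by (simp only: dvd_diff dvd_triv_left)
qed (simp add: zero_power prime_gt_0_nat assms)

text \<open>The carry is an integer polynomial, so modulo p its p-th power only moves the exponent
  onto the variables; Fermat's little theorem removes it from the coefficients. Oddness of p
  preserves the leading minus sign.\<close>

lemma carry_power_cong:
  assumes "prime p" "odd p"
  shows "(of_nat p :: 'r::comm_ring_1) dvd carry p x y ^ p - carry p (x ^ p) (y ^ p)"
proof -
  let ?c = "\<lambda>i. of_nat ((p choose i) div p) :: 'r"
  let ?s = "\<Sum>i\<in>{1..<p}. ?c i * x ^ i * y ^ (p - i)"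
  let ?t = "\<Sum>i\<in>{1..<p}. (?c i * x ^ i * y ^ (p - i)) ^ p"
  let ?u = "\<Sum>i\<in>{1..<p}. ?c i * (x ^ p) ^ i * (y ^ p) ^ (p - i)"
  have "of_nat p dvd ?s ^ p - ?t" by (rule frobenius_sum_dvd[OF assms(1)])
  moreover have "of_nat p dvd ?t - ?u"
  proof -
    have "(?c i * x ^ i * y ^ (p - i)) ^ p - ?c i * (x ^ p) ^ i * (y ^ p) ^ (p - i)
       = (?c i ^ p - ?c i) * ((x ^ p) ^ i * (y ^ p) ^ (p - i))" for i
      by (simp add: power_mult_distrib left_diff_distrib mult.assoc mult.commute[of p] flip: power_mult)
    then show ?thesis
      unfolding sum_subtractf[symmetric] by (auto intro!: dvd_sum dvd_mult2 of_nat_power_prime_dvd[OF assms(1)] simp del: of_nat_power)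
  qed
  ultimately have "of_nat p dvd (?s ^ p - ?t) + (?t - ?u)" by (rule dvd_add)
  then have "of_nat p dvd ?s ^ p - ?u" by (simp only: diff_add_cancel add_diff_eq)
  moreover have "carry p x y ^ p - carry p (x ^ p) (y ^ p) = - (?s ^ p - ?u)"
    using assms(2) by (simp add: carry_def)
  ultimately show ?thesis by (simp only: dvd_minus_iff)
qed

lemma witt_carry_eq_carry:
  fixes x :: "'r::{idom_divide,ring_char_0}"
  assumes "prime p"
  shows "witt_carry p x y = carry p x y"
  unfolding witt_carry_def of_nat_mult_carry[OF assms, symmetric]
  using assms prime_gt_0_nat by (intro nonzero_mult_div_cancel_left) auto

lemma of_nat_prime_cancel:
  fixes x y :: "'r::{idom,ring_char_0}"
  assumes "prime p" "of_nat p * x = of_nat p * y"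
  shows "x = y"
  using assms prime_gt_0_nat by auto

text \<open>The pattern of the identities that follow: in the polynomial ring over the integers p
  can be cancelled, and evaluation carries the result to any commutative ring, in particular to
  characteristic p.\<close>

lemma carry_commute:
  fixes x y :: "'r::comm_ring_1"
  assumes "prime p"
  shows "carry p x y = carry p y x"
proof -
  interpret h: ring_hom_on UNIV "\<lambda>P. peval P x y 0 0" by (rule ring_hom_total_peval)
  have "carry p X1 X3 = carry p X3 X1"
    by (rule of_nat_prime_cancel[OF assms]) (simp only: of_nat_mult_carry[OF assms] add.commute)
  then have "peval (carry p X1 X3) x y 0 0 = peval (carry p X3 X1) x y 0 0"
    by (rule arg_cong)
  then show ?thesis by (simp only: h.hom_carry UNIV_I peval_indets)
qed

text \<open>p times the carry is the coboundary of the map x -> x^p, hence a 2-cocycle. This is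
  associativity of Witt addition in the second component.\<close>

lemma carry_cocycle:
  fixes x y z :: "'r::comm_ring_1"
  assumes "prime p"
  shows "carry p x y + carry p (x + y) z = carry p y z + carry p x (y + z)"
proof -
  interpret h: ring_hom_on UNIV "\<lambda>P. peval P x y z 0" by (rule ring_hom_total_peval)
  have "carry p X1 X3 + carry p (X1 + X3) Y1 = carry p X3 Y1 + carry p X1 (X3 + Y1)"
    by (rule of_nat_prime_cancel[OF assms])
      (simp only: of_nat_mult_carry[OF assms] ring_distribs, simp only: add_ac diff_conv_add_uminus minus_add_cancel)
  then have "peval (carry p X1 X3 + carry p (X1 + X3) Y1) x y z 0
      = peval (carry p X3 Y1 + carry p X1 (X3 + Y1)) x y z 0"
    by (rule arg_cong)
  then show ?thesis by (simp only: h.hom_carry h.hom_add UNIV_I peval_indets)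
qed

text \<open>Adding 1 to x repeatedly makes the p-th powers telescope. In characteristic p the
  right-hand side is 1: the p-fold sum of the Witt vector (1, 0) is (0, 1).\<close>

lemma sum_carry_1:
  fixes x :: "'r::comm_ring_1"
  assumes "prime p"
  shows "(\<Sum>j<p. carry p 1 (x + of_nat j)) = 1 - of_nat p ^ (p - 1) + carry p x (of_nat p)"
proof -
  interpret h: ring_hom_on UNIV "\<lambda>P. peval P x 0 0 0" by (rule ring_hom_total_peval)
  have "p > 0" using assms prime_gt_0_nat by auto
  have "(\<Sum>j<p. carry p 1 (X1 + of_nat j)) = 1 - of_nat p ^ (p - 1) + carry p X1 (of_nat p)"
  proof (rule of_nat_prime_cancel[OF assms])
    have "of_nat p * (\<Sum>j<p. carry p 1 (X1 + of_nat j))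
       = (\<Sum>j<p. 1 + ((X1 + of_nat j) ^ p - (X1 + of_nat (Suc j)) ^ p))"
      unfolding sum_distrib_left of_nat_mult_carry[OF assms] power_one of_nat_Suc
      by (simp only: add_ac add_diff_eq)
    also have "\<dots> = of_nat p + (X1 ^ p - (X1 + of_nat p) ^ p)"
      unfolding sum.distrib sum_lessThan_telescope'[of "\<lambda>j. (X1 + of_nat j) ^ p"] by simp
    also have "\<dots> = of_nat p * (1 - of_nat p ^ (p - 1) + carry p X1 (of_nat p))"
      using \<open>p > 0\<close> power_minus_mult[of p "of_nat p :: int poly poly poly poly"]
      by (simp only: ring_distribs of_nat_mult_carry[OF assms]) (simp add: mult.commute)
    finally show "of_nat p * (\<Sum>j<p. carry p 1 (X1 + of_nat j))
       = of_nat p * (1 - of_nat p ^ (p - 1) + carry p X1 (of_nat p))" .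
  qed
  then have "peval (\<Sum>j<p. carry p 1 (X1 + of_nat j)) x 0 0 0
      = peval (1 - of_nat p ^ (p - 1) + carry p X1 (of_nat p)) x 0 0 0"
    by (rule arg_cong)
  then show ?thesis by (simp only: h.hom_carry h.hom UNIV_I peval_indets)
qed

section \<open>The second carry of Witt vector addition\<close>

text \<open>\<open>p\<^sup>2\<close> times the third component of a sum of Witt vectors \<open>(x\<^sub>1, x\<^sub>3, 0) + (y\<^sub>1, y\<^sub>3, 0)\<close>.\<close>

definition witt_num :: "nat \<Rightarrow> 'r::comm_ring_1 \<Rightarrow> 'r \<Rightarrow> 'r \<Rightarrow> 'r \<Rightarrow> 'r" where
  "witt_num p x1 x3 y1 y3 = x1 ^ p\<^sup>2 + y1 ^ p\<^sup>2 - (x1 + y1) ^ p\<^sup>2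
    + of_nat p * (x3 ^ p + y3 ^ p - (x3 + carry p x1 y1 + y3) ^ p)"

text \<open>Let c be the first carry. Modulo p^2 the first three terms equal p times
  \<open>carry p (x1 ^ p) (y1 ^ p)\<close>, hence p c^p. Modulo p the bracket equals - c^p, so the
  two contributions cancel.\<close>

lemma witt_num_dvd:
  fixes x1 :: "'r::comm_ring_1"
  assumes "prime p" "odd p"
  shows "of_nat (p\<^sup>2) dvd witt_num p x1 x3 y1 y3"
proof -
  let ?c = "carry p x1 y1" and ?P = "of_nat p :: 'r"
  have q: "z ^ p\<^sup>2 = (z ^ p) ^ p" for z :: 'r
    by (simp add: power2_eq_square power_mult)
  have "?P ^ Suc 1 dvd (x1 ^ p + y1 ^ p + - (?P * ?c)) ^ p - (x1 ^ p + y1 ^ p) ^ p"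
    by (rule power_dvd_power_add_diff[OF assms(1)]) auto
  moreover have "(x1 + y1) ^ p = x1 ^ p + y1 ^ p + - (?P * ?c)"
    by (simp add: of_nat_mult_carry[OF assms(1)])
  ultimately have 1: "?P\<^sup>2 dvd (x1 + y1) ^ p\<^sup>2 - (x1 ^ p + y1 ^ p) ^ p"
    unfolding q by (simp only: numeral_2_eq_2 One_nat_def)
  have 2: "?P\<^sup>2 dvd ?P * (?c ^ p - carry p (x1 ^ p) (y1 ^ p))"
    unfolding power2_eq_square by (intro mult_dvd_mono carry_power_cong assms dvd_refl)
  have "?P dvd (\<Sum>i\<in>{0..<3::nat}. [x3, ?c, y3] ! i) ^ p - (\<Sum>i\<in>{0..<3::nat}. ([x3, ?c, y3] ! i) ^ p)"
    by (rule frobenius_sum_dvd[OF assms(1)])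
  then have "?P dvd (x3 + ?c + y3) ^ p - (x3 ^ p + ?c ^ p + y3 ^ p)"
    by (simp add: numeral_3_eq_3)
  then have 3: "?P\<^sup>2 dvd ?P * ((x3 + ?c + y3) ^ p - (x3 ^ p + ?c ^ p + y3 ^ p))"
    unfolding power2_eq_square by (intro mult_dvd_mono dvd_refl)
  have "witt_num p x1 x3 y1 y3 = - ((x1 + y1) ^ p\<^sup>2 - (x1 ^ p + y1 ^ p) ^ p)
     + (- (?P * (?c ^ p - carry p (x1 ^ p) (y1 ^ p)))
     + - (?P * ((x3 + ?c + y3) ^ p - (x3 ^ p + ?c ^ p + y3 ^ p))))"
    by (simp add: witt_num_def ring_distribs of_nat_mult_carry[OF assms(1)] q)
  moreover have "?P\<^sup>2 dvd \<dots>"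
    by (intro dvd_add) (simp_all only: dvd_minus_iff 1 2 3)
  ultimately show ?thesis by (simp del: dvd_minus_iff)
qed

text \<open>The quotient of \<open>witt_num\<close> by p^2. Going through the integer polynomial
  \<open>D2_int\<close> gives it a meaning in rings where p^2 cannot be cancelled.\<close>

definition carry2 :: "nat \<Rightarrow> 'r::comm_ring_1 \<Rightarrow> 'r \<Rightarrow> 'r \<Rightarrow> 'r \<Rightarrow> 'r" where
  "carry2 p x1 x3 y1 y3 = peval (D2_int p) x1 x3 y1 y3"

lemma (in ring_hom_on)
  assumes "x1 \<in> S" "x3 \<in> S" "y1 \<in> S" "y3 \<in> S"
  shows carry2_closed: "carry2 p x1 x3 y1 y3 \<in> S"
    and hom_carry2: "h (carry2 p x1 x3 y1 y3) = carry2 p (h x1) (h x3) (h y1) (h y3)"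
  unfolding carry2_def by (simp_all add: hom_peval peval_closed assms)

lemma of_nat_mult_carry2:
  fixes x1 :: "'r::comm_ring_1"
  assumes "prime p" "odd p"
  shows "of_nat (p\<^sup>2) * carry2 p x1 x3 y1 y3 = witt_num p x1 x3 y1 y3"
proof -
  interpret h: ring_hom_on UNIV "\<lambda>P. peval P x1 x3 y1 y3" by (rule ring_hom_total_peval)
  have "D2_int p = witt_num p X1 X3 Y1 Y3 div of_nat (p\<^sup>2)"
    by (simp only: D2_int_def Let_def witt_num_def witt_carry_eq_carry[OF assms(1)])
  then have "of_nat (p\<^sup>2) * D2_int p = witt_num p X1 X3 Y1 Y3"
    by (simp only: dvd_mult_div_cancel witt_num_dvd[OF assms])
  then have "peval (of_nat (p\<^sup>2) * D2_int p) x1 x3 y1 y3 = peval (witt_num p X1 X3 Y1 Y3) x1 x3 y1 y3"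
    by (rule arg_cong)
  then show ?thesis
    by (simp only: h.hom UNIV_I carry2_def witt_num_def h.hom_carry peval_indets)
qed

lemma of_nat_prime_sq_cancel:
  fixes x y :: "'r::{idom,ring_char_0}"
  assumes "prime p" "of_nat (p\<^sup>2) * x = of_nat (p\<^sup>2) * y"
  shows "x = y"
  using assms prime_gt_0_nat by auto

text \<open>Both sides are the third component of X + Y + Z, with Y and Z added in opposite orders.
  After multiplication by p^2 the terms telescope, as soon as the second components of both sums are
  known to agree; that is the cocycle identity of the first carry.\<close>

lemma carry2_assoc_aux:
  fixes x1 :: "'r::{idom,ring_char_0}"
  assumes "prime p" "odd p"
  shows "carry2 p x1 x3 y1 y3 + carry2 p (x1 + y1) (x3 + carry p x1 y1 + y3) z1 z3
    = carry2 p x1 x3 z1 z3 + carry2 p (x1 + z1) (x3 + carry p x1 z1 + z3) y1 y3"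
proof (rule of_nat_prime_sq_cancel[OF assms(1)])
  let ?u = "x3 + carry p x1 y1 + y3" and ?v = "x3 + carry p x1 z1 + z3"
  have "carry p x1 y1 + carry p (x1 + y1) z1 = carry p x1 z1 + carry p (x1 + z1) y1"
    using carry_cocycle[OF assms(1), of y1 x1 z1] carry_commute[OF assms(1), of y1 x1]
      carry_commute[OF assms(1), of y1 "x1 + z1"]
    by (simp add: add.commute)
  then have 1: "?u + carry p (x1 + y1) z1 + z3 = ?v + carry p (x1 + z1) y1 + y3"
    by (simp add: algebra_simps)
  have 2: "x1 + y1 + z1 = x1 + z1 + y1" by simp
  show "of_nat (p\<^sup>2) * (carry2 p x1 x3 y1 y3 + carry2 p (x1 + y1) ?u z1 z3)
    = of_nat (p\<^sup>2) * (carry2 p x1 x3 z1 z3 + carry2 p (x1 + z1) ?v y1 y3)"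
    unfolding distrib_left of_nat_mult_carry2[OF assms] witt_num_def 1 2
    by (simp add: ring_distribs)
qed

text \<open>The four indeterminates of \<open>peval\<close> are taken up by X and Y. The third
  vector has integer entries, which every evaluation preserves; the vectors added later are (1, 0)
  and (0, 1).\<close>

lemma carry2_assoc:
  fixes x1 :: "'r::comm_ring_1" and z1 z3 :: int
  assumes "prime p" "odd p"
  shows "carry2 p x1 x3 y1 y3 + carry2 p (x1 + y1) (x3 + carry p x1 y1 + y3) (of_int z1) (of_int z3)
    = carry2 p x1 x3 (of_int z1) (of_int z3)
      + carry2 p (x1 + of_int z1) (x3 + carry p x1 (of_int z1) + of_int z3) y1 y3"
proof -
  interpret h: ring_hom_on UNIV "\<lambda>P. peval P x1 x3 y1 y3" by (rule ring_hom_total_peval)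
  note arg_cong[OF carry2_assoc_aux[OF assms, of X1 X3 Y1 Y3 "of_int z1" "of_int z3"],
    of "\<lambda>P. peval P x1 x3 y1 y3"]
  then show ?thesis by (simp only: h.hom UNIV_I h.hom_carry h.hom_carry2 peval_indets)
qed

text \<open>Adding (0, 1, 0) is addition of 1 shifted up by one component, so the first carry
  reappears one level higher.\<close>

lemma carry2_0_1:
  fixes x1 :: "'r::comm_ring_1"
  assumes "prime p" "odd p"
  shows "carry2 p x1 x3 0 1 = carry p 1 x3"
proof -
  interpret h: ring_hom_on UNIV "\<lambda>P. peval P x1 x3 0 0" by (rule ring_hom_total_peval)
  have "p > 0" using assms prime_gt_0_nat by auto
  have "of_nat (p\<^sup>2) * carry2 p X1 X3 0 1 = of_nat (p\<^sup>2) * carry p 1 X3"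
  proof -
    have "of_nat (p\<^sup>2) * carry p 1 X3 = of_nat p * (of_nat p * carry p 1 X3)"
      by (simp only: power2_eq_square of_nat_mult mult.assoc)
    also have "\<dots> = witt_num p X1 X3 0 1"
      unfolding of_nat_mult_carry[OF assms(1)] witt_num_def carry_0_right
      using \<open>p > 0\<close> by (simp only: zero_power zero_less_power power_one add_0_right add.commute diff_self add_0)
    finally show ?thesis by (simp only: of_nat_mult_carry2[OF assms])
  qed
  then have "peval (carry2 p X1 X3 0 1) x1 x3 0 0 = peval (carry p 1 X3) x1 x3 0 0"
    using of_nat_prime_sq_cancel[OF assms(1)] by metis
  then show ?thesis by (simp only: h.hom UNIV_I h.hom_carry h.hom_carry2 peval_indets)
qed

text \<open>\<open>c j\<close> is the gain of the second component after adding (1, 0, 0)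
  \<open>j\<close> times. Modulo p, the p-fold addition of (1, 0, 0) changes the third component
  just as one addition of (0, 1, 0) does.\<close>

lemma sum_carry2_aux:
  fixes x1 x3 :: "'r::{idom,ring_char_0}"
  assumes "prime p" "odd p"
  defines "c \<equiv> \<lambda>j. \<Sum>i<j. carry p 1 (x1 + of_nat i)"
  shows "of_nat p dvd (\<Sum>j<p. carry2 p (x1 + of_nat j) (x3 + c j) 1 0) - carry p 1 x3"
proof -
  let ?P = "of_nat p :: 'r"
  have "p > 0" using assms prime_gt_0_nat by auto
  have q: "z ^ p\<^sup>2 = (z ^ p) ^ p" for z :: 'r
    by (simp add: power2_eq_square power_mult)
  have sq: "of_nat (p\<^sup>2) = ?P * ?P" by (simp add: power2_eq_square)
  have c: "x3 + c j + carry p (x1 + of_nat j) 1 + 0 = x3 + c (Suc j)" for j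
    by (simp add: c_def carry_commute[OF assms(1), of _ 1])
  have "?P * ?P * (\<Sum>j<p. carry2 p (x1 + of_nat j) (x3 + c j) 1 0)
     = (\<Sum>j<p. witt_num p (x1 + of_nat j) (x3 + c j) 1 0)"
    unfolding sum_distrib_left sq[symmetric] of_nat_mult_carry2[OF assms(1,2)] ..
  also have "\<dots> = (\<Sum>j<p. ((x1 + of_nat j) ^ p\<^sup>2 - (x1 + of_nat (Suc j)) ^ p\<^sup>2) + 1
      + ?P * ((x3 + c j) ^ p - (x3 + c (Suc j)) ^ p))"
    using \<open>p > 0\<close> unfolding witt_num_def c by (intro sum.cong) (simp_all add: algebra_simps zero_power)
  also have "\<dots> = (x1 ^ p\<^sup>2 - (x1 + ?P) ^ p\<^sup>2) + ?P + ?P * (x3 ^ p - (x3 + c p) ^ p)"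
    unfolding sum.distrib sum_distrib_left[symmetric]
      sum_lessThan_telescope'[of "\<lambda>j. (x1 + of_nat j) ^ p\<^sup>2"]
      sum_lessThan_telescope'[of "\<lambda>j. (x3 + c j) ^ p"] by (simp add: c_def)
  finally have "?P * ?P * ((\<Sum>j<p. carry2 p (x1 + of_nat j) (x3 + c j) 1 0) - carry p 1 x3)
     = (x1 ^ p\<^sup>2 - (x1 + ?P) ^ p\<^sup>2) + ?P + ?P * (x3 ^ p - (x3 + c p) ^ p) - ?P * (?P * carry p 1 x3)"
    by (simp only: right_diff_distrib mult.assoc)
  also have "\<dots> = - ((x1 + ?P) ^ p\<^sup>2 - x1 ^ p\<^sup>2) - ?P * ((x3 + c p) ^ p - (x3 + 1) ^ p)"
    unfolding of_nat_mult_carry[OF assms(1)] by (simp add: algebra_simps)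
  \<comment> \<open>The claim has been multiplied by p^2, so a congruence modulo p has become one
    modulo p^3.\<close>
  also have "?P ^ 3 dvd \<dots>"
  proof (rule dvd_diff)
    have "?P ^ Suc 1 dvd (x1 + ?P) ^ p - x1 ^ p"
      by (rule power_dvd_power_add_diff[OF assms(1)]) auto
    then have "?P ^ Suc (Suc 1) dvd (x1 ^ p + ((x1 + ?P) ^ p - x1 ^ p)) ^ p - (x1 ^ p) ^ p"
      by (intro power_dvd_power_add_diff[OF assms(1)]) auto
    then have "?P ^ 3 dvd (x1 + ?P) ^ p\<^sup>2 - x1 ^ p\<^sup>2"
      unfolding q by (simp add: numeral_3_eq_3)
    then show "?P ^ 3 dvd - ((x1 + ?P) ^ p\<^sup>2 - x1 ^ p\<^sup>2)" by (simp only: dvd_minus_iff)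
    \<comment> \<open>The total gain of the second component is 1 modulo p. Taking p-th powers
      improves this to p^2, and the outer factor p supplies the third one.\<close>
    have "?P ^ 1 dvd c p - 1"
    proof -
      have "c p - 1 = carry p x1 ?P - ?P ^ (p - 1)"
        unfolding c_def sum_carry_1[OF assms(1)] by simp
      moreover have "?P dvd ?P ^ (p - 1)"
        using assms(1) prime_ge_2_nat[of p] by (intro dvd_power) auto
      ultimately show ?thesis using dvd_carry_right[of ?P p x1] by (simp add: dvd_diff)
    qed
    then have "?P ^ Suc 1 dvd ((x3 + 1) + (c p - 1)) ^ p - (x3 + 1) ^ p"
      by (intro power_dvd_power_add_diff[OF assms(1)]) auto
    then have "?P * ?P\<^sup>2 dvd ?P * ((x3 + c p) ^ p - (x3 + 1) ^ p)"
      by (intro mult_dvd_mono) (auto simp: numeral_2_eq_2)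
    then show "?P ^ 3 dvd ?P * ((x3 + c p) ^ p - (x3 + 1) ^ p)"
      by (simp add: power3_eq_cube power2_eq_square mult.assoc)
  qed
  finally have "?P * ?P * ?P dvd ?P * ?P * ((\<Sum>j<p. carry2 p (x1 + of_nat j) (x3 + c j) 1 0) - carry p 1 x3)"
    by (simp only: power3_eq_cube)
  then show ?thesis using \<open>p > 0\<close> by simp
qed

lemma sum_carry2:
  fixes x1 x3 :: "'r::comm_ring_1"
  assumes "prime p" "odd p" "of_nat p = (0 :: 'r)"
  shows "(\<Sum>j<p. carry2 p (x1 + of_nat j) (x3 + (\<Sum>i<j. carry p 1 (x1 + of_nat i))) 1 0) = carry p 1 x3"
proof -
  interpret h: ring_hom_on UNIV "\<lambda>P. peval P x1 x3 0 0" by (rule ring_hom_total_peval)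
  obtain W where "(\<Sum>j<p. carry2 p (X1 + of_nat j) (X3 + (\<Sum>i<j. carry p 1 (X1 + of_nat i))) 1 0) - carry p 1 X3
     = of_nat p * W"
    using sum_carry2_aux[OF assms(1,2), of X1 X3] by (rule dvdE)
  note arg_cong[OF this, of "\<lambda>P. peval P x1 x3 0 0"]
  then show ?thesis
    by (simp only: h.hom UNIV_I h.hom_carry h.hom_carry2 peval_indets assms(3) mult_zero_left right_minus_eq)
qed

section \<open>Artin-Schreier theory in characteristic \<open>p\<close>\<close>

locale prime_char =
  fixes p :: nat and ty :: "'a::field itself"
  assumes prime_p: "prime p" and odd_p: "odd p" and char_p: "CHAR('a) = p"
begin

lemma p_gt_1: "p > 1"
  using prime_p prime_gt_1_nat by blast

lemma p_gt_0: "p > 0"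
  using p_gt_1 by simp

lemma of_nat_p: "of_nat p = (0::'a)"
  using of_nat_CHAR[where 'a = 'a] char_p by simp

lemma of_nat_eq_iff_less: "i < p \<Longrightarrow> j < p \<Longrightarrow> of_nat i = (of_nat j :: 'a) \<longleftrightarrow> i = j"
  by (metis char_p cong_less_modulus_unique_nat of_nat_eq_iff_cong_CHAR)

lemma two_neq_0: "(2::'a) \<noteq> 0"
proof -
  have "p > 2" using p_gt_1 odd_p by (cases "p = 2") auto
  then show ?thesis using of_nat_eq_iff_less[of 2 0] by auto
qed

lemma frobenius_add: "((x::'a) + y) ^ p = x ^ p + y ^ p"
  using of_nat_mult_carry[OF prime_p, of x y] of_nat_p by simp

lemma frobenius_hom: "ring_hom_total (\<lambda>x::'a. x ^ p)"
  by (rule ring_hom_totalI) (simp_all add: frobenius_add power_mult_distrib)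

lemma of_nat_power_p: "of_nat n ^ p = (of_nat n :: 'a)"
  by (rule ring_hom_on.hom_of_nat[OF frobenius_hom])

lemma of_int_power_p: "of_int n ^ p = (of_int n :: 'a)"
  by (rule ring_hom_on.hom_of_int[OF frobenius_hom])

lemma AS_add: "AS p ((x::'a) + y) = AS p x + AS p y"
  by (simp add: AS_def frobenius_add)

lemma AS_mult_of_int: "AS p (of_int k * (x::'a)) = of_int k * AS p x"
  by (simp add: AS_def power_mult_distrib of_int_power_p right_diff_distrib)

lemma AS_of_int: "AS p (of_int k :: 'a) = 0"
  by (simp add: AS_def of_int_power_p)

lemma AS_0: "AS p (0 :: 'a) = 0" and AS_1: "AS p (1 :: 'a) = 0"
  using AS_of_int[of 0] AS_of_int[of 1] by auto

lemma AS_diff: "AS p ((x::'a) - y) = AS p x - AS p y"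
  using AS_add[of "x - y" y] by simp

text \<open>The p elements of the prime field are roots of X^p - X, which has at most p
  roots.\<close>

lemma AS_eq_0_imp_of_nat:
  assumes "AS p (x::'a) = 0"
  shows "\<exists>n<p. x = of_nat n"
proof (rule ccontr)
  assume "\<not> ?thesis"
  then have x: "x \<notin> of_nat ` {..<p}" by auto
  let ?P = "monom 1 p - monom 1 1 :: 'a poly"
  have c: "coeff ?P p = 1" using p_gt_1 by (simp add: coeff_monom)
  then have "?P \<noteq> 0" by (metis coeff_0 zero_neq_one)
  have "degree ?P \<le> p" using p_gt_1 by (intro degree_diff_le) (auto simp: degree_monom_eq)
  have "inj_on (of_nat :: nat \<Rightarrow> 'a) {..<p}"
    by (auto intro!: inj_onI simp: of_nat_eq_iff_less)
  then have "card (insert x (of_nat ` {..<p})) = Suc p"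
    using x by (simp add: card_image)
  moreover have "insert x (of_nat ` {..<p}) \<subseteq> {z. poly ?P z = 0}"
    using assms by (auto simp: AS_def poly_monom of_nat_power_p)
  moreover have "card {z. poly ?P z = 0} \<le> p" "finite {z. poly ?P z = 0}"
    using card_poly_roots_bound[OF \<open>?P \<noteq> 0\<close>] poly_roots_finite[OF \<open>?P \<noteq> 0\<close>] \<open>degree ?P \<le> p\<close> by auto
  ultimately show False by (metis card_mono not_less_eq_eq order_trans)
qed

lemma D1_eq_carry: "D1 p (x::'a) = carry p x (AS p x)"
proof -
  interpret h: ring_hom_on UNIV "\<lambda>P. eval1 P x" by (rule ring_hom_total_eval1)
  have x: "eval1 [:0, 1:] x = x" by (simp add: eval1_def map_poly_pCons)
  show ?thesis
    by (simp only: D1_def D1_int_def witt_carry_eq_carry[OF prime_p] AS_def eval1_def[symmetric]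
        h.hom_carry h.hom UNIV_I x)
qed

text \<open>The cocycle identity for 1, x and \<open>AS p x\<close>. Since x plus
  \<open>AS p x\<close> is x^p, one of its carries is \<open>carry p 1 (x ^ p)\<close>, which is the
  Frobenius image of \<open>carry p 1 x\<close>.\<close>

lemma D1_shift: "D1 p ((x::'a) + 1) = D1 p x + AS p (carry p 1 x)"
proof -
  have "carry p 1 x + carry p (1 + x) (AS p x) = carry p x (AS p x) + carry p 1 (x ^ p)"
    using carry_cocycle[OF prime_p, of 1 x "AS p x"] by (simp add: AS_def)
  moreover have "carry p 1 (x ^ p) = carry p 1 x ^ p"
    using ring_hom_on.hom_carry[OF frobenius_hom, of 1 x] by simp
  ultimately show ?thesis
    by (simp add: D1_eq_carry AS_add AS_1 AS_def[of p "carry p 1 x"] algebra_simps)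
qed

lemma sum_carry_1_eq_1: "(\<Sum>j<p. carry p 1 ((x::'a) + of_nat j)) = 1"
  using p_gt_1 by (simp add: sum_carry_1[OF prime_p] of_nat_p carry_0_right zero_power)

lemma D2_eq_carry2: "D2 p (x1::'a) x3 = carry2 p x1 x3 (AS p x1) (AS p x3 - D1 p x1)"
  by (simp add: D2_def eval4_eq_peval carry2_def)

lemma carry2_frobenius: "carry2 p ((x1::'a) ^ p) (x3 ^ p) (of_int z1) (of_int z3)
    = carry2 p x1 x3 (of_int z1) (of_int z3) ^ p"
  using ring_hom_on.hom_carry2[OF frobenius_hom, of x1 x3 "of_int z1" "of_int z3" p]
  by (simp add: of_int_power_p)

text \<open>Adding the constant Witt vector \<open>(z\<^sub>1, z\<^sub>3, 0)\<close> commutes with Frobenius.\<close>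

lemma D2_shift:
  assumes "D1 p (x1 + of_int z1) = D1 p (x1::'a) + AS p (carry p x1 (of_int z1))"
  shows "D2 p (x1 + of_int z1) (x3 + carry p x1 (of_int z1) + of_int z3)
    = D2 p x1 x3 + AS p (carry2 p x1 x3 (of_int z1) (of_int z3))"
proof -
  let ?b1 = "AS p x1" and ?b3 = "AS p x3 - D1 p x1"
  \<comment> \<open>The Witt vector \<open>(?b1, ?b3)\<close> is F X - X for X = (x1, x3), so adding
    it to X gives F X.\<close>
  have 1: "x1 + ?b1 = x1 ^ p" "x3 + carry p x1 ?b1 + ?b3 = x3 ^ p"
    by (simp_all add: AS_def D1_eq_carry)
  have 2: "AS p (x3 + carry p x1 (of_int z1) + of_int z3) - D1 p (x1 + of_int z1) = ?b3"
    unfolding assms by (simp add: AS_add AS_of_int)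
  have "carry2 p x1 x3 ?b1 ?b3 + carry2 p (x1 ^ p) (x3 ^ p) (of_int z1) (of_int z3)
    = carry2 p x1 x3 (of_int z1) (of_int z3)
      + carry2 p (x1 + of_int z1) (x3 + carry p x1 (of_int z1) + of_int z3) ?b1 ?b3"
    using carry2_assoc[OF prime_p odd_p, of x1 x3 ?b1 ?b3 z1 z3] unfolding 1 .
  then show ?thesis
    unfolding D2_eq_carry2 2 carry2_frobenius AS_add[of x1] AS_of_int add_0_right
    by (simp add: AS_def[of p "carry2 p _ _ _ _"] algebra_simps)
qed

lemma D2_shift_1:
  "D2 p ((x1::'a) + 1) (x3 + carry p 1 x1) = D2 p x1 x3 + AS p (carry2 p x1 x3 1 0)"
  using D2_shift[of x1 1 x3 0] D1_shift[of x1] by (simp add: carry_commute[OF prime_p, of x1 1])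

lemma D2_shift_3: "D2 p (x1::'a) (x3 + 1) = D2 p x1 x3 + AS p (carry p 1 x3)"
  using D2_shift[of x1 0 x3 1] by (simp add: carry_0_right AS_0 carry2_0_1[OF prime_p odd_p])

end

section \<open>Words and presented groups\<close>

lemma word_class_eq_iff: "word_class R u = word_class R v \<longleftrightarrow> word_eq R u v"
  unfolding word_class_def by (blast intro: word_eq.intros)

lemma presented_group_carrier: "carrier (presented_group R) = range (word_class R)"
  by (simp add: presented_group_def)

lemma presented_group_mult:
  "word_class R u \<otimes>\<^bsub>presented_group R\<^esub> word_class R v = word_class R (u @ v)"
  unfolding presented_group_def word_class_def
  by (auto intro: word_eq.intros)

declare word_eq.trans [trans]

lemma word_eq_cancel_left: "word_eq R (word_inv w @ w) []"
  and word_eq_cancel_right: "word_eq R (w @ word_inv w) []"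
proof (induction w)
  case (Cons x w)
  obtain g e where x: "x = (g, e)" by (cases x)
  {
    case 1
    have "word_eq R (word_inv w @ [(g, \<not> e), (g, \<not> \<not> e)] @ w) (word_inv w @ [] @ w)"
      by (intro word_eq.append word_eq.refl word_eq.cancel)
    also have "word_eq R (word_inv w @ [] @ w) []" using Cons by simp
    finally show ?case by (simp add: word_inv_def x)
  next
    case 2
    have "word_eq R ([(g, e)] @ (w @ word_inv w) @ [(g, \<not> e)]) ([(g, e)] @ [] @ [(g, \<not> e)])"
      using Cons by (intro word_eq.append word_eq.refl) auto
    also have "word_eq R ([(g, e)] @ [] @ [(g, \<not> e)]) []" using word_eq.cancel[of R g e] by simp
    finally show ?case by (simp add: word_inv_def x)
  }
qed (simp_all add: word_inv_def word_eq.refl)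

lemma word_eq_append_left: "word_eq R u v \<Longrightarrow> word_eq R (w @ u) (w @ v)"
  by (intro word_eq.append word_eq.refl)

lemma word_eq_append_right: "word_eq R u v \<Longrightarrow> word_eq R (u @ w) (v @ w)"
  by (intro word_eq.append word_eq.refl)

lemma word_eq_left_cancel:
  assumes "word_eq R (word_inv v @ u) []"
  shows "word_eq R u v"
proof -
  have "word_eq R ([] @ u) ((v @ word_inv v) @ u)"
    by (intro word_eq_append_right word_eq.sym[OF word_eq_cancel_right])
  also have "(v @ word_inv v) @ u = v @ (word_inv v @ u)" by simp
  also have "word_eq R (v @ (word_inv v @ u)) (v @ [])"
    by (intro word_eq_append_left assms)
  finally show ?thesis by simp
qed

text \<open>Such words represent the elements of the subgroup generated by \<open>B\<close>.\<close>

definition words :: "'g set \<Rightarrow> 'g word set" where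
  "words B = {w. fst ` set w \<subseteq> B}"

lemma words_append: "u \<in> words B \<Longrightarrow> v \<in> words B \<Longrightarrow> u @ v \<in> words B"
  by (auto simp: words_def)

lemma words_word_inv: "u \<in> words B \<Longrightarrow> word_inv u \<in> words B"
  by (force simp: words_def word_inv_def)

lemma words_Nil: "[] \<in> words B"
  by (simp add: words_def)

lemma words_concat_replicate: "w \<in> words B \<Longrightarrow> concat (replicate n w) \<in> words B"
  by (fastforce simp: words_def)

lemma words_word_pow: "w \<in> words B \<Longrightarrow> word_pow w k \<in> words B"
  unfolding word_pow_def by (auto intro!: words_concat_replicate words_word_inv)

text \<open>One round of collection in a polycyclic group: a letter of \<open>B\<close> moves past
  \<open>g\<close> to the right and becomes a word in \<open>B\<close>, so the letters
  \<open>g\<close> gather on the left. If h g = g w, then h^-1 g = g w^-1, which covers inverse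
  letters; the power relation keeps the exponent of \<open>g\<close> below p.\<close>

lemma word_normal_form_step:
  fixes R :: "('g word \<times> 'g word) set"
  assumes conj: "\<And>h. h \<in> B \<Longrightarrow> \<exists>w\<in>words B. word_eq R [(h, True), (g, True)] ((g, True) # w)"
    and pow: "v \<in> words B" "word_eq R (replicate p (g, True)) v" and p: "p > 0"
    and u: "u \<in> words (insert g B)"
  shows "\<exists>n<p. \<exists>w\<in>words B. word_eq R u (replicate n (g, True) @ w)"
proof -
  let ?g = "\<lambda>n. replicate n (g, True)"
  have letter: "\<exists>w\<in>words B. word_eq R [(h, e), (g, True)] ((g, True) # w)" if h: "h \<in> B" for h e
  proof (cases e)
    case False
    obtain w where w: "w \<in> words B" "word_eq R [(h, True), (g, True)] ((g, True) # w)"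
      using conj[OF h] by blast
    have "word_eq R ([(h, False), (g, True)] @ []) ([(h, False), (g, True)] @ (w @ word_inv w))"
      by (intro word_eq_append_left word_eq.sym[OF word_eq_cancel_right])
    also have "[(h, False), (g, True)] @ (w @ word_inv w) = [(h, False)] @ ((g, True) # w) @ word_inv w" by simp
    also have "word_eq R \<dots> ([(h, False)] @ [(h, True), (g, True)] @ word_inv w)"
      by (intro word_eq_append_left word_eq_append_right word_eq.sym[OF w(2)])
    also have "\<dots> = [(h, False), (h, \<not> False)] @ ((g, True) # word_inv w)" by simp
    also have "word_eq R \<dots> ([] @ ((g, True) # word_inv w))"
      by (intro word_eq_append_right word_eq.cancel)
    finally show ?thesis using w(1) False by (intro bexI[of _ "word_inv w"]) (auto intro: words_word_inv)
  qed (use conj[OF h] in auto)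
  have word: "\<exists>w\<in>words B. word_eq R (u @ [(g, True)]) ((g, True) # w)" if "u \<in> words B" for u
    using that
  proof (induction u)
    case (Cons x u)
    obtain h e where x: "x = (h, e)" by (cases x)
    from Cons obtain w where w: "w \<in> words B" "word_eq R (u @ [(g, True)]) ((g, True) # w)"
      by (auto simp: words_def)
    obtain w' where w': "w' \<in> words B" "word_eq R [(h, e), (g, True)] ((g, True) # w')"
      using letter[of h e] Cons.prems by (auto simp: words_def x)
    have "word_eq R ([x] @ u @ [(g, True)]) ([x] @ (g, True) # w)"
      by (intro word_eq_append_left w(2))
    also have "[x] @ (g, True) # w = [(h, e), (g, True)] @ w" by (simp add: x)
    also have "word_eq R \<dots> (((g, True) # w') @ w)"
      by (intro word_eq_append_right w'(2))
    finally show ?case using w(1) w'(1) by (intro bexI[of _ "w' @ w"]) (auto intro: words_append)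
  qed (auto intro!: bexI[of _ "[]"] simp: words_Nil word_eq.refl)
  have power: "\<exists>w\<in>words B. word_eq R (u @ ?g n) (?g n @ w)" if "u \<in> words B" for u n
    using that
  proof (induction n arbitrary: u)
    case (Suc n)
    obtain w where w: "w \<in> words B" "word_eq R (u @ [(g, True)]) ((g, True) # w)"
      using word[OF Suc.prems] by blast
    obtain w' where w': "w' \<in> words B" "word_eq R (w @ ?g n) (?g n @ w')"
      using Suc.IH[OF w(1)] by blast
    have "word_eq R ((u @ [(g, True)]) @ ?g n) (((g, True) # w) @ ?g n)"
      by (intro word_eq_append_right w(2))
    also have "((g, True) # w) @ ?g n = [(g, True)] @ (w @ ?g n)" by simp
    also have "word_eq R \<dots> ([(g, True)] @ (?g n @ w'))"
      by (intro word_eq_append_left w'(2))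
    finally show ?case using w'(1) by auto
  qed (auto intro: word_eq.refl)
  show ?thesis
    using u
  proof (induction u)
    case Nil
    then show ?case using p by (intro exI[of _ 0] conjI bexI[of _ "[]"]) (auto simp: words_Nil word_eq.refl)
  next
    case (Cons x u)
    obtain h e where x: "x = (h, e)" by (cases x)
    from Cons obtain n w where n: "n < p" "w \<in> words B" "word_eq R u (?g n @ w)"
      by (auto simp: words_def)
    have *: "word_eq R (x # u) ([x] @ (?g n @ w))"
      using word_eq_append_left[OF n(3), of "[x]"] by simp
    consider "h \<in> B" | "h = g" "e" "Suc n < p" | "h = g" "e" "Suc n = p"
      | "h = g" "\<not> e" "n > 0" | "h = g" "\<not> e" "n = 0"
      using Cons.prems n(1) by (force simp: words_def x)
    then show ?case
    proof cases
      case 1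
      obtain w' where w': "w' \<in> words B" "word_eq R ([x] @ ?g n) (?g n @ w')"
        using power[of "[x]" n] 1 by (auto simp: words_def x)
      have "word_eq R (([x] @ ?g n) @ w) ((?g n @ w') @ w)"
        by (intro word_eq_append_right w'(2))
      then have "word_eq R (x # u) (?g n @ (w' @ w))"
        using * word_eq.trans by fastforce
      then show ?thesis using n(1,2) w'(1) by (blast intro: words_append)
    next
      case 2
      then have "word_eq R (x # u) (?g (Suc n) @ w)" using * by (simp add: x)
      then show ?thesis using n(2) 2 by blast
    next
      case 3
      have "word_eq R (?g p @ w) (v @ w)" by (intro word_eq_append_right pow(2))
      moreover have "[x] @ (?g n @ w) = ?g p @ w" unfolding 3(3)[symmetric] using 3(1,2) by (simp add: x)
      ultimately have "word_eq R (x # u) (v @ w)" using * by (metis word_eq.trans)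
      then show ?thesis using p words_append[OF pow(1) n(2)]
        by (intro exI[of _ 0] conjI bexI[of _ "v @ w"]) simp_all
    next
      case 4
      then obtain m where m: "n = Suc m" by (cases n) auto
      have "word_eq R ([(g, False), (g, \<not> False)] @ (?g m @ w)) ([] @ (?g m @ w))"
        by (intro word_eq_append_right word_eq.cancel)
      then have "word_eq R (x # u) (?g m @ w)"
        using * word_eq.trans 4 by (fastforce simp: m x)
      then show ?thesis using n m by (meson Suc_lessD)
    next
      \<comment> \<open>An inverse letter that finds no \<open>g\<close> to cancel is replaced by
        \<open>p - 1\<close> letters \<open>g\<close> followed by \<open>word_inv v\<close>.\<close>
      case 5
      obtain m where m: "p = Suc m" using p by (cases p) auto
      have "word_eq R ([(g, False)] @ []) ([(g, False)] @ (v @ word_inv v))"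
        by (intro word_eq_append_left word_eq.sym[OF word_eq_cancel_right])
      also have "word_eq R ([(g, False)] @ (v @ word_inv v)) ([(g, False)] @ (?g p @ word_inv v))"
        by (intro word_eq_append_left word_eq_append_right word_eq.sym[OF pow(2)])
      also have "[(g, False)] @ (?g p @ word_inv v) = [(g, False), (g, \<not> False)] @ (?g m @ word_inv v)"
        by (simp add: m)
      also have "word_eq R \<dots> ([] @ (?g m @ word_inv v))"
        by (intro word_eq_append_right word_eq.cancel)
      finally have "word_eq R [(g, False)] (?g m @ word_inv v)" by simp
      then have "word_eq R ([x] @ w) ((?g m @ word_inv v) @ w)"
        using 5 by (intro word_eq_append_right) (simp add: x)
      then have "word_eq R (x # u) (?g m @ (word_inv v @ w))"
        using * word_eq.trans 5 by fastforce
      then show ?thesis using m pow(1) n(2) by (blast intro: words_append words_word_inv)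
    qed
  qed
qed

section \<open>Words of automorphisms and their cocycles\<close>

abbreviation finv :: "('a \<Rightarrow> 'b) \<Rightarrow> 'b \<Rightarrow> 'a" where
  "finv \<equiv> inv_into UNIV"

primrec act :: "('g \<Rightarrow> 'a \<Rightarrow> 'a) \<Rightarrow> 'g word \<Rightarrow> 'a \<Rightarrow> 'a" where
  "act \<sigma> [] = id"
| "act \<sigma> (x # w) = (if snd x then \<sigma> (fst x) else finv (\<sigma> (fst x))) \<circ> act \<sigma> w"

text \<open>The value at a word of the crossed homomorphism with value \<open>f g\<close> at each generator \<open>g\<close>.\<close>

primrec cocyc :: "('g \<Rightarrow> 'a \<Rightarrow> 'a) \<Rightarrow> ('g \<Rightarrow> 'a::field) \<Rightarrow> 'g word \<Rightarrow> 'a" where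
  "cocyc \<sigma> f [] = 0"
| "cocyc \<sigma> f (x # w) = (if snd x then f (fst x) + \<sigma> (fst x) (cocyc \<sigma> f w)
     else finv (\<sigma> (fst x)) (cocyc \<sigma> f w - f (fst x)))"

lemma concat_replicate_singleton: "concat (replicate n [x]) = replicate n x"
  by (induction n) auto

lemma letter_pow_int: "letter_pow g (int n) = replicate n (g, True)"
  by (simp add: word_pow_def concat_replicate_singleton)

lemma letter_pow_1: "letter_pow g 1 = [(g, True)]"
  by (simp add: word_pow_def)

lemma ring_hom_total_comp: "ring_hom_total f \<Longrightarrow> ring_hom_total g \<Longrightarrow> ring_hom_total (f \<circ> g)"
  by (rule ring_hom_totalI) (simp_all add: ring_hom_on.hom)

lemma ring_hom_total_inv:
  assumes "bij f" "ring_hom_total f"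
  shows "ring_hom_total (finv f)"
proof (rule ring_hom_totalI)
  note s = surj_f_inv_f[OF bij_is_surj[OF assms(1)]] and i = inv_f_f[OF bij_is_inj[OF assms(1)]]
  show "finv f 1 = 1" using i[of 1] ring_hom_on.hom_one[OF assms(2)] by simp
  show "finv f (x + y) = finv f x + finv f y" for x y
    using i[of "finv f x + finv f y"] by (simp add: ring_hom_on.hom_add[OF assms(2)] s)
  show "finv f (x * y) = finv f x * finv f y" for x y
    using i[of "finv f x * finv f y"] by (simp add: ring_hom_on.hom_mult[OF assms(2)] s)
qed

lemma ring_hom_total_id: "ring_hom_total id"
  by (rule ring_hom_totalI) simp_all

lemma ring_hom_total_funpow:
  fixes f :: "'r::comm_ring_1 \<Rightarrow> 'r"
  shows "ring_hom_total f \<Longrightarrow> ring_hom_total (f ^^ n)"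
  by (induction n) (simp_all only: funpow.simps ring_hom_total_comp ring_hom_total_id)

lemma ring_hom_total_inverse:
  assumes "ring_hom_total (f :: 'a::field \<Rightarrow> 'a)"
  shows "f (inverse x) = inverse (f x)"
proof (cases "x = 0")
  case False
  interpret ring_hom_on UNIV f by fact
  have "f x * f (inverse x) = 1" using False by (simp flip: hom_mult add: hom_one)
  then show ?thesis by (metis inverse_unique)
qed (simp add: ring_hom_on.hom_zero[OF assms])

locale field_auts =
  fixes \<sigma> :: "'g \<Rightarrow> 'a::field \<Rightarrow> 'a"
  assumes bij: "bij (\<sigma> g)" and ring_hom: "ring_hom_total (\<sigma> g)"
begin

lemma inv_simps: "finv (\<sigma> g) (\<sigma> g y) = y" "\<sigma> g (finv (\<sigma> g) y) = y"
  using bij[of g] by (auto simp: bij_is_inj bij_is_surj surj_f_inv_f)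

lemma ring_hom_inv: "ring_hom_total (finv (\<sigma> g))"
  by (rule ring_hom_total_inv[OF bij ring_hom])

lemmas inv_hom = ring_hom_on.hom[OF ring_hom_inv] and gen_hom = ring_hom_on.hom[OF ring_hom]

lemma act_append: "act \<sigma> (u @ v) = act \<sigma> u \<circ> act \<sigma> v"
  by (induction u) auto

lemma bij_act: "bij (act \<sigma> w)"
proof (induction w)
  case (Cons x w)
  have "bij (if snd x then \<sigma> (fst x) else finv (\<sigma> (fst x)))"
    using bij bij_imp_bij_inv by auto
  then show ?case unfolding act.simps by (intro bij_comp Cons)
qed (simp only: act.simps bij_id)

lemma ring_hom_act: "ring_hom_total (act \<sigma> w)"
proof (induction w)
  case (Cons x w)
  have "ring_hom_total (if snd x then \<sigma> (fst x) else finv (\<sigma> (fst x)))"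
    using ring_hom ring_hom_inv by auto
  then show ?case unfolding act.simps by (intro ring_hom_total_comp Cons)
qed (simp only: act.simps ring_hom_total_id)

lemmas act_hom = ring_hom_on.hom[OF ring_hom_act]

lemma cocyc_append: "cocyc \<sigma> f (u @ v) = cocyc \<sigma> f u + act \<sigma> u (cocyc \<sigma> f v)"
  by (induction u) (auto simp: gen_hom inv_hom)

lemma act_shift:
  assumes "\<And>g. \<sigma> g x = x + f g"
  shows "act \<sigma> w x = x + cocyc \<sigma> f w"
proof (induction w)
  case (Cons l w)
  obtain g e where l: "l = (g, e)" by (cases l)
  have "x = finv (\<sigma> g) x + finv (\<sigma> g) (f g)"
    using arg_cong[OF assms[of g], of "finv (\<sigma> g)"] by (simp only: inv_simps inv_hom UNIV_I)
  then have "finv (\<sigma> g) x = x - finv (\<sigma> g) (f g)" by (simp add: eq_diff_eq)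
  then show ?case using Cons by (simp add: l assms gen_hom inv_hom)
qed simp

lemma act_concat_replicate: "act \<sigma> (concat (replicate n w)) = act \<sigma> w ^^ n"
  by (induction n) (auto simp: act_append)

lemma cocyc_concat_replicate:
  "cocyc \<sigma> f (concat (replicate n w)) = (\<Sum>j<n. (act \<sigma> w ^^ j) (cocyc \<sigma> f w))"
proof (induction n)
  case (Suc n)
  have "concat (replicate (Suc n) w) = concat (replicate n w) @ w"
    by (induction n) auto
  then show ?case using Suc by (simp add: cocyc_append act_concat_replicate)
qed simp

text \<open>At a product the cocycle is twisted by the action, so the two must be compared together:
  the pair is a homomorphism into a semidirect product.\<close>

lemma act_cocyc_eqI:
  assumes rel: "\<And>u v. (u, v) \<in> R \<Longrightarrow> act \<sigma> u = act \<sigma> v \<and> cocyc \<sigma> f u = cocyc \<sigma> f v"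
    and "word_eq R u v"
  shows "act \<sigma> u = act \<sigma> v \<and> cocyc \<sigma> f u = cocyc \<sigma> f v"
  using assms(2)
proof (induction rule: word_eq.induct)
  case (cancel g e)
  then show ?case by (auto simp: inv_simps inv_hom gen_hom fun_eq_iff)
qed (auto simp: act_append cocyc_append rel)

lemma act_eqI:
  assumes "\<And>u v. (u, v) \<in> R \<Longrightarrow> act \<sigma> u = act \<sigma> v" and "word_eq R u v"
  shows "act \<sigma> u = act \<sigma> v"
proof -
  have "cocyc \<sigma> (\<lambda>_. 0) w = 0" for w by (induction w) (auto simp: gen_hom inv_hom)
  then show ?thesis using act_cocyc_eqI[where f = "\<lambda>_. 0", OF _ assms(2)] assms(1) by auto
qed

lemma act_word_inv: "act \<sigma> (word_inv w) (act \<sigma> w y) = y"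
  using act_eqI[OF _ word_eq_cancel_left[of "{}" w]] by (simp add: act_append fun_eq_iff)

lemma cocyc_word_inv: "cocyc \<sigma> f (word_inv w) = - act \<sigma> (word_inv w) (cocyc \<sigma> f w)"
  using act_cocyc_eqI[OF _ word_eq_cancel_left[of "{}" w], of f]
  by (simp add: cocyc_append eq_neg_iff_add_eq_0)

lemma cocyc_word_pow_fixed:
  assumes "act \<sigma> w (cocyc \<sigma> f w) = cocyc \<sigma> f w"
  shows "cocyc \<sigma> f (word_pow w k) = of_int k * cocyc \<sigma> f w"
proof -
  let ?c = "cocyc \<sigma> f w"
  have inv: "act \<sigma> (word_inv w) ?c = ?c" using act_word_inv[of w ?c] assms by simp
  have p: "(act \<sigma> w ^^ n) ?c = ?c" "(act \<sigma> (word_inv w) ^^ n) (- ?c) = - ?c" for n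
    using assms inv by (induction n) (auto simp: act_hom)
  show ?thesis
    by (auto simp: word_pow_def cocyc_concat_replicate cocyc_word_inv inv p)
qed

lemma cocyc_letter_pow_int: "cocyc \<sigma> f (letter_pow g (int n)) = (\<Sum>j<n. (\<sigma> g ^^ j) (f g))"
  using cocyc_concat_replicate[of f n "[(g, True)]"] gen_hom(1)[of g]
  by (simp add: word_pow_def)

lemma act_letter_pow_int: "act \<sigma> (letter_pow g (int n)) = \<sigma> g ^^ n"
  using act_concat_replicate[of n "[(g, True)]"] by (simp add: word_pow_def)

end

text \<open>Artin's argument: a relation with as few terms as possible is shortened by comparing
  its values at \<open>a * y\<close> and \<open>y\<close>.\<close>

lemma dedekind_independence:
  fixes S :: "('a::field \<Rightarrow> 'a) set"
  assumes "finite S" "\<And>\<tau>. \<tau> \<in> S \<Longrightarrow> ring_hom_total \<tau>" "\<And>y. (\<Sum>\<tau>\<in>S. c \<tau> * \<tau> y) = 0" "\<tau> \<in> S"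
  shows "c \<tau> = 0"
  using assms
proof (induction S arbitrary: c \<tau> rule: finite_induct)
  case (insert \<tau>0 S)
  have hom: "\<And>\<tau>. \<tau> \<in> S \<Longrightarrow> ring_hom_total \<tau>" "ring_hom_total \<tau>0" using insert.prems by auto
  have eq: "(\<Sum>\<tau>\<in>S. c \<tau> * (\<tau> a - \<tau>0 a) * \<tau> y) = 0" for a y
  proof -
    have "(\<Sum>\<tau>\<in>S. c \<tau> * (\<tau> a - \<tau>0 a) * \<tau> y)
       = (c \<tau>0 * \<tau>0 (a * y) + (\<Sum>\<tau>\<in>S. c \<tau> * \<tau> (a * y))) - \<tau>0 a * (c \<tau>0 * \<tau>0 y + (\<Sum>\<tau>\<in>S. c \<tau> * \<tau> y))"
      by (simp add: ring_hom_on.hom_mult[OF hom(1)] ring_hom_on.hom_mult[OF hom(2)]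
          algebra_simps sum_distrib_left sum_subtractf)
    also have "\<dots> = 0"
      using insert.prems(2)[of "a * y"] insert.prems(2)[of y] insert.hyps by simp
    finally show ?thesis .
  qed
  have 1: "c \<tau> = 0" if "\<tau> \<in> S" for \<tau>
  proof (rule ccontr)
    assume "c \<tau> \<noteq> 0"
    moreover have "c \<tau> * (\<tau> a - \<tau>0 a) = 0" for a
      using insert.IH[OF hom(1) eq that] by simp
    ultimately have "\<tau> = \<tau>0" by (auto simp: fun_eq_iff)
    with that insert.hyps show False by auto
  qed
  have "c \<tau>0 = 0"
    using insert.prems(2)[of 1] insert.hyps 1 by (simp add: ring_hom_on.hom_one[OF hom(2)])
  with 1 show ?case using \<open>\<tau> \<in> insert \<tau>0 S\<close> by (metis insertE)
qed simp

text \<open>By \<open>eq\<close> the cocycle descends to a function \<open>F\<close> on the finite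
  group of automorphisms. With t the trace of some z and s the same sum weighted by
  \<open>F\<close>, the element - s / t has the required shifts. Independence of automorphisms
  provides a z with nonzero t.\<close>

lemma (in field_auts) additive_hilbert90:
  assumes fin: "finite (range (act \<sigma>))"
    and eq: "\<And>u v. act \<sigma> u = act \<sigma> v \<Longrightarrow> cocyc \<sigma> f u = cocyc \<sigma> f v"
  shows "\<exists>x. \<forall>g. \<sigma> g x = x + f g"
proof -
  let ?S = "range (act \<sigma>)"
  define F where "F = (\<lambda>\<tau>. cocyc \<sigma> f (SOME w. act \<sigma> w = \<tau>))"
  have F: "F (act \<sigma> w) = cocyc \<sigma> f w" for w
    unfolding F_def by (rule eq) (metis (mono_tags) someI)
  have id: "id \<in> ?S" by (auto intro: range_eqI[of _ _ "[]"])
  have "\<exists>z. (\<Sum>\<tau>\<in>?S. \<tau> z) \<noteq> 0"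
  proof (rule ccontr)
    assume "\<not> ?thesis"
    then have "(1::'a) = 0"
      using dedekind_independence[OF fin _ _ id, of "\<lambda>_. 1"] ring_hom_act by auto
    then show False by simp
  qed
  then obtain z where z: "(\<Sum>\<tau>\<in>?S. \<tau> z) \<noteq> 0" ..
  define t where "t = (\<Sum>\<tau>\<in>?S. \<tau> z)"
  define s where "s = (\<Sum>\<tau>\<in>?S. \<tau> z * F \<tau>)"
  have bij: "bij_betw (\<lambda>\<tau>. \<sigma> g \<circ> \<tau>) ?S ?S" for g
  proof (rule bij_betw_byWitness[where f' = "\<lambda>\<tau>. finv (\<sigma> g) \<circ> \<tau>"])
    show "(\<lambda>\<tau>. \<sigma> g \<circ> \<tau>) ` ?S \<subseteq> ?S"
      by (auto intro: range_eqI[of _ _ "(g, True) # _"])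
    show "(\<lambda>\<tau>. finv (\<sigma> g) \<circ> \<tau>) ` ?S \<subseteq> ?S"
      by (auto intro: range_eqI[of _ _ "(g, False) # _"])
  qed (auto simp: inv_simps fun_eq_iff)
  have FS: "F (\<sigma> g \<circ> \<tau>) = f g + \<sigma> g (F \<tau>)" if "\<tau> \<in> ?S" for g \<tau>
    using that F[of "(g, True) # _"] F by auto
  have t: "\<sigma> g t = t" for g
    unfolding t_def using sum.reindex_bij_betw[OF bij, of "\<lambda>\<tau>. \<tau> z"] by (simp add: gen_hom)
  have s: "\<sigma> g s = s - t * f g" for g
  proof -
    have "\<sigma> g s = (\<Sum>\<tau>\<in>?S. (\<sigma> g \<circ> \<tau>) z * (F (\<sigma> g \<circ> \<tau>) - f g))"
      unfolding s_def gen_hom(7)[OF UNIV_I] by (rule sum.cong) (auto simp: FS gen_hom)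
    also have "\<dots> = (\<Sum>\<tau>\<in>?S. \<tau> z * (F \<tau> - f g))"
      by (rule sum.reindex_bij_betw[OF bij])
    finally show ?thesis by (simp add: s_def t_def right_diff_distrib sum_subtractf sum_distrib_right)
  qed
  have "\<sigma> g (- (s * inverse t)) = - (s * inverse t) + f g" for g
    using z unfolding t_def[symmetric]
    by (simp only: gen_hom UNIV_I ring_hom_total_inverse[OF ring_hom] s t) (simp add: field_simps)
  then show ?thesis by blast
qed

section \<open>Subfields of the top field\<close>

lemma top_field_simps:
  "carrier top_field = UNIV" "\<one>\<^bsub>top_field\<^esub> = 1" "\<zero>\<^bsub>top_field\<^esub> = 0"
  "x \<oplus>\<^bsub>top_field\<^esub> y = x + y" "x \<otimes>\<^bsub>top_field\<^esub> y = x * (y :: 'a::field)"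
  by (simp_all add: ring_of_type_algebra_def)

lemma field_top_field: "Ring.field (top_field :: 'a::field ring)"
  by (rule field_from_type_algebra)

lemma top_field_uminus: "\<ominus>\<^bsub>top_field\<^esub> x = - (x :: 'a::field)"
proof -
  interpret Ring.field "top_field :: 'a ring" by (rule field_top_field)
  have "x \<oplus>\<^bsub>top_field\<^esub> (\<ominus>\<^bsub>top_field\<^esub> x) = \<zero>\<^bsub>top_field\<^esub>" by (rule r_neg) (simp add: top_field_simps)
  then show ?thesis by (simp add: top_field_simps eq_neg_iff_add_eq_0 add.commute)
qed

lemma top_field_inv:
  assumes "x \<noteq> 0"
  shows "inv\<^bsub>top_field\<^esub> x = inverse (x :: 'a::field)"
proof -
  interpret Ring.field "top_field :: 'a ring" by (rule field_top_field)
  have "inverse x = inv\<^bsub>top_field\<^esub> x"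
    using assms by (intro inv_unique') (auto simp: top_field_simps)
  then show ?thesis ..
qed

lemma subfield_top_field_iff:
  "subfield (K :: 'a::field set) top_field \<longleftrightarrow> subring_set K \<and> (\<forall>x\<in>K. inverse x \<in> K)"
proof -
  interpret Ring.field "top_field :: 'a ring" by (rule field_top_field)
  show ?thesis
  proof
    assume K: "subfield K top_field"
    note r = subringE[OF subfieldE(1)[OF K], unfolded top_field_simps top_field_uminus]
    have "subring_set K" using r by unfold_locales auto
    moreover have "inverse x \<in> K" if "x \<in> K" for x
      using subfield_m_inv(1)[OF K, of x] that r(2)
      by (cases "x = 0") (auto simp: top_field_simps top_field_inv)
    ultimately show "subring_set K \<and> (\<forall>x\<in>K. inverse x \<in> K)" by blast
  next
    assume "subring_set K \<and> (\<forall>x\<in>K. inverse x \<in> K)"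
    then interpret subring_set K + assms: subring_set K by auto
    show "subfield K top_field"
      using \<open>subring_set K \<and> _\<close>
      by (intro subfieldI' subringI) (auto simp: top_field_simps top_field_uminus top_field_inv closed)
  qed
qed

lemma subring_set_subfield: "subfield (K :: 'a::field set) top_field \<Longrightarrow> subring_set K"
  by (simp add: subfield_top_field_iff)

lemma subfield_fixed_field:
  assumes "\<And>\<tau>. \<tau> \<in> S \<Longrightarrow> ring_hom_total (\<tau> :: 'a::field \<Rightarrow> 'a)"
  shows "subfield (fixed_field S) top_field"
  unfolding subfield_top_field_iff fixed_field_def
  by (auto intro!: subring_set.intro
      simp: ring_hom_on.hom[OF assms] ring_hom_total_inverse[OF assms])

lemma generate_field_subset_iff:
  assumes "subfield (L :: 'a::field set) top_field"
  shows "generate_field top_field H \<subseteq> L \<longleftrightarrow> H \<subseteq> L"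
proof -
  interpret Ring.field "top_field :: 'a ring" by (rule field_top_field)
  show ?thesis
    using generate_field_min_subfield1[OF _ assms, of H] by (auto simp: top_field_simps intro: generate_field.incl)
qed

lemma subfield_generate_field: "subfield (generate_field top_field H) (top_field :: 'a::field ring)"
proof -
  interpret Ring.field "top_field :: 'a ring" by (rule field_top_field)
  show ?thesis by (rule generate_field_is_subfield) (simp add: top_field_simps)
qed

section \<open>Interpolation by traces and generation of one cyclic step\<close>

context prime_char
begin

lemma of_nat_power_p_minus_1:
  assumes "j < p"
  shows "(- of_nat j :: 'a) ^ (p - 1) = (if j = 0 then 0 else 1)"
proof (cases "j = 0")
  case False
  then have j: "(of_nat j :: 'a) \<noteq> 0" using of_nat_eq_iff_less[of j 0] assms p_gt_0 by auto
  have "of_nat j * of_nat j ^ (p - 1) = (of_nat j :: 'a)"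
    using of_nat_power_p[of j] p_gt_0 by (metis power_eq_if not_gr_zero)
  then have "(of_nat j :: 'a) ^ (p - 1) = 1" using j by simp
  moreover have "even (p - 1)" using odd_p by simp
  ultimately show ?thesis using False by (simp add: power_minus_even)
qed (use p_gt_1 in auto)

text \<open>Lagrange interpolation of \<open>x + j \<mapsto> \<sigma>\<^sup>j y\<close>, with \<open>1 - (x - X - j)\<^bsup>p-1\<^esup>\<close> as basis polynomials.\<close>

lemma lagrange_trace:
  assumes \<sigma>: "ring_hom_total \<sigma>" "\<sigma> x = (x::'a) + 1"
  defines "Tr \<equiv> \<lambda>u. \<Sum>j<p. (\<sigma> ^^ j) u"
  shows "y = Tr y - (\<Sum>k\<le>p - 1. of_nat ((p - 1) choose k) * x ^ k * Tr (y * (- x) ^ (p - 1 - k)))"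
proof -
  have x: "(\<sigma> ^^ j) x = x + of_nat j" for j
    by (induction j) (auto simp: \<sigma> ring_hom_on.hom[OF \<sigma>(1)])
  note h = ring_hom_on.hom[OF ring_hom_total_funpow[OF \<sigma>(1)]]
  have "(\<Sum>k\<le>p - 1. of_nat ((p - 1) choose k) * x ^ k * Tr (y * (- x) ^ (p - 1 - k)))
     = (\<Sum>j<p. \<Sum>k\<le>p - 1. of_nat ((p - 1) choose k) * x ^ k * ((\<sigma> ^^ j) y * (- (x + of_nat j)) ^ (p - 1 - k)))"
    unfolding Tr_def sum_distrib_left by (subst sum.swap) (simp add: h x)
  also have "\<dots> = (\<Sum>j<p. (\<sigma> ^^ j) y * (x + - (x + of_nat j)) ^ (p - 1))"
    unfolding binomial_ring sum_distrib_left by (intro sum.cong HOL.refl) (simp add: mult_ac)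
  also have "\<dots> = (\<Sum>j<p. if j = 0 then 0 else (\<sigma> ^^ j) y)"
    by (intro sum.cong HOL.refl) (simp add: of_nat_power_p_minus_1 del: One_nat_def)
  also have "\<dots> = Tr y - y"
    using p_gt_0 by (simp add: Tr_def sum.remove[of "{..<p}" 0] sum.If_cases Diff_eq Compl_eq)
  finally show ?thesis by simp
qed

text \<open>Yields K_i = K_(i-1)(x_i) without counting degrees. Interpolation writes y as a
  polynomial in x whose coefficients are traces of elements of \<open>L\<close>; since \<sigma> has
  period p on \<open>L\<close>, these traces are fixed by \<sigma> and lie in
  \<open>K\<close>.\<close>

lemma fixed_field_step:
  assumes \<sigma>: "ring_hom_total \<sigma>" "\<sigma> x = (x::'a) + 1" and L: "subfield L top_field" "x \<in> L"
    and stable: "\<And>y. y \<in> L \<Longrightarrow> \<sigma> y \<in> L" and per: "\<And>y. y \<in> L \<Longrightarrow> (\<sigma> ^^ p) y = y"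
    and K: "\<And>y. y \<in> K \<longleftrightarrow> y \<in> L \<and> \<sigma> y = y"
  shows "L = generate_field top_field (insert x K)"
proof
  let ?G = "generate_field top_field (insert x K)"
  show "?G \<subseteq> L" using L K by (subst generate_field_subset_iff) auto
  interpret L: subring_set L by (rule subring_set_subfield[OF L(1)])
  interpret G: subring_set ?G by (rule subring_set_subfield[OF subfield_generate_field])
  define Tr where "Tr = (\<lambda>u. \<Sum>j<p. (\<sigma> ^^ j) u)"
  have Tr: "Tr u \<in> ?G" if "u \<in> L" for u
  proof -
    have *: "(\<sigma> ^^ j) u \<in> L" for j using that by (induction j) (auto intro: stable)
    have "\<sigma> (Tr u) = (\<Sum>j<p. (\<sigma> ^^ Suc j) u)"
      unfolding Tr_def by (simp add: ring_hom_on.hom[OF \<sigma>(1)])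
    also have "\<dots> = Tr u"
      using sum.lessThan_Suc_shift[of "\<lambda>j. (\<sigma> ^^ j) u" p] per[OF that] by (simp add: Tr_def)
    finally have "Tr u \<in> K" unfolding K using * by (auto simp: Tr_def intro: L.closed)
    then show ?thesis by (intro generate_field.incl) auto
  qed
  have x: "x \<in> ?G" by (intro generate_field.incl) auto
  show "L \<subseteq> ?G"
  proof
    fix y assume y: "y \<in> L"
    have "Tr y - (\<Sum>k\<le>p - 1. of_nat ((p - 1) choose k) * x ^ k * Tr (y * (- x) ^ (p - 1 - k))) \<in> ?G"
      using y L(2) x by (intro G.closed Tr L.closed)
    then show "y \<in> ?G" using lagrange_trace[OF \<sigma>, of y] by (simp add: Tr_def)
  qed
qed

end

section \<open>Galois groups and towers\<close>

lemma carrier_galois_group: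
  "carrier (galois_group K) = {\<tau> :: 'a::field \<Rightarrow> 'a. bij \<tau> \<and> ring_hom_total \<tau> \<and> (\<forall>x\<in>K. \<tau> x = x)}"
proof -
  have "\<tau> \<in> ring_iso top_field top_field \<longleftrightarrow> bij \<tau> \<and> ring_hom_total \<tau>" for \<tau> :: "'a \<Rightarrow> 'a"
    by (auto simp: ring_iso_def ring_hom_def top_field_simps ring_hom_on.hom intro!: ring_hom_totalI)
  then show ?thesis by (auto simp: galois_group_def)
qed

lemma galois_group_mult: "\<tau> \<otimes>\<^bsub>galois_group K\<^esub> \<tau>' = \<tau> \<circ> \<tau>'" and galois_group_one: "\<one>\<^bsub>galois_group K\<^esub> = id"
  by (simp_all add: galois_group_def)

lemma group_galois_group: "group (galois_group (K :: 'a::field set))"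
proof (rule groupI)
  fix \<tau> assume \<tau>: "\<tau> \<in> carrier (galois_group K)"
  then have "finv \<tau> x = x" if "x \<in> K" for x
    using that by (auto simp: carrier_galois_group intro: inv_f_eq bij_is_inj)
  with \<tau> have "finv \<tau> \<in> carrier (galois_group K)"
    by (auto simp: carrier_galois_group bij_imp_bij_inv ring_hom_total_inv)
  moreover have "finv \<tau> \<circ> \<tau> = id"
    using \<tau> by (auto simp: carrier_galois_group bij_is_inj)
  ultimately show "\<exists>\<tau>'\<in>carrier (galois_group K). \<tau>' \<otimes>\<^bsub>galois_group K\<^esub> \<tau> = \<one>\<^bsub>galois_group K\<^esub>"
    by (auto simp: galois_group_mult galois_group_one)
qed (auto simp: carrier_galois_group galois_group_mult galois_group_one bij_comp
    ring_hom_total_comp ring_hom_total_id)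

lemma fixed_field_generate:
  fixes K :: "'a::field set"
  assumes "S \<subseteq> carrier (galois_group K)"
  shows "fixed_field (generate (galois_group K) S) = fixed_field S"
proof
  interpret group "galois_group K" by (rule group_galois_group)
  show "fixed_field (generate (galois_group K) S) \<subseteq> fixed_field S"
    by (auto simp: fixed_field_def intro: generate.incl)
  show "fixed_field S \<subseteq> fixed_field (generate (galois_group K) S)"
  proof
    fix x assume x: "x \<in> fixed_field S"
    have "\<tau> x = x" if "\<tau> \<in> generate (galois_group K) S" for \<tau>
      using that
    proof (induction rule: generate.induct)
      case (inv h)
      have "inv\<^bsub>galois_group K\<^esub> h \<circ> h = id"
        using l_inv[of h] inv assms by (auto simp: galois_group_mult galois_group_one)
      then have "(inv\<^bsub>galois_group K\<^esub> h) (h x) = x" by (simp add: fun_eq_iff)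
      moreover have "h x = x" using inv x by (simp add: fixed_field_def)
      ultimately show ?case by simp
    qed (use x in \<open>auto simp: fixed_field_def galois_group_mult galois_group_one\<close>)
    then show "x \<in> fixed_field (generate (galois_group K) S)" by (simp add: fixed_field_def)
  qed
qed

section \<open>The abstract tower of four Artin-Schreier steps\<close>

lemma UNIV_gen: "UNIV = {S1, S2, S3, S4}"
  by (auto intro: gen.exhaust)

definition e1 :: "gen \<Rightarrow> 'a::field" where
  "e1 g = (if g = S1 then 1 else 0)"

definition e2 :: "gen \<Rightarrow> 'a::field" where
  "e2 g = (if g = S2 then 1 else 0)"

text \<open>The common features of the groups \<open>G\<close> and \<open>H\<close>: \<open>e3\<close> and \<open>e4\<close> give \<open>(\<sigma>\<^sub>g - 1) x\<^sub>3\<close> and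
  \<open>(\<sigma>\<^sub>g - 1) x\<^sub>4\<close>, and the equations are \<open>\<wp>(x\<^sub>3) = rhs3 \<beta>\<^sub>2 x\<^sub>1 + \<beta>\<^sub>3\<close> and
  \<open>\<wp>(x\<^sub>4) = rhs4 \<beta>\<^sub>2 \<beta>\<^sub>3 x\<^sub>1 x\<^sub>2 x\<^sub>3 + \<beta>\<^sub>4\<close>.\<close>

locale tower = prime_char p ty
  for p :: nat and ty :: "'a::field itself" +
  fixes R :: "(gen word \<times> gen word) set"
    and e3 :: "gen \<Rightarrow> 'a \<Rightarrow> 'a \<Rightarrow> 'a" and e4 :: "gen \<Rightarrow> 'a \<Rightarrow> 'a \<Rightarrow> 'a \<Rightarrow> 'a"
    and rhs3 :: "'a \<Rightarrow> 'a \<Rightarrow> 'a" and rhs4 :: "'a \<Rightarrow> 'a \<Rightarrow> 'a \<Rightarrow> 'a \<Rightarrow> 'a \<Rightarrow> 'a"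
  assumes e3_S3: "e3 S3 x1 x2 = 1" and e3_S4: "e3 S4 x1 x2 = 0" and e4_S4: "e4 S4 x1 x2 x3 = 1"
    and e3_closed: "subring_set S \<Longrightarrow> x1 \<in> S \<Longrightarrow> x2 \<in> S \<Longrightarrow> e3 g x1 x2 \<in> S"
    and e4_closed: "subring_set S \<Longrightarrow> x1 \<in> S \<Longrightarrow> x2 \<in> S \<Longrightarrow> x3 \<in> S \<Longrightarrow> e4 g x1 x2 x3 \<in> S"
    and rhs3_closed: "subring_set S \<Longrightarrow> \<beta>2 \<in> S \<Longrightarrow> x1 \<in> S \<Longrightarrow> rhs3 \<beta>2 x1 \<in> S"
    and rhs4_closed: "subfield S top_field \<Longrightarrow> \<beta>2 \<in> S \<Longrightarrow> \<beta>3 \<in> S \<Longrightarrow> x1 \<in> S \<Longrightarrow> x2 \<in> S \<Longrightarrow> x3 \<in> S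
      \<Longrightarrow> rhs4 \<beta>2 \<beta>3 x1 x2 x3 \<in> S"
    and hom_rhs3: "ring_hom_on S h \<Longrightarrow> \<beta>2 \<in> S \<Longrightarrow> x1 \<in> S \<Longrightarrow> x2 \<in> S \<Longrightarrow>
      h \<beta>2 = \<beta>2 \<Longrightarrow> h x1 = x1 + e1 g \<Longrightarrow> h x2 = x2 + e2 g \<Longrightarrow> AS p x2 = \<beta>2 \<Longrightarrow>
      h (rhs3 \<beta>2 x1) = rhs3 \<beta>2 x1 + AS p (e3 g x1 x2)"
    and hom_rhs4: "subfield S top_field \<Longrightarrow> ring_hom_on S h \<Longrightarrow>
      \<beta>2 \<in> S \<Longrightarrow> \<beta>3 \<in> S \<Longrightarrow> x1 \<in> S \<Longrightarrow> x2 \<in> S \<Longrightarrow> x3 \<in> S \<Longrightarrow>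
      h \<beta>2 = \<beta>2 \<Longrightarrow> h \<beta>3 = \<beta>3 \<Longrightarrow>
      h x1 = x1 + e1 g \<Longrightarrow> h x2 = x2 + e2 g \<Longrightarrow> h x3 = x3 + e3 g x1 x2 \<Longrightarrow>
      AS p x2 = \<beta>2 \<Longrightarrow> AS p x3 = rhs3 \<beta>2 x1 + \<beta>3 \<Longrightarrow>
      h (rhs4 \<beta>2 \<beta>3 x1 x2 x3) = rhs4 \<beta>2 \<beta>3 x1 x2 x3 + AS p (e4 g x1 x2 x3)"
    and cocyc_e1: "field_auts \<sigma> \<Longrightarrow> (u, v) \<in> R \<Longrightarrow> cocyc \<sigma> e1 u = (cocyc \<sigma> e1 v :: 'a)"
    and cocyc_e2: "field_auts \<sigma> \<Longrightarrow> (u, v) \<in> R \<Longrightarrow> cocyc \<sigma> e2 u = (cocyc \<sigma> e2 v :: 'a)"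
    and cocyc_e3: "field_auts \<sigma> \<Longrightarrow> (\<And>g. \<sigma> g x1 = x1 + e1 g) \<Longrightarrow> (\<And>g. \<sigma> g x2 = x2 + e2 g) \<Longrightarrow>
      (u, v) \<in> R \<Longrightarrow> cocyc \<sigma> (\<lambda>g. e3 g x1 x2) u = cocyc \<sigma> (\<lambda>g. e3 g x1 x2) v"
    and cocyc_e4: "field_auts \<sigma> \<Longrightarrow> (\<And>g. \<sigma> g x1 = x1 + e1 g) \<Longrightarrow> (\<And>g. \<sigma> g x2 = x2 + e2 g) \<Longrightarrow>
      (\<And>g. \<sigma> g x3 = x3 + e3 g x1 x2) \<Longrightarrow>
      (u, v) \<in> R \<Longrightarrow> cocyc \<sigma> (\<lambda>g. e4 g x1 x2 x3) u = cocyc \<sigma> (\<lambda>g. e4 g x1 x2 x3) v"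
    and conj_rel: "(g, B) \<in> {(S1, {S2, S3, S4}), (S2, {S3, S4}), (S3, {S4})} \<Longrightarrow> b \<in> B \<Longrightarrow>
      \<exists>w\<in>words B. word_eq R [(b, True), (g, True)] ((g, True) # w)"
    and pow_rel: "(g, B) \<in> {(S1, {S2, S3, S4}), (S2, {S3, S4}), (S3, {S4}), (S4, {})} \<Longrightarrow>
      \<exists>v\<in>words B. word_eq R (replicate p (g, True)) v"
begin

text \<open>A pair (g, B) is one step of the subgroup chain, from the subgroup generated by g and B
  down to the one generated by B. On the side of fixed fields it is one step up the tower.\<close>

definition levels :: "(gen \<times> gen set) set" where
  "levels = {(S1, {S2, S3, S4}), (S2, {S3, S4}), (S3, {S4}), (S4, {})}"

lemma conj_rel': "(g, B) \<in> levels \<Longrightarrow> h \<in> B \<Longrightarrow>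
    \<exists>w\<in>words B. word_eq R [(h, True), (g, True)] ((g, True) # w)"
  using conj_rel[of g B h] by (auto simp: levels_def)

lemma pow_rel': "(g, B) \<in> levels \<Longrightarrow> \<exists>v\<in>words B. word_eq R (replicate p (g, True)) v"
  using pow_rel[of g B] by (auto simp: levels_def)

lemma normal_form_step:
  assumes "(g, B) \<in> levels" "u \<in> words (insert g B)"
  shows "\<exists>n<p. \<exists>w\<in>words B. word_eq R u (replicate n (g, True) @ w)"
proof -
  obtain v where "v \<in> words B" "word_eq R (replicate p (g, True)) v"
    using pow_rel'[OF assms(1)] by blast
  then show ?thesis
    using conj_rel'[OF assms(1)] p_gt_0 assms(2) by (intro word_normal_form_step) auto
qed

definition nf_word :: "nat \<Rightarrow> nat \<Rightarrow> nat \<Rightarrow> nat \<Rightarrow> gen word" where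
  "nf_word i j k l = replicate i (S1, True) @ replicate j (S2, True)
     @ replicate k (S3, True) @ replicate l (S4, True)"

text \<open>Bounds the order of the presented group by p^4.\<close>

lemma normal_form:
  "\<exists>i<p. \<exists>j<p. \<exists>k<p. \<exists>l<p. word_eq R u (nf_word i j k l)"
proof -
  have "u \<in> words (insert S1 {S2, S3, S4})"
    unfolding UNIV_gen[symmetric] by (auto simp: words_def)
  then obtain i u1 where 1: "i < p" "u1 \<in> words {S2, S3, S4}" "word_eq R u (replicate i (S1, True) @ u1)"
    using normal_form_step[of S1 "{S2, S3, S4}" u] by (auto simp: levels_def)
  obtain j u2 where 2: "j < p" "u2 \<in> words {S3, S4}" "word_eq R u1 (replicate j (S2, True) @ u2)"
    using normal_form_step[of S2 "{S3, S4}" u1] 1(2) by (auto simp: levels_def)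
  obtain k u3 where 3: "k < p" "u3 \<in> words {S4}" "word_eq R u2 (replicate k (S3, True) @ u3)"
    using normal_form_step[of S3 "{S4}" u2] 2(2) by (auto simp: levels_def)
  obtain l u4 where 4: "l < p" "u4 \<in> words {}" "word_eq R u3 (replicate l (S4, True) @ u4)"
    using normal_form_step[of S4 "{}" u3] 3(2) by (auto simp: levels_def)
  have "u4 = []" using 4(2) by (simp add: words_def)
  then have "word_eq R u2 (replicate k (S3, True) @ replicate l (S4, True))"
    using 3(3) word_eq_append_left[OF 4(3)] by (auto intro: word_eq.trans)
  then have "word_eq R u1 (replicate j (S2, True) @ replicate k (S3, True) @ replicate l (S4, True))"
    using 2(3) word_eq_append_left by (blast intro: word_eq.trans)
  then have "word_eq R u (nf_word i j k l)"
    unfolding nf_word_def using 1(3) word_eq_append_left by (blast intro: word_eq.trans)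
  with 1(1) 2(1) 3(1) 4(1) show ?thesis by blast
qed

end

section \<open>From a faithful action on the field to x1, ..., x4\<close>

locale galois_tower = tower p ty R e3 e4 rhs3 rhs4 + field_auts \<sigma>
  for p :: nat and ty :: "'a::field itself" and R e3 e4 rhs3 rhs4 and \<sigma> :: "gen \<Rightarrow> 'a \<Rightarrow> 'a" +
  fixes K :: "'a set"
  assumes act_eq_iff: "act \<sigma> u = act \<sigma> v \<longleftrightarrow> word_eq R u v"
    and K_iff: "x \<in> K \<longleftrightarrow> (\<forall>g. \<sigma> g x = x)"
begin

lemma finite_range_act: "finite (range (act \<sigma>))"
proof -
  have "range (act \<sigma>) \<subseteq> (\<lambda>(i, j, k, l). act \<sigma> (nf_word i j k l)) ` ({..<p} \<times> {..<p} \<times> {..<p} \<times> {..<p})"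
  proof
    fix \<tau> assume "\<tau> \<in> range (act \<sigma>)"
    then obtain u where u: "\<tau> = act \<sigma> u" by blast
    obtain i j k l where "i < p" "j < p" "k < p" "l < p" "word_eq R u (nf_word i j k l)"
      using normal_form[of u] by blast
    then show "\<tau> \<in> (\<lambda>(i, j, k, l). act \<sigma> (nf_word i j k l)) ` ({..<p} \<times> {..<p} \<times> {..<p} \<times> {..<p})"
      unfolding u by (intro image_eqI[of _ _ "(i, j, k, l)"]) (auto simp: act_eq_iff)
  qed
  then show ?thesis by (rule finite_subset) auto
qed

text \<open>Faithfulness turns equality of automorphisms into equality of words modulo the
  relations. Hence it is enough to test \<open>f\<close> on the relations themselves.\<close>

lemma solve_cocyc:
  assumes "\<And>u v. (u, v) \<in> R \<Longrightarrow> cocyc \<sigma> f u = cocyc \<sigma> f v"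
  shows "\<exists>x. \<forall>g. \<sigma> g x = x + f g"
proof (rule additive_hilbert90[OF finite_range_act])
  fix u v assume "act \<sigma> u = act \<sigma> v"
  then have "word_eq R u v" by (simp add: act_eq_iff)
  then show "cocyc \<sigma> f u = cocyc \<sigma> f v"
    using act_cocyc_eqI[of R f u v] assms by (auto simp: act_eq_iff intro: word_eq.rel)
qed

definition Fix :: "gen set \<Rightarrow> 'a set" where
  "Fix S = {x. \<forall>g\<in>S. \<sigma> g x = x}"

lemma gen_in_galois_group: "\<sigma> g \<in> carrier (galois_group K)"
  by (auto simp: carrier_galois_group bij ring_hom K_iff)

lemma stage_eq_Fix: "stage K \<sigma> S = Fix S"
  unfolding stage_def using gen_in_galois_group
  by (subst fixed_field_generate) (auto simp: fixed_field_def Fix_def)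

lemma subfield_Fix: "subfield (Fix S) top_field"
  using subfield_fixed_field[of "\<sigma> ` S"] ring_hom by (auto simp: fixed_field_def Fix_def)

lemma act_words_Fix:
  assumes "w \<in> words S" "x \<in> Fix S"
  shows "act \<sigma> w x = x"
  using assms(1)
proof (induction w)
  case (Cons l w)
  obtain g e where l: "l = (g, e)" by (cases l)
  have "\<sigma> g x = x" using Cons.prems assms(2) by (auto simp: words_def l Fix_def)
  moreover from this have "finv (\<sigma> g) x = x" using inv_simps(1)[of g x] by simp
  ultimately show ?case using Cons by (simp add: l words_def)
qed simp

text \<open>By faithfulness the relations hold between automorphisms: the conjugation relations show
  that \<open>\<sigma> g\<close> maps \<open>Fix B\<close> to itself, and the power relation that
  its p-th power is the identity there.\<close>

lemma Fix_step:
  assumes gB: "(g, B) \<in> levels" and x: "x \<in> Fix B" "\<sigma> g x = x + 1"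
  shows "Fix B = generate_field top_field (insert x (Fix (insert g B)))"
proof (rule fixed_field_step[where \<sigma> = "\<sigma> g"])
  fix y assume y: "y \<in> Fix B"
  show "\<sigma> g y \<in> Fix B"
    unfolding Fix_def
  proof safe
    fix h assume "h \<in> B"
    then obtain w where w: "w \<in> words B" "word_eq R [(h, True), (g, True)] ((g, True) # w)"
      using conj_rel'[OF gB] by blast
    from w(2) have "act \<sigma> [(h, True), (g, True)] y = act \<sigma> ((g, True) # w) y"
      using act_eq_iff by metis
    then show "\<sigma> h (\<sigma> g y) = \<sigma> g y" by (simp add: act_words_Fix[OF w(1) y])
  qed
  obtain v where v: "v \<in> words B" "word_eq R (replicate p (g, True)) v"
    using pow_rel'[OF gB] by blast
  from v(2) have "act \<sigma> (replicate p (g, True)) y = act \<sigma> v y"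
    using act_eq_iff by metis
  then show "(\<sigma> g ^^ p) y = y"
    by (simp add: act_words_Fix[OF v(1) y] act_letter_pow_int letter_pow_int[symmetric])
next
  show "y \<in> Fix (insert g B) \<longleftrightarrow> y \<in> Fix B \<and> \<sigma> g y = y" for y
    by (auto simp: Fix_def)
qed (fact x ring_hom subfield_Fix)+

lemma step_gen_Fix:
  assumes "(g, B) \<in> levels" "x \<in> Fix B" "\<sigma> g x = x + 1" "AS p x \<in> Fix (insert g B)"
  shows "step_gen p (Fix (insert g B)) (Fix B) (\<sigma> g) x"
  using assms Fix_step[OF assms(1-3)] by (simp add: step_gen_def)

lemma K_eq_Fix: "K = Fix {S1, S2, S3, S4}"
  unfolding UNIV_gen[symmetric] Fix_def by (auto simp: K_iff)

lemma UNIV_eq_Fix: "UNIV = Fix {}"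
  by (simp add: Fix_def)

lemma hom_AS: "\<sigma> g (AS p x) = AS p (\<sigma> g x)"
  by (simp add: AS_def gen_hom)

text \<open>Replaces the conditions on fields by the shifts of x1 and x2. One direction gives
  existence through crossed homomorphisms; the other reads off the shifts of an arbitrary given
  pair, to which x3 and x4 must then be fitted.\<close>

lemma lower_gens_iff:
  "lower_gens p K \<sigma> x1 x2 \<and> AS p x1 \<in> K \<and> AS p x2 \<in> K \<longleftrightarrow>
    (\<forall>g. \<sigma> g x1 = x1 + e1 g) \<and> (\<forall>g. \<sigma> g x2 = x2 + e2 g)"
proof
  assume *: "lower_gens p K \<sigma> x1 x2 \<and> AS p x1 \<in> K \<and> AS p x2 \<in> K"
  then have "x1 \<in> Fix {S2, S3, S4}" "\<sigma> S1 x1 - x1 = 1" "x2 \<in> Fix {S3, S4}" "\<sigma> S2 x2 - x2 = 1"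
      "\<sigma> S1 x2 - x2 = 0"
    by (auto simp: lower_gens_def step_gen_def stage_eq_Fix)
  moreover from this have "\<sigma> S1 x1 = x1 + 1" "\<sigma> S2 x2 = x2 + 1" by (simp_all add: diff_eq_eq add.commute)
  moreover have "(\<forall>g. P g) \<longleftrightarrow> P S1 \<and> P S2 \<and> P S3 \<and> P S4" for P
    by (metis gen.exhaust)
  ultimately show "(\<forall>g. \<sigma> g x1 = x1 + e1 g) \<and> (\<forall>g. \<sigma> g x2 = x2 + e2 g)"
    by (simp add: Fix_def e1_def e2_def)
next
  assume *: "(\<forall>g. \<sigma> g x1 = x1 + e1 g) \<and> (\<forall>g. \<sigma> g x2 = x2 + e2 g)"
  then have K: "AS p x1 \<in> K" "AS p x2 \<in> K"
    by (auto simp: K_iff hom_AS AS_add AS_0 AS_1 e1_def e2_def)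
  have "x1 \<in> Fix {S2, S3, S4}" "x2 \<in> Fix {S3, S4}"
    using * by (auto simp: Fix_def e1_def e2_def)
  moreover have "AS p x2 \<in> Fix {S2, S3, S4}"
    using K(2) unfolding K_eq_Fix by (auto simp: Fix_def)
  ultimately have "step_gen p K (Fix {S2, S3, S4}) (\<sigma> S1) x1"
      "step_gen p (Fix {S2, S3, S4}) (Fix {S3, S4}) (\<sigma> S2) x2"
    using * K step_gen_Fix[of S1 "{S2, S3, S4}" x1] step_gen_Fix[of S2 "{S3, S4}" x2]
    unfolding K_eq_Fix by (auto simp: levels_def e1_def e2_def)
  with * K show "lower_gens p K \<sigma> x1 x2 \<and> AS p x1 \<in> K \<and> AS p x2 \<in> K"
    by (auto simp: lower_gens_def stage_eq_Fix e2_def)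
qed

lemma exists_lower_gens:
  "\<exists>x1 x2. lower_gens p K \<sigma> x1 x2 \<and> AS p x1 \<in> K \<and> AS p x2 \<in> K"
  unfolding lower_gens_iff
  using solve_cocyc[of e1] solve_cocyc[of e2] cocyc_e1 cocyc_e2 field_auts_axioms by blast

lemma exists_upper_gens:
  assumes "lower_gens p K \<sigma> x1 x2 \<and> AS p x1 \<in> K \<and> AS p x2 \<in> K"
  shows "\<exists>x3 x4. upper_gens p K \<sigma> x3 x4 \<and> (\<exists>\<beta>3\<in>K. \<exists>\<beta>4\<in>K.
    AS p x3 = rhs3 (AS p x2) x1 + \<beta>3 \<and> AS p x4 = rhs4 (AS p x2) \<beta>3 x1 x2 x3 + \<beta>4)"
proof -
  have x1: "\<sigma> g x1 = x1 + e1 g" and x2: "\<sigma> g x2 = x2 + e2 g" for g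
    using assms unfolding lower_gens_iff by auto
  have \<beta>2: "\<sigma> g (AS p x2) = AS p x2" for g using assms K_iff by auto
  obtain x3 where x3: "\<And>g. \<sigma> g x3 = x3 + e3 g x1 x2"
    using solve_cocyc[of "\<lambda>g. e3 g x1 x2"] cocyc_e3[OF field_auts_axioms x1 x2] by blast
  obtain x4 where x4: "\<And>g. \<sigma> g x4 = x4 + e4 g x1 x2 x3"
    using solve_cocyc[of "\<lambda>g. e4 g x1 x2 x3"] cocyc_e4[OF field_auts_axioms x1 x2 x3] by blast
  define \<beta>3 where "\<beta>3 = AS p x3 - rhs3 (AS p x2) x1"
  have \<beta>3: "\<sigma> g \<beta>3 = \<beta>3" for g
    using hom_rhs3[OF ring_hom UNIV_I UNIV_I UNIV_I \<beta>2 x1 x2 HOL.refl]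
    by (simp add: \<beta>3_def gen_hom hom_AS x3 AS_add)
  have AS3: "AS p x3 = rhs3 (AS p x2) x1 + \<beta>3" by (simp add: \<beta>3_def)
  define \<beta>4 where "\<beta>4 = AS p x4 - rhs4 (AS p x2) \<beta>3 x1 x2 x3"
  have U: "subfield (UNIV :: 'a set) top_field" using subfield_Fix[of "{}"] UNIV_eq_Fix by simp
  have \<beta>4: "\<sigma> g \<beta>4 = \<beta>4" for g
    using hom_rhs4[OF U ring_hom UNIV_I UNIV_I UNIV_I UNIV_I UNIV_I \<beta>2 \<beta>3 x1 x2 x3 HOL.refl AS3]
    by (simp add: \<beta>4_def gen_hom hom_AS x4 AS_add)
  \<comment> \<open>The shifts of x3 under S3 and S4 and of x4 under S4 are 0 or 1, and
    \<open>AS\<close> annihilates both values.\<close>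
  have "x3 \<in> Fix {S4}" "AS p x3 \<in> Fix {S3, S4}" "AS p x4 \<in> Fix {S4}"
    by (auto simp: Fix_def hom_AS x3 x4 AS_add e3_S3 e3_S4 e4_S4 AS_1 AS_0)
  then have "upper_gens p K \<sigma> x3 x4"
    unfolding upper_gens_def stage_eq_Fix UNIV_eq_Fix
    using step_gen_Fix[of S3 "{S4}" x3] step_gen_Fix[of S4 "{}" x4] x3[of S3] x4[of S4]
    by (auto simp: levels_def e3_S3 e4_S4 UNIV_eq_Fix[symmetric])
  moreover have "\<beta>3 \<in> K" "\<beta>4 \<in> K" using \<beta>3 \<beta>4 by (auto simp: K_iff)
  moreover have "AS p x4 = rhs4 (AS p x2) \<beta>3 x1 x2 x3 + \<beta>4" by (simp add: \<beta>4_def)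
  ultimately show ?thesis using AS3 by blast
qed

end

section \<open>An isomorphism from the presented group as a faithful action\<close>

lemma (in tower) galois_tower_of_iso:
  assumes gal: "galois_ext K" and \<phi>: "\<phi> \<in> iso (presented_group R) (galois_group K)"
  shows "galois_tower p R e3 e4 rhs3 rhs4 (\<lambda>g. \<phi> (presented_gen R g)) K"
proof -
  define \<sigma> where "\<sigma> = (\<lambda>g. \<phi> (presented_gen R g))"
  have bij\<phi>: "bij_betw \<phi> (range (word_class R)) (carrier (galois_group K))"
    using \<phi> by (simp add: iso_def presented_group_carrier)
  have mult: "\<phi> (word_class R (u @ v)) = \<phi> (word_class R u) \<circ> \<phi> (word_class R v)" for u v
    using \<phi> by (auto simp: iso_def hom_def presented_group_carrier presented_group_mult galois_group_mult
        simp flip: presented_group_mult)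
  have carrier: "\<phi> (word_class R u) \<in> carrier (galois_group K)" for u
    using bij\<phi> by (auto simp: bij_betw_def)
  interpret field_auts \<sigma>
    using carrier by (intro field_auts.intro) (auto simp: \<sigma>_def presented_gen_def carrier_galois_group)
  have one: "\<phi> (word_class R []) = id"
  proof -
    \<comment> \<open>An injective idempotent map is the identity.\<close>
    have "\<phi> (word_class R []) \<circ> \<phi> (word_class R []) = \<phi> (word_class R [])"
      using mult[of "[]" "[]"] by simp
    moreover have "inj (\<phi> (word_class R []))"
      using carrier[of "[]"] by (auto simp: carrier_galois_group bij_is_inj)
    ultimately show ?thesis by (metis fun.inj_map_strong fun_eq_iff id_apply injD o_apply)
  qed
  have letter: "\<phi> (word_class R [(g, False)]) = finv (\<sigma> g)" for g
  proof -
    have "\<phi> (word_class R [(g, False)]) \<circ> \<sigma> g = \<phi> (word_class R [(g, False), (g, \<not> False)])"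
      using mult[of "[(g, False)]" "[(g, True)]"] by (simp add: \<sigma>_def presented_gen_def)
    also have "word_class R [(g, False), (g, \<not> False)] = word_class R []"
      unfolding word_class_eq_iff by (rule word_eq.cancel)
    finally have "\<phi> (word_class R [(g, False)]) \<circ> \<sigma> g = id" by (simp only: one)
    then show ?thesis by (metis bij bij_is_surj surj_iff comp_assoc comp_id id_comp)
  qed
  have act: "act \<sigma> w = \<phi> (word_class R w)" for w
  proof (induction w)
    case (Cons x w)
    obtain g e where x: "x = (g, e)" by (cases x)
    have "\<phi> (word_class R (x # w)) = \<phi> (word_class R [x]) \<circ> \<phi> (word_class R w)"
      using mult[of "[x]" w] by simp
    then show ?case using Cons letter by (auto simp: x \<sigma>_def presented_gen_def)
  qed (simp add: one)
  have "galois_tower p R e3 e4 rhs3 rhs4 \<sigma> K"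
  proof unfold_locales
    show "act \<sigma> u = act \<sigma> v \<longleftrightarrow> word_eq R u v" for u v
      using bij\<phi> by (auto simp: act bij_betw_def inj_on_eq_iff simp flip: word_class_eq_iff)
    have range: "range (act \<sigma>) = carrier (galois_group K)"
      using bij\<phi> by (auto simp: act bij_betw_def)
    show "x \<in> K \<longleftrightarrow> (\<forall>g. \<sigma> g x = x)" for x
    proof
      assume "x \<in> K"
      then show "\<forall>g. \<sigma> g x = x"
        using carrier by (auto simp: \<sigma>_def presented_gen_def carrier_galois_group)
    next
      assume x: "\<forall>g. \<sigma> g x = x"
      \<comment> \<open>\<open>act_shift\<close> at x leaves the cocycle of the zero function; the
        instance at 0 shows that this cocycle vanishes.\<close>
      then have "act \<sigma> w x = x" for w
        using act_shift[of x "\<lambda>_. 0" w] act_shift[of 0 "\<lambda>_. 0" w] by (simp add: act_hom gen_hom)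
      then have "x \<in> fixed_field (carrier (galois_group K))"
        unfolding range[symmetric] by (auto simp: fixed_field_def)
      then show "x \<in> K" using gal by (simp add: galois_ext_def)
    qed
  qed
  then show ?thesis by (simp only: \<sigma>_def)
qed

section \<open>Adjoining Artin-Schreier roots\<close>

definition span_powers :: "'a::field set \<Rightarrow> 'a \<Rightarrow> nat \<Rightarrow> 'a set" where
  "span_powers K x n = {\<Sum>i<n. k i * x ^ i | k. \<forall>i<n. k i \<in> K}"

definition indep_powers :: "'a::field set \<Rightarrow> 'a \<Rightarrow> nat \<Rightarrow> bool" where
  "indep_powers K x n \<longleftrightarrow> (\<forall>k. (\<forall>i<n. k i \<in> K) \<longrightarrow> (\<Sum>i<n. k i * x ^ i) = 0 \<longrightarrow> (\<forall>i<n. k i = 0))"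

lemma span_powersI: "(\<And>i. i < n \<Longrightarrow> k i \<in> K) \<Longrightarrow> (\<Sum>i<n. k i * x ^ i) \<in> span_powers K x n"
  by (auto simp: span_powers_def)

lemma span_powersE:
  assumes "y \<in> span_powers K x n"
  obtains k where "\<And>i. i < n \<Longrightarrow> k i \<in> K" "y = (\<Sum>i<n. k i * x ^ i)"
  using assms by (auto simp: span_powers_def)

lemma span_powers_subset:
  assumes "subring_set S" "K \<subseteq> S" "x \<in> S"
  shows "span_powers K x n \<subseteq> S"
proof -
  interpret subring_set S by fact
  show ?thesis using assms(2,3) by (force simp: span_powers_def intro!: closed)
qed

text \<open>Converts a dimension into independence. Powers are added one at a time; one that depends
  on its predecessors leaves the dimension unchanged, and the dimension then stays behind the number
  of powers.\<close>

lemma dimension_span_powers: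
  assumes K: "subfield (K :: 'a::field set) top_field"
  shows "\<exists>m\<le>n. ring.dimension top_field m K (span_powers K x n) \<and> (m = n \<longrightarrow> indep_powers K x n)"
proof (induction n)
  interpret Ring.field "top_field :: 'a ring" by (rule field_top_field)
  case 0
  have "span_powers K x 0 = {0}" by (auto simp: span_powers_def)
  then show ?case using zero_dim[of K] by (auto simp: top_field_simps indep_powers_def)
next
  interpret Ring.field "top_field :: 'a ring" by (rule field_top_field)
  interpret subring_set K by (rule subring_set_subfield[OF K])
  have inv: "inverse k \<in> K" if "k \<in> K" for k using K that by (simp add: subfield_top_field_iff)
  case (Suc n)
  then obtain m where m: "m \<le> n" "dimension m K (span_powers K x n)" "m = n \<Longrightarrow> indep_powers K x n"
    by blast
  have le: "line_extension K (x ^ n) (span_powers K x n) = span_powers K x (Suc n)"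
  proof safe
    fix y assume "y \<in> line_extension K (x ^ n) (span_powers K x n)"
    then obtain c k where c: "c \<in> K" "\<And>i. i < n \<Longrightarrow> k i \<in> K" "y = c * x ^ n + (\<Sum>i<n. k i * x ^ i)"
      unfolding line_extension_mem_iff top_field_simps by (metis span_powersE)
    have "(\<Sum>i<Suc n. (k(n := c)) i * x ^ i) \<in> span_powers K x (Suc n)"
      by (rule span_powersI) (use c less_Suc_eq in auto)
    then show "y \<in> span_powers K x (Suc n)" by (simp add: c(3) add.commute)
  next
    fix y assume "y \<in> span_powers K x (Suc n)"
    then obtain k where k: "\<And>i. i < Suc n \<Longrightarrow> k i \<in> K" "y = (\<Sum>i<Suc n. k i * x ^ i)"
      by (metis span_powersE)
    then have "y = k n * x ^ n + (\<Sum>i<n. k i * x ^ i)" "(\<Sum>i<n. k i * x ^ i) \<in> span_powers K x n"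
      by (auto simp: add.commute intro: span_powersI)
    then show "y \<in> line_extension K (x ^ n) (span_powers K x n)"
      unfolding line_extension_mem_iff top_field_simps using k(1)[of n] by auto
  qed
  show ?case
  proof (cases "x ^ n \<in> span_powers K x n")
    case True
    then obtain k where k: "\<And>i. i < n \<Longrightarrow> k i \<in> K" "x ^ n = (\<Sum>i<n. k i * x ^ i)" by (metis span_powersE)
    have "span_powers K x (Suc n) = span_powers K x n"
    proof safe
      fix y assume "y \<in> span_powers K x (Suc n)"
      then obtain c where c: "\<And>i. i < Suc n \<Longrightarrow> c i \<in> K" "y = (\<Sum>i<Suc n. c i * x ^ i)"
        by (metis span_powersE)
      then have "y = (\<Sum>i<n. (c i + c n * k i) * x ^ i)"
        by (simp add: k(2) sum_distrib_left sum.distrib ring_distribs mult.assoc)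
      moreover have "\<dots> \<in> span_powers K x n"
        by (rule span_powersI) (use c k in \<open>auto intro!: closed\<close>)
      ultimately show "y \<in> span_powers K x n" by simp
    next
      fix y assume "y \<in> span_powers K x n"
      then obtain c where c: "\<And>i. i < n \<Longrightarrow> c i \<in> K" "y = (\<Sum>i<n. c i * x ^ i)" by (metis span_powersE)
      have "(\<Sum>i<Suc n. (c(n := 0)) i * x ^ i) \<in> span_powers K x (Suc n)"
        by (rule span_powersI) (use c(1) less_Suc_eq zero_closed in auto)
      then show "y \<in> span_powers K x (Suc n)" by (simp add: c(2))
    qed
    then show ?thesis using m by (intro exI[of _ m]) auto
  next
    case False
    have "dimension (Suc m) K (span_powers K x (Suc n))"
      using Suc_dim[OF _ False m(2)] by (simp add: le top_field_simps)
    moreover have "indep_powers K x (Suc n)" if "m = n"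
      unfolding indep_powers_def
    proof (intro allI impI)
      fix k i assume k: "\<forall>i<Suc n. k i \<in> K" "(\<Sum>i<Suc n. k i * x ^ i) = 0" and i: "i < Suc n"
      have "k n = 0"
      proof (rule ccontr)
        assume kn: "k n \<noteq> 0"
        have "k n * x ^ n = - (\<Sum>i<n. k i * x ^ i)" using k(2) by (simp add: eq_neg_iff_add_eq_0 add.commute)
        then have "x ^ n = inverse (k n) * - (\<Sum>i<n. k i * x ^ i)"
          using kn by (simp add: field_simps)
        also have "\<dots> = (\<Sum>i<n. (- inverse (k n) * k i) * x ^ i)"
          by (simp add: sum_distrib_left mult.assoc sum_negf)
        also have "\<dots> \<in> span_powers K x n"
          by (rule span_powersI) (use k(1) inv in \<open>auto intro!: closed\<close>)
        finally show False using False by simp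
      qed
      moreover from this have "\<forall>i<n. k i = 0"
        using m(3)[OF that] k unfolding indep_powers_def by auto
      ultimately show "k i = 0" using i less_Suc_eq by auto
    qed
    ultimately show ?thesis using m(1) by (intro exI[of _ "Suc m"]) auto
  qed
qed

context prime_char
begin

text \<open>The coefficients of x times a polynomial of degree below p in x, after reduction by x^p
  = x + b.\<close>

definition shift_coeffs :: "'a \<Rightarrow> (nat \<Rightarrow> 'a) \<Rightarrow> nat \<Rightarrow> 'a" where
  "shift_coeffs b k i = (if i = 0 then k (p - 1) * b else k (i - 1) + (if i = 1 then k (p - 1) else 0))"

lemma mult_sum_powers:
  "x * (\<Sum>i<p. k i * x ^ i) = (\<Sum>i<p. shift_coeffs (AS p x) k i * x ^ i)"
proof -
  obtain q where q: "p = Suc q" "q > 0" using p_gt_1 by (cases p) auto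
  then obtain r where r: "q = Suc r" by (cases q) auto
  have "x * (\<Sum>i<p. k i * x ^ i) = (\<Sum>i<q. k i * x ^ Suc i) + k q * x ^ p"
    by (simp add: q(1) sum_distrib_left ring_distribs mult_ac)
  also have "x ^ p = AS p x + x" by (simp add: AS_def)
  also have "(\<Sum>i<q. k i * x ^ Suc i) + k q * (AS p x + x)
     = (\<Sum>i<p. shift_coeffs (AS p x) k i * x ^ i)"
    unfolding shift_coeffs_def unfolding q(1) sum.lessThan_Suc_shift unfolding r sum.lessThan_Suc_shift
    by (simp add: ring_distribs)
  finally show ?thesis .
qed

lemma shift_coeffs_closed:
  assumes "subring_set K" "b \<in> K" "\<And>i. i < p \<Longrightarrow> k i \<in> K" "i < p"
  shows "shift_coeffs b k i \<in> K"
proof -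
  interpret subring_set K by fact
  have "k (p - 1) \<in> K" using assms(3) p_gt_0 by auto
  then show ?thesis using assms by (auto simp: shift_coeffs_def closed)
qed

text \<open>Products reduce to multiplication by scalars and by x, and for the latter
  \<open>mult_sum_powers\<close> brings the degree back below p.\<close>

lemma
  assumes K: "subring_set K" and b: "AS p (x::'a) \<in> K"
  shows subring_set_span_powers: "subring_set (span_powers K x p)"
    and subset_span_powers: "K \<subseteq> span_powers K x p"
    and mem_span_powers: "x \<in> span_powers K x p"
proof -
  interpret subring_set K by (rule K)
  let ?S = "span_powers K x p"
  have const: "c \<in> ?S" if "c \<in> K" for c
  proof -
    have "(\<Sum>i<p. (if i = 0 then c else 0) * x ^ i) \<in> ?S"
      by (rule span_powersI) (use that in \<open>auto simp: closed\<close>)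
    also have "(\<Sum>i<p. (if i = 0 then c else 0) * x ^ i) = c"
      using p_gt_0 by (simp add: if_distrib[of "\<lambda>u. u * _"] cong: if_cong)
    finally show ?thesis .
  qed
  have add: "y + z \<in> ?S" if yz: "y \<in> ?S" "z \<in> ?S" for y z
  proof -
    obtain k where "\<And>i. i < p \<Longrightarrow> k i \<in> K" "y = (\<Sum>i<p. k i * x ^ i)" using yz(1) by (metis span_powersE)
    moreover obtain l where "\<And>i. i < p \<Longrightarrow> l i \<in> K" "z = (\<Sum>i<p. l i * x ^ i)" using yz(2) by (metis span_powersE)
    ultimately show ?thesis
      using span_powersI[of p "\<lambda>i. k i + l i" K x] by (simp add: sum.distrib ring_distribs closed)
  qed
  have smult: "c * y \<in> ?S" if cy: "c \<in> K" "y \<in> ?S" for c y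
  proof -
    obtain k where k: "\<And>i. i < p \<Longrightarrow> k i \<in> K" "y = (\<Sum>i<p. k i * x ^ i)" using cy(2) by (metis span_powersE)
    have "(\<Sum>i<p. (c * k i) * x ^ i) \<in> ?S" by (rule span_powersI) (intro mult_closed cy(1) k(1))
    then show ?thesis by (simp add: k(2) sum_distrib_left mult.assoc)
  qed
  have xmult: "x * y \<in> ?S" if y: "y \<in> ?S" for y
  proof -
    obtain k where k: "\<And>i. i < p \<Longrightarrow> k i \<in> K" "y = (\<Sum>i<p. k i * x ^ i)" using y by (metis span_powersE)
    show ?thesis
      unfolding k(2) mult_sum_powers by (rule span_powersI) (rule shift_coeffs_closed[OF K b k(1)])
  qed
  have pmult: "x ^ i * y \<in> ?S" if "y \<in> ?S" for i y
    by (induction i) (auto simp: that xmult mult.assoc)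
  have mult: "y * z \<in> ?S" if yz: "y \<in> ?S" "z \<in> ?S" for y z
  proof -
    obtain k where k: "\<And>i. i < p \<Longrightarrow> k i \<in> K" "y = (\<Sum>i<p. k i * x ^ i)" using yz(1) by (metis span_powersE)
    have *: "k i * (x ^ i * z) \<in> ?S" if "i < p" for i
      using k(1)[OF that] yz(2) by (intro smult pmult)
    have "(\<Sum>i\<in>A. k i * (x ^ i * z)) \<in> ?S" if "A \<subseteq> {..<p}" for A
      using that * by (induction A rule: infinite_finite_induct) (auto intro: add const zero_closed)
    then show ?thesis by (simp add: k(2) sum_distrib_right mult.assoc)
  qed
  show "subring_set ?S"
  proof unfold_locales
    show "- y \<in> ?S" if "y \<in> ?S" for y
      using smult[OF uminus_closed[OF one_closed] that] by simp
  qed (auto intro: add mult const one_closed)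
  show "K \<subseteq> ?S" using const by blast
  show "x \<in> ?S" using xmult[OF const[OF one_closed]] by simp
qed

text \<open>Inverses come from algebraicity: for y in the span, the extension of K by y is a field,
  and it lies inside the span because the span is a ring containing K and y.\<close>

lemma subfield_span_powers:
  assumes K: "subfield K top_field" and b: "AS p (x::'a) \<in> K" and alg: "K0 \<subseteq> K" "algebraic_ext K0"
  shows "subfield (span_powers K x p) top_field"
proof -
  interpret Ring.field "top_field :: 'a ring" by (rule field_top_field)
  note K' = subring_set_subfield[OF K]
  interpret S: subring_set "span_powers K x p" by (rule subring_set_span_powers[OF K' b])
  have sub: "subring (span_powers K x p) top_field"
    by (rule subringI) (auto simp: top_field_simps top_field_uminus S.closed)
  have "inverse y \<in> span_powers K x p" if y: "y \<in> span_powers K x p" for y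
  proof -
    have "(algebraic over K) y" using alg algebraic_mono by blast
    then have "subfield (simple_extension K y) top_field"
      using simple_extension_is_subfield[OF K, of y] by (simp add: top_field_simps)
    moreover have "y \<in> simple_extension K y"
      using simple_extension_mem[OF subfieldE(1)[OF K]] by (simp add: top_field_simps)
    moreover have "simple_extension K y \<subseteq> span_powers K x p"
      using y by (intro simple_extension_subring_incl sub subset_span_powers[OF K' b])
    ultimately show ?thesis by (auto simp: subfield_top_field_iff)
  qed
  then show ?thesis unfolding subfield_top_field_iff using S.subring_set_axioms by blast
qed

text \<open>Independence makes x -> x' well defined on coefficients. Multiplicativity then reduces
  to multiplication by x and by x'. Both obey the rule of \<open>shift_coeffs\<close>, with
  constants that correspond under \<tau> because \<open>AS p x'\<close> is the image of
  \<open>AS p x\<close>.\<close>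

lemma extend_hom:
  assumes K: "subring_set K" and b: "AS p (x::'a) \<in> K" and ind: "indep_powers K x p"
    and \<tau>: "ring_hom_on K \<tau>" "AS p x' = (\<tau> (AS p x) :: 'a)"
  shows "\<exists>\<tau>'. ring_hom_on (span_powers K x p) \<tau>' \<and> (\<forall>c\<in>K. \<tau>' c = \<tau> c) \<and> \<tau>' x = x'"
proof -
  interpret K: ring_hom_on K \<tau> by (rule \<tau>(1))
  let ?S = "span_powers K x p"
  interpret S: subring_set ?S by (rule subring_set_span_powers[OF K b])
  define co where "co = (\<lambda>y. SOME k. (\<forall>i<p. k i \<in> K) \<and> y = (\<Sum>i<p. k i * x ^ i))"
  define h where "h = (\<lambda>y. \<Sum>i<p. \<tau> (co y i) * x' ^ i)"
  have h: "h (\<Sum>i<p. k i * x ^ i) = (\<Sum>i<p. \<tau> (k i) * x' ^ i)" if k: "\<And>i. i < p \<Longrightarrow> k i \<in> K" for k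
  proof -
    let ?y = "\<Sum>i<p. k i * x ^ i"
    have "(\<forall>i<p. co ?y i \<in> K) \<and> ?y = (\<Sum>i<p. co ?y i * x ^ i)"
      unfolding co_def by (rule someI[where x = k]) (use k in auto)
    then have "\<forall>i<p. co ?y i - k i \<in> K" "(\<Sum>i<p. (co ?y i - k i) * x ^ i) = 0"
      using k by (auto simp: K.closed left_diff_distrib sum_subtractf)
    then have "\<forall>i<p. co ?y i = k i" using ind unfolding indep_powers_def by fastforce
    then show ?thesis by (simp add: h_def)
  qed
  have const: "h c = \<tau> c" if "c \<in> K" for c
    using h[of "\<lambda>i. if i = 0 then c else 0"] that p_gt_0
    by (simp add: K.closed K.hom if_distrib[of "\<lambda>u. u * _"] if_distrib[of \<tau>] cong: if_cong)
  have add: "h (y + z) = h y + h z" if yz: "y \<in> ?S" "z \<in> ?S" for y z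
  proof -
    obtain k where k: "\<And>i. i < p \<Longrightarrow> k i \<in> K" "y = (\<Sum>i<p. k i * x ^ i)" using yz(1) by (metis span_powersE)
    obtain l where l: "\<And>i. i < p \<Longrightarrow> l i \<in> K" "z = (\<Sum>i<p. l i * x ^ i)" using yz(2) by (metis span_powersE)
    have "h (\<Sum>i<p. (k i + l i) * x ^ i) = (\<Sum>i<p. \<tau> (k i + l i) * x' ^ i)"
      using k(1) l(1) by (intro h K.closed)
    then show ?thesis
      using k l by (simp add: h K.hom ring_distribs sum.distrib)
  qed
  have smult: "h (c * y) = \<tau> c * h y" if cy: "c \<in> K" "y \<in> ?S" for c y
  proof -
    obtain k where k: "\<And>i. i < p \<Longrightarrow> k i \<in> K" "y = (\<Sum>i<p. k i * x ^ i)" using cy(2) by (metis span_powersE)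
    have hk: "h y = (\<Sum>i<p. \<tau> (k i) * x' ^ i)" unfolding k(2) by (rule h) (rule k(1))
    have "h (\<Sum>i<p. (c * k i) * x ^ i) = (\<Sum>i<p. \<tau> (c * k i) * x' ^ i)"
      using k(1) cy(1) by (intro h K.closed)
    also have "\<dots> = \<tau> c * h y"
      unfolding hk using k(1) cy(1) by (simp add: K.hom mult.assoc sum_distrib_left)
    finally show ?thesis by (simp add: k(2) sum_distrib_left mult.assoc)
  qed
  have xmult: "h (x * y) = x' * h y" if y: "y \<in> ?S" for y
  proof -
    obtain k where k: "\<And>i. i < p \<Longrightarrow> k i \<in> K" "y = (\<Sum>i<p. k i * x ^ i)" using y by (metis span_powersE)
    have hk: "h y = (\<Sum>i<p. \<tau> (k i) * x' ^ i)" unfolding k(2) by (rule h) (rule k(1))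
    have kp: "k (p - 1) \<in> K" using k(1) p_gt_0 by simp
    have "h (x * y) = (\<Sum>i<p. \<tau> (shift_coeffs (AS p x) k i) * x' ^ i)"
      unfolding k(2) mult_sum_powers by (rule h) (rule shift_coeffs_closed[OF K b k(1)])
    also have "\<dots> = (\<Sum>i<p. shift_coeffs (AS p x') (\<lambda>i. \<tau> (k i)) i * x' ^ i)"
      using k(1) kp b by (intro sum.cong HOL.refl) (auto simp: shift_coeffs_def \<tau>(2) K.hom)
    also have "\<dots> = x' * h y" unfolding mult_sum_powers[symmetric] hk ..
    finally show ?thesis .
  qed
  have x: "x \<in> ?S" by (rule mem_span_powers[OF K b])
  have pmult: "h (x ^ i * y) = x' ^ i * h y" if "y \<in> ?S" for i y
  proof (induction i)
    case (Suc i)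
    have "x ^ i * y \<in> ?S" using that x by (intro S.closed)
    then show ?case using xmult[of "x ^ i * y"] Suc by (simp add: mult.assoc)
  qed simp
  have sum: "h (\<Sum>i\<in>A. f i) = (\<Sum>i\<in>A. h (f i))" if "\<And>i. i \<in> A \<Longrightarrow> f i \<in> ?S" for A :: "nat set" and f
    using that
    by (induction A rule: infinite_finite_induct)
      (auto simp: const[OF K.zero_closed] K.hom add S.sum_closed)
  have mult: "h (y * z) = h y * h z" if yz: "y \<in> ?S" "z \<in> ?S" for y z
  proof -
    obtain k where k: "\<And>i. i < p \<Longrightarrow> k i \<in> K" "y = (\<Sum>i<p. k i * x ^ i)" using yz(1) by (metis span_powersE)
    have hk: "h y = (\<Sum>i<p. \<tau> (k i) * x' ^ i)" unfolding k(2) by (rule h) (rule k(1))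
    have "k i \<in> ?S" if "i < p" for i using k(1)[OF that] subset_span_powers[OF K b] by blast
    then have "h (\<Sum>i<p. k i * (x ^ i * z)) = (\<Sum>i<p. h (k i * (x ^ i * z)))"
      using yz(2) x by (intro sum S.closed) auto
    also have "\<dots> = (\<Sum>i<p. \<tau> (k i) * (x' ^ i * h z))"
      using k(1) yz(2) x by (intro sum.cong HOL.refl) (simp add: smult pmult S.closed)
    also have "\<dots> = h y * h z" by (simp only: hk sum_distrib_right mult.assoc)
    finally show ?thesis by (simp add: k(2) sum_distrib_right mult.assoc)
  qed
  have "ring_hom_on ?S h"
    by (intro ring_hom_on.intro ring_hom_on_axioms.intro S.subring_set_axioms)
      (auto simp: add mult const[OF K.one_closed] K.hom)
  moreover have "h x = x'"
    using xmult[of 1] S.one_closed const[OF K.one_closed] by (simp add: K.hom)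
  ultimately show ?thesis using const by blast
qed

text \<open>The polynomial \<open>P - y\<close>, where \<open>P(x) = y\<close> and \<open>deg P < p\<close>, has the \<open>p\<close> roots \<open>x + j\<close>.\<close>

lemma span_powers_fixed:
  assumes y: "y \<in> span_powers K x p" and \<tau>: "ring_hom_total \<tau>" "\<And>c. c \<in> K \<Longrightarrow> \<tau> c = c"
    "\<tau> x = (x::'a) + 1" "\<tau> y = y"
  shows "y \<in> K"
proof -
  obtain k where k: "\<And>i. i < p \<Longrightarrow> k i \<in> K" "y = (\<Sum>i<p. k i * x ^ i)" using y by (metis span_powersE)
  define P where "P = (\<Sum>i<p. monom (k i) i) - [:y:]"
  have poly: "poly P z = (\<Sum>i<p. k i * z ^ i) - y" for z
    by (simp add: P_def poly_sum poly_monom)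
  have root: "poly P (x + of_nat j) = 0" for j
  proof (induction j)
    case (Suc j)
    note hom = ring_hom_on.hom[OF \<tau>(1)]
    have "\<tau> (poly P (x + of_nat j)) = poly P (x + of_nat (Suc j))"
      unfolding poly using k(1) by (simp add: hom \<tau> add_ac)
    then show ?case using Suc by (simp add: hom)
  qed (simp add: poly k(2))
  have coeff: "coeff P i = (if i < p then k i else 0) - (if i = 0 then y else 0)" for i
    by (auto simp: P_def coeff_sum coeff_monom coeff_pCons split: nat.split)
  have "P = 0"
  proof (rule ccontr)
    assume "P \<noteq> 0"
    have "degree P \<le> p - 1" by (rule degree_le) (auto simp: coeff)
    have "inj_on (\<lambda>j. x + of_nat j) {..<p}"
      by (auto intro!: inj_onI simp: of_nat_eq_iff_less)
    then have "card ((\<lambda>j. x + of_nat j) ` {..<p}) = p" by (simp add: card_image)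
    moreover have "(\<lambda>j. x + of_nat j) ` {..<p} \<subseteq> {z. poly P z = 0}" using root by auto
    ultimately have "p \<le> card {z. poly P z = 0}"
      using card_mono[OF poly_roots_finite[OF \<open>P \<noteq> 0\<close>]] by metis
    also have "\<dots> \<le> degree P" by (rule card_poly_roots_bound[OF \<open>P \<noteq> 0\<close>])
    finally show False using \<open>degree P \<le> p - 1\<close> p_gt_0 by linarith
  qed
  then have "k 0 = y" using coeff[of 0] p_gt_0 by simp
  then show ?thesis using k(1)[of 0] p_gt_0 by simp
qed

end

text \<open>Equalisers are subfields, so two endomorphisms of the field coincide once they agree on
  K0 and the four roots. In the same way, ranges being subfields reduces surjectivity to
  generators.\<close>

lemma ring_hom_on_eq_subfield:
  assumes "ring_hom_total f" "ring_hom_total (g :: 'a::field \<Rightarrow> 'a)"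
  shows "subfield {x. f x = g x} top_field"
  unfolding subfield_top_field_iff
  by (auto intro!: subring_set.intro simp: ring_hom_on.hom[OF assms(1)] ring_hom_on.hom[OF assms(2)]
      ring_hom_total_inverse[OF assms(1)] ring_hom_total_inverse[OF assms(2)])

lemma subfield_range:
  assumes "ring_hom_total (f :: 'a::field \<Rightarrow> 'a)"
  shows "subfield (range f) top_field"
  unfolding subfield_top_field_iff
proof (intro conjI ballI subring_set.intro; (elim rangeE)?; hypsubst?)
  note hom = ring_hom_on.hom[OF assms]
  show "1 \<in> range f" by (intro range_eqI[of _ _ 1]) (simp add: hom)
  show "f x + f y \<in> range f" for x y by (intro range_eqI[of _ _ "x + y"]) (simp add: hom)
  show "f x * f y \<in> range f" for x y by (intro range_eqI[of _ _ "x * y"]) (simp add: hom)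
  show "- f x \<in> range f" for x by (intro range_eqI[of _ _ "- x"]) (simp add: hom)
  show "inverse (f x) \<in> range f" for x
    by (intro range_eqI[of _ _ "inverse x"]) (simp add: ring_hom_total_inverse[OF assms])
qed

section \<open>From roots of the equations to the Galois group\<close>

locale root_tower = tower p ty R e3 e4 rhs3 rhs4
  for p :: nat and ty :: "'a::field itself" and R e3 e4 rhs3 rhs4 +
  fixes K0 :: "'a set" and x1 x2 x3 x4 \<beta>2 \<beta>3 \<beta>4 :: 'a
  assumes K0: "subfield K0 top_field" and alg: "algebraic_ext K0" and deg: "ext_degree K0 (p ^ 4)"
    and gen: "generate_field top_field (K0 \<union> {x1, x2, x3, x4}) = UNIV"
    and \<beta>: "AS p x1 \<in> K0" "\<beta>2 \<in> K0" "\<beta>3 \<in> K0" "\<beta>4 \<in> K0"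
    and AS2: "AS p x2 = \<beta>2" and AS3: "AS p x3 = rhs3 \<beta>2 x1 + \<beta>3"
    and AS4: "AS p x4 = rhs4 \<beta>2 \<beta>3 x1 x2 x3 + \<beta>4"
begin

definition "K1 = span_powers K0 x1 p"
definition "K2 = span_powers K1 x2 p"
definition "K3 = span_powers K2 x3 p"
definition "K4 = span_powers K3 x4 p"

lemma K1: "K0 \<subseteq> K1" "x1 \<in> K1" "subfield K1 top_field"
  using subset_span_powers[OF subring_set_subfield[OF K0] \<beta>(1)] mem_span_powers[OF subring_set_subfield[OF K0] \<beta>(1)]
    subfield_span_powers[OF K0 \<beta>(1) order_refl alg] by (auto simp: K1_def)

lemma AS2_mem: "AS p x2 \<in> K1"
  using AS2 \<beta> K1 by auto

lemma K2: "K1 \<subseteq> K2" "x2 \<in> K2" "subfield K2 top_field"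
  using subset_span_powers[OF subring_set_subfield[OF K1(3)] AS2_mem]
    mem_span_powers[OF subring_set_subfield[OF K1(3)] AS2_mem]
    subfield_span_powers[OF K1(3) AS2_mem K1(1) alg] by (auto simp: K2_def)

lemma AS3_mem: "AS p x3 \<in> K2"
proof -
  interpret subring_set K2 by (rule subring_set_subfield[OF K2(3)])
  show ?thesis unfolding AS3
    using K1 K2 \<beta> by (intro add_closed rhs3_closed subring_set_axioms) auto
qed

lemma K3: "K2 \<subseteq> K3" "x3 \<in> K3" "subfield K3 top_field"
  using subset_span_powers[OF subring_set_subfield[OF K2(3)] AS3_mem]
    mem_span_powers[OF subring_set_subfield[OF K2(3)] AS3_mem]
    subfield_span_powers[OF K2(3) AS3_mem _ alg] K1(1) K2(1) by (auto simp: K3_def)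

lemma AS4_mem: "AS p x4 \<in> K3"
proof -
  interpret subring_set K3 by (rule subring_set_subfield[OF K3(3)])
  show ?thesis unfolding AS4
    using K1 K2 K3 \<beta> by (intro add_closed rhs4_closed K3(3)) auto
qed

lemma K4: "K3 \<subseteq> K4" "x4 \<in> K4" "subfield K4 top_field"
  using subset_span_powers[OF subring_set_subfield[OF K3(3)] AS4_mem]
    mem_span_powers[OF subring_set_subfield[OF K3(3)] AS4_mem]
    subfield_span_powers[OF K3(3) AS4_mem _ alg] K1(1) K2(1) K3(1) by (auto simp: K4_def)

lemma eq_UNIV_if:
  assumes "subfield L top_field" "K0 \<subseteq> L" "x1 \<in> L" "x2 \<in> L" "x3 \<in> L" "x4 \<in> L"
  shows "L = UNIV"
  using generate_field_subset_iff[OF assms(1), of "K0 \<union> {x1, x2, x3, x4}"] gen assms by auto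

lemma K4_eq_UNIV: "K4 = UNIV"
  using K1 K2 K3 K4 by (intro eq_UNIV_if) auto

lemma indep: "indep_powers K0 x1 p" "indep_powers K1 x2 p" "indep_powers K2 x3 p" "indep_powers K3 x4 p"
proof -
  interpret Ring.field "top_field :: 'a ring" by (rule field_top_field)
  obtain m1 where 1: "m1 \<le> p" "dimension m1 K0 K1" "m1 = p \<Longrightarrow> indep_powers K0 x1 p"
    using dimension_span_powers[OF K0, of p x1] by (auto simp: K1_def)
  obtain m2 where 2: "m2 \<le> p" "dimension m2 K1 K2" "m2 = p \<Longrightarrow> indep_powers K1 x2 p"
    using dimension_span_powers[OF K1(3), of p x2] by (auto simp: K2_def)
  obtain m3 where 3: "m3 \<le> p" "dimension m3 K2 K3" "m3 = p \<Longrightarrow> indep_powers K2 x3 p"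
    using dimension_span_powers[OF K2(3), of p x3] by (auto simp: K3_def)
  obtain m4 where 4: "m4 \<le> p" "dimension m4 K3 K4" "m4 = p \<Longrightarrow> indep_powers K3 x4 p"
    using dimension_span_powers[OF K3(3), of p x4] by (auto simp: K4_def)
  have "dimension (m1 * m2 * m3 * m4) K0 UNIV"
    using telescopic_base[OF K0 K3(3) telescopic_base[OF K0 K2(3) telescopic_base[OF K0 K1(3) 1(2) 2(2)] 3(2)] 4(2)]
    by (simp add: K4_eq_UNIV)
  then have eq: "m1 * m2 * m3 * m4 = p ^ 4"
    using dimension_is_inj[OF K0] deg by blast
  have le: "a = p \<and> b = c" if "a * b = p * c" "a \<le> p" "b \<le> c" "c > 0" for a b c
    using that p_gt_0
    by (metis le_neq_implies_less mult.commute mult_le_less_imp_less mult_less_le_imp_less nat_less_le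
        not_gr_zero zero_le mult_cancel_left mult_le_mono1 nat_mult_less_cancel_disj order_le_less_trans)
  have "m1 * (m2 * (m3 * m4)) = p * (p * (p * p))"
    using eq by (simp add: mult.assoc eval_nat_numeral)
  then have "m1 = p" "m2 * (m3 * m4) = p * (p * p)"
    using le[of m1 "m2 * (m3 * m4)" "p * (p * p)"] 1(1) 2(1) 3(1) 4(1) p_gt_0 by (auto intro: mult_le_mono)
  moreover from this have "m2 = p" "m3 * m4 = p * p"
    using le[of m2 "m3 * m4" "p * p"] 2(1) 3(1) 4(1) p_gt_0 by (auto intro: mult_le_mono)
  moreover from this have "m3 = p" "m4 = p"
    using le[of m3 m4 p] 3(1) 4(1) p_gt_0 by auto
  ultimately show "indep_powers K0 x1 p" "indep_powers K1 x2 p" "indep_powers K2 x3 p" "indep_powers K3 x4 p"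
    using 1(3) 2(3) 3(3) 4(3) by auto
qed

lemma exists_generator:
  "\<exists>\<tau>. ring_hom_total \<tau> \<and> (\<forall>c\<in>K0. \<tau> c = c) \<and> \<tau> x1 = x1 + e1 g \<and> \<tau> x2 = x2 + e2 g
    \<and> \<tau> x3 = x3 + e3 g x1 x2 \<and> \<tau> x4 = x4 + e4 g x1 x2 x3"
proof -
  have AS_e: "AS p (e1 g :: 'a) = 0" "AS p (e2 g :: 'a) = 0" by (auto simp: e1_def e2_def AS_0 AS_1)
  note s0 = subring_set_subfield[OF K0] and s1 = subring_set_subfield[OF K1(3)]
    and s2 = subring_set_subfield[OF K2(3)] and s3 = subring_set_subfield[OF K3(3)]
  have "ring_hom_on K0 (\<lambda>c. c)"
    by (intro ring_hom_on.intro s0 ring_hom_on_axioms.intro) auto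
  then obtain \<tau>1 where t1: "ring_hom_on K1 \<tau>1" "\<And>c. c \<in> K0 \<Longrightarrow> \<tau>1 c = c" "\<tau>1 x1 = x1 + e1 g"
    using extend_hom[OF s0 \<beta>(1) indep(1), of "\<lambda>c. c" "x1 + e1 g"] by (auto simp: K1_def AS_add AS_e)
  obtain \<tau>2 where t2: "ring_hom_on K2 \<tau>2" "\<And>c. c \<in> K1 \<Longrightarrow> \<tau>2 c = \<tau>1 c" "\<tau>2 x2 = x2 + e2 g"
    using extend_hom[OF s1 AS2_mem indep(2) t1(1), of "x2 + e2 g"] t1(2)[OF \<beta>(2)]
    by (auto simp: K2_def AS_add AS_e AS2)
  have K0_2: "\<tau>2 c = c" if "c \<in> K0" for c using that t1 t2 K1 by auto
  have x1_2: "\<tau>2 x1 = x1 + e1 g" using t1 t2 K1 by auto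
  have "\<tau>2 (rhs3 \<beta>2 x1) = rhs3 \<beta>2 x1 + AS p (e3 g x1 x2)"
    using K1 K2 \<beta> K0_2 by (intro hom_rhs3[OF t2(1) _ _ _ _ x1_2 t2(3) AS2]) auto
  moreover have "rhs3 \<beta>2 x1 \<in> K2" using K1 K2 \<beta> by (intro rhs3_closed s2) auto
  moreover have "\<beta>3 \<in> K2" using K1 K2 \<beta> by auto
  ultimately have 3: "AS p (x3 + e3 g x1 x2) = \<tau>2 (AS p x3)"
    using K0_2[OF \<beta>(3)] by (simp add: AS_add AS3 ring_hom_on.hom_add[OF t2(1)])
  obtain \<tau>3 where t3: "ring_hom_on K3 \<tau>3" "\<And>c. c \<in> K2 \<Longrightarrow> \<tau>3 c = \<tau>2 c" "\<tau>3 x3 = x3 + e3 g x1 x2"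
    using extend_hom[OF s2 AS3_mem indep(3) t2(1) 3] by (auto simp: K3_def)
  have K0_3: "\<tau>3 c = c" if "c \<in> K0" for c using that K0_2 t3 K1 K2 by auto
  have x12_3: "\<tau>3 x1 = x1 + e1 g" "\<tau>3 x2 = x2 + e2 g" using x1_2 t2 t3 K1 K2 by auto
  have "\<tau>3 (rhs4 \<beta>2 \<beta>3 x1 x2 x3) = rhs4 \<beta>2 \<beta>3 x1 x2 x3 + AS p (e4 g x1 x2 x3)"
    using K1 K2 K3 \<beta> K0_3 by (intro hom_rhs4[OF K3(3) t3(1) _ _ _ _ _ _ _ x12_3 t3(3) AS2 AS3]) auto
  moreover have "rhs4 \<beta>2 \<beta>3 x1 x2 x3 \<in> K3" using K1 K2 K3 \<beta> by (intro rhs4_closed K3) auto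
  moreover have "\<beta>4 \<in> K3" using K1 K2 K3 \<beta> by auto
  ultimately have 4: "AS p (x4 + e4 g x1 x2 x3) = \<tau>3 (AS p x4)"
    using K0_3[OF \<beta>(4)] by (simp add: AS_add AS4 ring_hom_on.hom_add[OF t3(1)])
  obtain \<tau>4 where t4: "ring_hom_total \<tau>4" "\<And>c. c \<in> K3 \<Longrightarrow> \<tau>4 c = \<tau>3 c" "\<tau>4 x4 = x4 + e4 g x1 x2 x3"
    using extend_hom[OF s3 AS4_mem indep(4) t3(1) 4] K4_eq_UNIV by (auto simp: K4_def)
  have "\<forall>c\<in>K0. \<tau>4 c = c" "\<tau>4 x1 = x1 + e1 g" "\<tau>4 x2 = x2 + e2 g" "\<tau>4 x3 = x3 + e3 g x1 x2"
  proof -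
    have "K0 \<subseteq> K3" "x1 \<in> K3" "x2 \<in> K3" using K1 K2 K3 by auto
    then show "\<forall>c\<in>K0. \<tau>4 c = c" "\<tau>4 x1 = x1 + e1 g" "\<tau>4 x2 = x2 + e2 g" "\<tau>4 x3 = x3 + e3 g x1 x2"
      using K0_3 x12_3 t3(3) t4(2) K3(2) by (simp_all add: subset_iff)
  qed
  with t4 show ?thesis by blast
qed

definition \<sigma> :: "gen \<Rightarrow> 'a \<Rightarrow> 'a" where
  "\<sigma> g = (SOME \<tau>. ring_hom_total \<tau> \<and> (\<forall>c\<in>K0. \<tau> c = c) \<and> \<tau> x1 = x1 + e1 g \<and> \<tau> x2 = x2 + e2 g
    \<and> \<tau> x3 = x3 + e3 g x1 x2 \<and> \<tau> x4 = x4 + e4 g x1 x2 x3)"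

lemma \<sigma>: "ring_hom_total (\<sigma> g)" "c \<in> K0 \<Longrightarrow> \<sigma> g c = c" "\<sigma> g x1 = x1 + e1 g" "\<sigma> g x2 = x2 + e2 g"
    "\<sigma> g x3 = x3 + e3 g x1 x2" "\<sigma> g x4 = x4 + e4 g x1 x2 x3"
  using someI_ex[OF exists_generator[of g]] unfolding \<sigma>_def[symmetric] by auto

text \<open>Surjectivity climbs the tower: the range contains the image of each root, and the shift
  to be subtracted is an expression in roots already known to lie in the range.\<close>

lemma bij_\<sigma>: "bij (\<sigma> g)"
proof -
  note hom = ring_hom_on.hom[OF \<sigma>(1)[of g]]
  have "inj (\<sigma> g)"
  proof (rule injI)
    fix y z assume "\<sigma> g y = \<sigma> g z"
    then have d: "\<sigma> g (y - z) = 0" by (simp add: hom)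
    show "y = z"
    proof (rule ccontr)
      assume "y \<noteq> z"
      then have "\<sigma> g ((y - z) * inverse (y - z)) = 1" by (simp add: hom)
      then show False using d by (simp only: hom UNIV_I mult_zero_left zero_neq_one)
    qed
  qed
  moreover have "range (\<sigma> g) = UNIV"
  proof -
    have sub: "subfield (range (\<sigma> g)) top_field" by (rule subfield_range[OF \<sigma>(1)])
    interpret subring_set "range (\<sigma> g)" by (rule subring_set_subfield[OF sub])
    have 0: "K0 \<subseteq> range (\<sigma> g)" using \<sigma>(2)[of _ g] by (metis rangeI subsetI)
    have e: "e1 g \<in> range (\<sigma> g)" "e2 g \<in> range (\<sigma> g)"
      using zero_closed one_closed unfolding e1_def e2_def by metis+
    have "\<sigma> g x1 - e1 g \<in> range (\<sigma> g)" by (intro diff_closed e rangeI)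
    then have 1: "x1 \<in> range (\<sigma> g)" by (simp add: \<sigma>)
    have "\<sigma> g x2 - e2 g \<in> range (\<sigma> g)" by (intro diff_closed e rangeI)
    then have 2: "x2 \<in> range (\<sigma> g)" by (simp add: \<sigma>)
    have "\<sigma> g x3 - e3 g x1 x2 \<in> range (\<sigma> g)" by (intro diff_closed e3_closed subring_set_axioms 1 2 rangeI)
    then have 3: "x3 \<in> range (\<sigma> g)" by (simp add: \<sigma>)
    have "\<sigma> g x4 - e4 g x1 x2 x3 \<in> range (\<sigma> g)" by (intro diff_closed e4_closed subring_set_axioms 1 2 3 rangeI)
    then have 4: "x4 \<in> range (\<sigma> g)" by (simp add: \<sigma>)
    show ?thesis by (rule eq_UNIV_if[OF sub 0 1 2 3 4])
  qed
  ultimately show ?thesis by (simp add: bij_def)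
qed

sublocale field_auts \<sigma>
  by (rule field_auts.intro) (rule bij_\<sigma> \<sigma>(1))+

lemma eqI:
  fixes f h :: "'a \<Rightarrow> 'a"
  assumes "ring_hom_total f" "ring_hom_total h" "\<And>c. c \<in> K0 \<Longrightarrow> f c = h c"
    "f x1 = h x1" "f x2 = h x2" "f x3 = h x3" "f x4 = h x4"
  shows "f = h"
proof -
  have "{x. f x = h x} = UNIV"
    using assms(3-7) by (intro eq_UNIV_if ring_hom_on_eq_subfield[OF assms(1,2)]) auto
  then have "f x = h x" for x by blast
  then show ?thesis by (rule ext)
qed

lemma act_K0: "c \<in> K0 \<Longrightarrow> act \<sigma> w c = c"
  using act_shift[of c "\<lambda>_. 0" w] act_shift[of 0 "\<lambda>_. 0" w] by (simp add: \<sigma> act_hom gen_hom)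

text \<open>An automorphism over K0 is determined by its shifts of the four roots. For a word these
  shifts are the values of the four crossed homomorphisms, which respect the relations.\<close>

lemma act_eq_if_word_eq:
  assumes "word_eq R u v"
  shows "act \<sigma> u = act \<sigma> v"
proof (rule act_eqI[OF _ assms])
  fix u v assume uv: "(u, v) \<in> R"
  note ax = field_auts_axioms
  show "act \<sigma> u = act \<sigma> v"
    using cocyc_e1[OF ax uv] cocyc_e2[OF ax uv] cocyc_e3[OF ax \<sigma>(3,4) uv] cocyc_e4[OF ax \<sigma>(3-5) uv]
    by (intro eqI ring_hom_act) (auto simp: act_K0 act_shift[OF \<sigma>(3)] act_shift[OF \<sigma>(4)]
        act_shift[OF \<sigma>(5)] act_shift[OF \<sigma>(6)])
qed

lemma cocyc_replicate_0: "f g = 0 \<Longrightarrow> cocyc \<sigma> f (replicate n (g, True) @ w) = (\<sigma> g ^^ n) (cocyc \<sigma> f w)"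
  by (induction n) auto

lemma cocyc_replicate_1: "f g = 1 \<Longrightarrow> cocyc \<sigma> f (replicate n (g, True)) = of_nat n"
  by (induction n) (auto simp: gen_hom)

lemma cocyc_replicate_1_append:
  "f g = 1 \<Longrightarrow> cocyc \<sigma> f w = 0 \<Longrightarrow> cocyc \<sigma> f (replicate n (g, True) @ w) = of_nat n"
  by (simp add: cocyc_append cocyc_replicate_1 act_hom)

lemma funpow_0: "(\<sigma> g ^^ n) 0 = 0"
  by (induction n) (auto simp: gen_hom)

text \<open>The shifts of x1, ..., x4 yield the exponents in this order. The order matters because
  \<open>e3\<close> and \<open>e4\<close> can be nonzero at earlier generators, whose exponents must
  already be known to vanish. Each exponent is below p, so its image in the field is zero only if it
  is zero.\<close>

lemma word_eq_Nil_if_act: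
  assumes "act \<sigma> w = id"
  shows "word_eq R w []"
proof -
  obtain i j k l where lt: "i < p" "j < p" "k < p" "l < p" and nf: "word_eq R w (nf_word i j k l)"
    using normal_form[of w] by blast
  have act: "act \<sigma> (nf_word i j k l) = id" using act_eq_if_word_eq[OF nf] assms by simp
  have c1: "cocyc \<sigma> e1 (nf_word i j k l) = 0" using act_shift[OF \<sigma>(3), of "nf_word i j k l"] act by simp
  have "cocyc \<sigma> e1 (replicate n (S4, True)) = 0" for n
    using cocyc_replicate_0[of e1 S4 n "[]"] by (simp add: e1_def funpow_0)
  then have "cocyc \<sigma> e1 (nf_word i j k l) = of_nat i"
    unfolding nf_word_def
    by (intro cocyc_replicate_1_append) (simp_all add: e1_def cocyc_replicate_0 funpow_0)
  then have i: "i = 0" using c1 of_nat_eq_iff_less[of i 0] lt by simp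
  have c2: "cocyc \<sigma> e2 (nf_word i j k l) = 0" using act_shift[OF \<sigma>(4), of "nf_word i j k l"] act by simp
  have "cocyc \<sigma> e2 (replicate n (S4, True)) = 0" for n
    using cocyc_replicate_0[of e2 S4 n "[]"] by (simp add: e2_def funpow_0)
  then have "cocyc \<sigma> e2 (replicate j (S2, True) @ replicate k (S3, True) @ replicate l (S4, True)) = of_nat j"
    by (intro cocyc_replicate_1_append) (simp_all add: e2_def cocyc_replicate_0 funpow_0)
  then have j: "j = 0" using c2 of_nat_eq_iff_less[of j 0] lt by (simp add: nf_word_def i)
  have c3: "cocyc \<sigma> (\<lambda>g. e3 g x1 x2) (nf_word i j k l) = 0"
    using act_shift[OF \<sigma>(5), of "nf_word i j k l"] act by simp
  have "cocyc \<sigma> (\<lambda>g. e3 g x1 x2) (replicate n (S4, True)) = 0" for n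
    using cocyc_replicate_0[of "\<lambda>g. e3 g x1 x2" S4 n "[]"] by (simp add: e3_S4 funpow_0)
  then have "cocyc \<sigma> (\<lambda>g. e3 g x1 x2) (replicate k (S3, True) @ replicate l (S4, True)) = of_nat k"
    by (intro cocyc_replicate_1_append) (simp_all add: e3_S3)
  then have k: "k = 0" using c3 of_nat_eq_iff_less[of k 0] lt by (simp add: nf_word_def i j)
  have "cocyc \<sigma> (\<lambda>g. e4 g x1 x2 x3) (nf_word i j k l) = 0"
    using act_shift[OF \<sigma>(6), of "nf_word i j k l"] act by simp
  moreover have "cocyc \<sigma> (\<lambda>g. e4 g x1 x2 x3) (replicate l (S4, True)) = of_nat l"
    by (rule cocyc_replicate_1) (simp add: e4_S4)
  ultimately have "l = 0" using of_nat_eq_iff_less[of l 0] lt by (simp add: nf_word_def i j k)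
  with i j k nf show ?thesis by (simp add: nf_word_def)
qed

lemma act_eq_iff_word_eq: "act \<sigma> u = act \<sigma> v \<longleftrightarrow> word_eq R u v"
proof
  assume "act \<sigma> u = act \<sigma> v"
  then have "act \<sigma> (word_inv v @ u) = id"
    by (auto simp: act_append fun_eq_iff act_word_inv)
  then show "word_eq R u v" by (rule word_eq_left_cancel[OF word_eq_Nil_if_act])
qed (rule act_eq_if_word_eq)

lemma act_in_galois_group: "act \<sigma> w \<in> carrier (galois_group K0)"
  by (simp add: carrier_galois_group bij_act ring_hom_act act_K0)

text \<open>\<tau> x and x have the same value under \<open>AS\<close>, so they differ by an element
  of the prime field, which a power of \<open>\<sigma> g\<close> undoes.\<close>

lemma correct_root:
  assumes "ring_hom_total \<tau>" "\<tau> (AS p x) = AS p x" "\<sigma> g x = x + 1"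
  shows "\<exists>n. act \<sigma> (word_inv (replicate n (g, True))) (\<tau> x) = x"
proof -
  note hom = ring_hom_on.hom[OF assms(1)]
  have "AS p (\<tau> x) = \<tau> (AS p x)" by (simp add: AS_def hom)
  then have "AS p (\<tau> x - x) = 0" using assms(2) by (simp add: AS_diff)
  then obtain n where n: "\<tau> x - x = of_nat n" using AS_eq_0_imp_of_nat by blast
  have "act \<sigma> (replicate n (g, True)) x = x + of_nat n"
    unfolding letter_pow_int[symmetric] act_letter_pow_int
    by (induction n) (auto simp: assms(3) gen_hom)
  then have "\<tau> x = act \<sigma> (replicate n (g, True)) x" using n by (simp add: diff_eq_eq add.commute)
  then show ?thesis by (metis act_word_inv)
qed

lemma act_word_inv_fixed:
  assumes "\<sigma> g x = x"
  shows "act \<sigma> (word_inv (replicate n (g, True))) x = x"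
proof -
  have "act \<sigma> (replicate n (g, True)) x = x"
    unfolding letter_pow_int[symmetric] act_letter_pow_int by (induction n) (auto simp: assms)
  then show ?thesis using act_word_inv by metis
qed

lemma galois_group_eq_range_act: "carrier (galois_group K0) = range (act \<sigma>)"
proof
  show "carrier (galois_group K0) \<subseteq> range (act \<sigma>)"
  proof
    fix \<tau> assume "\<tau> \<in> carrier (galois_group K0)"
    then have \<tau>: "ring_hom_total \<tau>" "\<And>c. c \<in> K0 \<Longrightarrow> \<tau> c = c" by (auto simp: carrier_galois_group)
    let ?c = "\<lambda>g n. act \<sigma> (word_inv (replicate n (g, True)))"
    have hom: "ring_hom_total (?c g n \<circ> \<upsilon>)" if "ring_hom_total \<upsilon>" for g n \<upsilon>
      by (intro ring_hom_total_comp ring_hom_act that)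
    obtain i where i: "?c S1 i (\<tau> x1) = x1"
      using correct_root[OF \<tau>(1), of x1 S1] \<tau>(2) \<beta>(1) by (auto simp: \<sigma> e1_def)
    define \<tau>1 where "\<tau>1 = ?c S1 i \<circ> \<tau>"
    have \<tau>1: "ring_hom_total \<tau>1" "\<And>c. c \<in> K0 \<Longrightarrow> \<tau>1 c = c" "\<tau>1 x1 = x1"
      unfolding \<tau>1_def using hom \<tau> i by (auto simp: act_K0)
    obtain j where j: "?c S2 j (\<tau>1 x2) = x2"
      using correct_root[OF \<tau>1(1), of x2 S2] \<tau>1(2) \<beta>(2) AS2 by (auto simp: \<sigma> e2_def)
    define \<tau>2 where "\<tau>2 = ?c S2 j \<circ> \<tau>1"
    have \<tau>2: "ring_hom_total \<tau>2" "\<And>c. c \<in> K0 \<Longrightarrow> \<tau>2 c = c" "\<tau>2 x1 = x1" "\<tau>2 x2 = x2"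
      unfolding \<tau>2_def using hom \<tau>1 j by (auto simp: act_K0 act_word_inv_fixed \<sigma> e1_def)
    \<comment> \<open>The generator S4 has shift 0 on x1, x2 and x3, so the transformation rule
      taken at S4 states plain invariance.\<close>
    have "\<tau>2 (rhs3 \<beta>2 x1) = rhs3 \<beta>2 x1 + AS p (e3 S4 x1 x2)"
      using \<tau>2 \<beta> by (intro hom_rhs3[OF \<tau>2(1)]) (auto simp: AS2 e1_def e2_def)
    then have "\<tau>2 (AS p x3) = AS p x3"
      using \<tau>2(2) \<beta>(3) by (simp add: AS3 ring_hom_on.hom[OF \<tau>2(1)] e3_S4 AS_0)
    then obtain k where k: "?c S3 k (\<tau>2 x3) = x3"
      using correct_root[OF \<tau>2(1), of x3 S3] by (auto simp: \<sigma> e3_S3)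
    define \<tau>3 where "\<tau>3 = ?c S3 k \<circ> \<tau>2"
    have \<tau>3: "ring_hom_total \<tau>3" "\<And>c. c \<in> K0 \<Longrightarrow> \<tau>3 c = c" "\<tau>3 x1 = x1" "\<tau>3 x2 = x2" "\<tau>3 x3 = x3"
      unfolding \<tau>3_def using hom \<tau>2 k by (auto simp: act_K0 act_word_inv_fixed \<sigma> e1_def e2_def)
    have U: "subfield (UNIV :: 'a set) top_field" using K4(3) K4_eq_UNIV by simp
    \<comment> \<open>Again the rule at S4; its shift of x4 is 1, which \<open>AS\<close> sends to
      0.\<close>
    have "\<tau>3 (rhs4 \<beta>2 \<beta>3 x1 x2 x3) = rhs4 \<beta>2 \<beta>3 x1 x2 x3 + AS p (e4 S4 x1 x2 x3)"
      using \<tau>3 \<beta> by (intro hom_rhs4[OF U \<tau>3(1)]) (auto simp: AS2 AS3 e1_def e2_def e3_S4)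
    then have "\<tau>3 (AS p x4) = AS p x4"
      using \<tau>3(2) \<beta>(4) by (simp add: AS4 ring_hom_on.hom[OF \<tau>3(1)] e4_S4 AS_1)
    then obtain l where l: "?c S4 l (\<tau>3 x4) = x4"
      using correct_root[OF \<tau>3(1), of x4 S4] by (auto simp: \<sigma> e4_S4)
    have "?c S4 l \<circ> \<tau>3 = id"
      using \<tau>3 hom[OF \<tau>3(1), of l S4] l
      by (intro eqI) (auto simp: ring_hom_total_id act_K0 act_word_inv_fixed \<sigma> e1_def e2_def e3_S4)
    then have "act \<sigma> (word_inv (replicate l (S4, True)) @ word_inv (replicate k (S3, True))
        @ word_inv (replicate j (S2, True)) @ word_inv (replicate i (S1, True))) \<circ> \<tau> = id" (is "act \<sigma> ?w \<circ> \<tau> = id")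
      by (simp add: act_append \<tau>3_def \<tau>2_def \<tau>1_def comp_assoc)
    then have "\<tau> = act \<sigma> (word_inv ?w)"
      using act_word_inv[of ?w] by (auto simp: fun_eq_iff) metis
    then show "\<tau> \<in> range (act \<sigma>)" by (rule range_eqI)
  qed
qed (auto simp: act_in_galois_group)

text \<open>A fixed element descends from K4 to K0. At each step one generator fixes the lower field
  and moves the adjoined root by 1, and an element of the upper field fixed by it lies in the lower
  one.\<close>

lemma galois_ext_K0: "galois_ext K0"
proof -
  have "y \<in> K0" if y: "\<And>\<tau>. \<tau> \<in> carrier (galois_group K0) \<Longrightarrow> \<tau> y = y" for y
  proof -
    have \<sigma>y: "\<sigma> g y = y" for g
      using y[OF act_in_galois_group[of "[(g, True)]"]] by simp
    have fixes_eq: "K \<subseteq> {x. \<sigma> g x = id x}" if "K0 \<subseteq> L" "L \<subseteq> {x. \<sigma> g x = id x}" "K = span_powers L x p" "\<sigma> g x = x"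
      for K L x g
    proof -
      have "subring_set {x. \<sigma> g x = id x}"
        by (rule subring_set_subfield) (rule ring_hom_on_eq_subfield[OF \<sigma>(1) ring_hom_total_id])
      then show ?thesis unfolding that(3) using that by (intro span_powers_subset) auto
    qed
    have k0: "K0 \<subseteq> {x. \<sigma> g x = id x}" for g using \<sigma>(2) by auto
    have k1: "K1 \<subseteq> {x. \<sigma> g x = id x}" if "g \<noteq> S1" for g
      using that by (intro fixes_eq[OF _ k0 K1_def]) (auto simp: \<sigma> e1_def)
    have k2: "K2 \<subseteq> {x. \<sigma> g x = id x}" if "g \<notin> {S1, S2}" for g
      using that K1 by (intro fixes_eq[OF _ k1 K2_def]) (auto simp: \<sigma> e2_def)
    have k3: "K3 \<subseteq> {x. \<sigma> S4 x = id x}"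
      using K1 K2 by (intro fixes_eq[OF _ k2 K3_def]) (auto simp: \<sigma> e3_S4)
    have "y \<in> span_powers K3 x4 p" using K4_eq_UNIV by (simp add: K4_def)
    then have "y \<in> K3"
      using k3 by (intro span_powers_fixed[of y K3 x4, OF _ \<sigma>(1)[of S4]]) (auto simp: \<sigma> \<sigma>y e4_S4)
    then have "y \<in> span_powers K2 x3 p" by (simp add: K3_def)
    then have "y \<in> K2"
      using k2[of S3] by (intro span_powers_fixed[of y K2 x3, OF _ \<sigma>(1)[of S3]]) (auto simp: \<sigma> \<sigma>y e3_S3)
    then have "y \<in> span_powers K1 x2 p" by (simp add: K2_def)
    then have "y \<in> K1"
      using k1[of S2] by (intro span_powers_fixed[of y K1 x2, OF _ \<sigma>(1)[of S2]]) (auto simp: \<sigma> \<sigma>y e2_def)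
    then have "y \<in> span_powers K0 x1 p" by (simp add: K1_def)
    then show "y \<in> K0"
      using k0[of S1] by (intro span_powers_fixed[of y K0 x1, OF _ \<sigma>(1)[of S1]]) (auto simp: \<sigma> \<sigma>y e1_def)
  qed
  then have "fixed_field (carrier (galois_group K0)) = K0"
    by (auto simp: fixed_field_def carrier_galois_group)
  with alg show ?thesis by (simp add: galois_ext_def)
qed

lemma galois_group_iso: "galois_group K0 \<cong> presented_group R"
proof -
  \<comment> \<open>The words acting as a given automorphism form exactly one class of the presented
    group, so no representative has to be chosen.\<close>
  define \<psi> where "\<psi> = (\<lambda>\<tau>. {w. act \<sigma> w = \<tau>})"
  have \<psi>: "\<psi> (act \<sigma> w) = word_class R w" for w
    by (auto simp: \<psi>_def word_class_def act_eq_iff_word_eq intro: word_eq.sym)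
  have "\<psi> \<in> iso (galois_group K0) (presented_group R)"
  proof (rule isoI)
    show "\<psi> \<in> hom (galois_group K0) (presented_group R)"
    proof (rule homI)
      fix \<tau> \<tau>' assume "\<tau> \<in> carrier (galois_group K0)" "\<tau>' \<in> carrier (galois_group K0)"
      then obtain u v where "\<tau> = act \<sigma> u" "\<tau>' = act \<sigma> v" unfolding galois_group_eq_range_act by blast
      then show "\<psi> (\<tau> \<otimes>\<^bsub>galois_group K0\<^esub> \<tau>') = \<psi> \<tau> \<otimes>\<^bsub>presented_group R\<^esub> \<psi> \<tau>'"
        by (simp add: \<psi> presented_group_mult galois_group_mult flip: act_append)
    qed (auto simp: galois_group_eq_range_act \<psi> presented_group_carrier)
    show "bij_betw \<psi> (carrier (galois_group K0)) (carrier (presented_group R))"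
      unfolding galois_group_eq_range_act presented_group_carrier bij_betw_def
      by (auto simp: inj_on_def \<psi> word_class_eq_iff act_eq_iff_word_eq image_image)
  qed
  then show ?thesis by (auto simp: is_iso_def)
qed

end

section \<open>The groups \<open>G\<close>\<close>

context prime_char
begin

lemma AS_closed: "subring_set S \<Longrightarrow> (x::'a) \<in> S \<Longrightarrow> AS p x \<in> S"
  by (simp add: AS_def subring_set.closed)

lemma hom_AS: "ring_hom_on S h \<Longrightarrow> (x::'a) \<in> S \<Longrightarrow> h (AS p x) = AS p (h x :: 'a)"
  by (simp add: AS_def ring_hom_on.hom subring_set.closed ring_hom_on.axioms)

lemma D1_closed: "subring_set S \<Longrightarrow> (x::'a) \<in> S \<Longrightarrow> D1 p x \<in> S"
  by (simp add: D1_eq_carry subring_set.carry_closed AS_closed)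

lemma hom_D1: "ring_hom_on S h \<Longrightarrow> (x::'a) \<in> S \<Longrightarrow> h (D1 p x) = D1 p (h x :: 'a)"
  by (simp add: D1_eq_carry ring_hom_on.hom_carry hom_AS AS_closed ring_hom_on.axioms)

lemma
  assumes h: "ring_hom_on S h" and x: "(x1::'a) \<in> S" "x3 \<in> S"
  shows D2_closed: "D2 p x1 x3 \<in> S" and hom_D2: "h (D2 p x1 x3) = D2 p (h x1) (h x3 :: 'a)"
proof -
  interpret ring_hom_on S h by fact
  have c: "AS p x1 \<in> S" "AS p x3 - D1 p x1 \<in> S"
    using x by (simp_all add: AS_closed D1_closed diff_closed subring_set_axioms)
  show "D2 p x1 x3 \<in> S" unfolding D2_eq_carry2 by (intro carry2_closed x c)
  show "h (D2 p x1 x3) = D2 p (h x1) (h x3)"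
    unfolding D2_eq_carry2 hom_carry2[OF x c]
    using x by (simp add: hom_AS[OF h] hom_D1[OF h] hom_diff AS_closed D1_closed subring_set_axioms)
qed

lemma half_closed:
  assumes "subfield S top_field" "(x::'a) \<in> S"
  shows "x / 2 \<in> S"
proof -
  interpret subring_set S by (rule subring_set_subfield[OF assms(1)])
  have "inverse (of_nat 2) \<in> S" using assms(1) of_nat_closed[of 2] unfolding subfield_top_field_iff by blast
  from mult_closed[OF assms(2) this] show ?thesis by (simp only: divide_inverse of_nat_numeral)
qed

lemma hom_half:
  assumes "ring_hom_on S h" "subfield S top_field" "(x::'a) \<in> S"
  shows "h (x / 2) = h x / (2 :: 'a)"
proof -
  interpret ring_hom_on S h by fact
  have "h (x / 2 + x / 2) = h (x / 2) + h (x / 2)" by (intro hom_add half_closed assms)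
  moreover have "x / 2 + x / 2 = x" using two_neq_0 by (simp add: field_simps)
  ultimately show ?thesis using two_neq_0 by (simp add: field_simps)
qed

lemma sum_of_nat_p: "(\<Sum>j<p. of_nat j) = (0::'a)"
proof -
  have "2 * (\<Sum>j<n. of_nat j) = (of_nat n * (of_nat n - 1) :: 'a)" for n
    by (induction n) (auto simp: algebra_simps)
  from this[of p] show ?thesis using two_neq_0 by (simp add: of_nat_p)
qed

end

context field_auts
begin

lemma funpow_gen_hom: "ring_hom_total (\<sigma> g ^^ n)"
  by (rule ring_hom_total_funpow[OF ring_hom])

lemma cocyc_letter_pow_fixed: "\<sigma> g (f g) = f g \<Longrightarrow> cocyc \<sigma> f (letter_pow g k) = of_int k * f g"
  using cocyc_word_pow_fixed[of "[(g, True)]" f k] by (simp add: gen_hom)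

end

text \<open>Under x1 -> x1 + 1 the equation of x3 gains a0 \<beta>2, which is \<open>AS\<close> of
  a0 x2, and a1 times the gain of D1, which is \<open>AS\<close> of the carry.\<close>

definition e3_G :: "nat \<Rightarrow> params \<Rightarrow> gen \<Rightarrow> 'a::field \<Rightarrow> 'a \<Rightarrow> 'a" where
  "e3_G p = (\<lambda>(a0, a1, b0, b1, b2, b3) g x1 x2.
    case g of S1 \<Rightarrow> of_int a0 * x2 + of_int a1 * carry p 1 x1 | S2 \<Rightarrow> 0 | S3 \<Rightarrow> 1 | S4 \<Rightarrow> 0)"

text \<open>The summand b3 x3 at S1 comes from the binomial term, which gains b3 (a0 \<beta>2 x1 +
  \<beta>3). At S2 the moving term is D1 of x2.\<close>

definition e4_G :: "nat \<Rightarrow> params \<Rightarrow> gen \<Rightarrow> 'a::field \<Rightarrow> 'a \<Rightarrow> 'a \<Rightarrow> 'a" where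
  "e4_G p = (\<lambda>(a0, a1, b0, b1, b2, b3) g x1 x2 x3.
    case g of S1 \<Rightarrow> of_int b0 * x2 + of_int b1 * carry p 1 x1 + of_int b3 * x3
      | S2 \<Rightarrow> of_int b2 * carry p 1 x2 | S3 \<Rightarrow> 0 | S4 \<Rightarrow> 1)"

definition rhs3_G :: "nat \<Rightarrow> params \<Rightarrow> 'a::field \<Rightarrow> 'a \<Rightarrow> 'a" where
  "rhs3_G p = (\<lambda>(a0, a1, b0, b1, b2, b3) \<beta>2 x1. of_int a0 * \<beta>2 * x1 + of_int a1 * D1 p x1)"

definition rhs4_G :: "nat \<Rightarrow> params \<Rightarrow> 'a::field \<Rightarrow> 'a \<Rightarrow> 'a \<Rightarrow> 'a \<Rightarrow> 'a \<Rightarrow> 'a" where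
  "rhs4_G p = (\<lambda>(a0, a1, b0, b1, b2, b3) \<beta>2 \<beta>3 x1 x2 x3.
    of_int b0 * \<beta>2 * x1 + of_int b1 * D1 p x1 + of_int b2 * D1 p x2
      + of_int b3 * (of_int a0 * \<beta>2 * (x1 * (x1 - 1) / 2) + \<beta>3 * x1))"

lemma system_G_iff:
  "system_G p ab \<beta>2 \<beta>3 \<beta>4 x1 x2 x3 x4 \<longleftrightarrow>
    AS p x3 = rhs3_G p ab \<beta>2 x1 + \<beta>3 \<and> AS p x4 = rhs4_G p ab \<beta>2 \<beta>3 x1 x2 x3 + \<beta>4"
  by (cases ab) (simp add: rhs3_G_def rhs4_G_def)

text \<open>The hypotheses are the defining relations read through the crossed homomorphism rule.
  For all four shift functions the values at S3 and S4 are 0 or 1, hence fixed by every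
  automorphism.\<close>

lemma cocyc_relations_G:
  fixes f :: "gen \<Rightarrow> 'a::field" and \<sigma> :: "gen \<Rightarrow> 'a \<Rightarrow> 'a"
  assumes "field_auts \<sigma>" and p0: "of_nat p = (0::'a)"
    and const: "f S3 \<in> {0, 1}" "f S4 \<in> {0, 1}"
    and pow1: "(\<Sum>j<p. (\<sigma> S1 ^^ j) (f S1)) = of_int a1 * f S3 + of_int b1 * f S4"
    and pow2: "(\<Sum>j<p. (\<sigma> S2 ^^ j) (f S2)) = of_int b2 * f S4"
    and c41: "\<sigma> S4 (f S1) = f S1" and c42: "\<sigma> S4 (f S2) = f S2" and c32: "\<sigma> S3 (f S2) = f S2"
    and c31: "\<sigma> S3 (f S1) = f S1 + of_int b3 * f S4"
    and c21: "f S2 + \<sigma> S2 (f S1) = f S1 + \<sigma> S1 (f S2) + of_int a0 * f S3 + of_int b0 * f S4"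
    and uv: "(u, v) \<in> relations_G p (a0, a1, b0, b1, b2, b3)"
  shows "cocyc \<sigma> f u = cocyc \<sigma> f v"
proof -
  interpret s: field_auts \<sigma> by fact
  have fx: "\<sigma> g (f S3) = f S3" "\<sigma> g (f S4) = f S4" "finv (\<sigma> g) (f S3) = f S3"
      "act \<sigma> w (f S3) = f S3" "act \<sigma> w (f S4) = f S4" for g w
    using const by (auto simp: s.gen_hom s.act_hom s.inv_hom)
  have pf: "of_nat p * z = (0::'a)" for z by (simp add: p0)
  have pow: "cocyc \<sigma> f (letter_pow S3 k) = of_int k * f S3"
      "cocyc \<sigma> f (letter_pow S4 k) = of_int k * f S4" for k
    by (simp_all add: s.cocyc_letter_pow_fixed fx)
  note simps = s.cocyc_append pow fx s.act_hom s.gen_hom s.cocyc_letter_pow_int letter_pow_1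
  consider "u = letter_pow S1 (int p)" "v = letter_pow S3 a1 @ letter_pow S4 b1"
    | "u = letter_pow S2 (int p)" "v = letter_pow S4 b2"
    | "u = letter_pow S3 (int p)" "v = []"
    | "u = letter_pow S4 (int p)" "v = []"
    | g where "u = letter_pow S4 1 @ letter_pow g 1" "v = letter_pow g 1 @ letter_pow S4 1"
    | "u = letter_pow S3 1 @ letter_pow S2 1" "v = letter_pow S2 1 @ letter_pow S3 1"
    | "u = letter_pow S3 1 @ letter_pow S1 1" "v = letter_pow S1 1 @ letter_pow S3 1 @ letter_pow S4 b3"
    | "u = letter_pow S2 1 @ letter_pow S1 1"
      "v = letter_pow S1 1 @ letter_pow S2 1 @ letter_pow S3 a0 @ letter_pow S4 b0"
    using uv by auto
  then show ?thesis
  proof cases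
    case 1
    then show ?thesis using pow1 by (simp add: simps)
  next
    case 2
    then show ?thesis using pow2 by (simp add: simps)
  next
    case 3
    then show ?thesis by (simp only: pow) (simp add: pf)
  next
    case 4
    then show ?thesis by (simp only: pow) (simp add: pf)
  next
    case 5
    then show ?thesis using c41 c42 by (cases g) (simp_all add: simps)
  next
    case 6
    then show ?thesis using c32 by (simp add: simps)
  next
    case 7
    then show ?thesis using c31 by (simp add: simps)
  next
    case 8
    then show ?thesis using c21 by (simp add: simps)
  qed
qed

lemma relations_G_mem:
  "(letter_pow S1 (int p), letter_pow S3 a1 @ letter_pow S4 b1) \<in> relations_G p (a0, a1, b0, b1, b2, b3)"
  "(letter_pow S2 (int p), letter_pow S4 b2) \<in> relations_G p (a0, a1, b0, b1, b2, b3)"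
  "(letter_pow S3 (int p), []) \<in> relations_G p (a0, a1, b0, b1, b2, b3)"
  "(letter_pow S4 (int p), []) \<in> relations_G p (a0, a1, b0, b1, b2, b3)"
  "(letter_pow S4 1 @ letter_pow g 1, letter_pow g 1 @ letter_pow S4 1) \<in> relations_G p (a0, a1, b0, b1, b2, b3)"
  "(letter_pow S3 1 @ letter_pow S2 1, letter_pow S2 1 @ letter_pow S3 1) \<in> relations_G p (a0, a1, b0, b1, b2, b3)"
  "(letter_pow S3 1 @ letter_pow S1 1, letter_pow S1 1 @ letter_pow S3 1 @ letter_pow S4 b3)
    \<in> relations_G p (a0, a1, b0, b1, b2, b3)"
  "(letter_pow S2 1 @ letter_pow S1 1, letter_pow S1 1 @ letter_pow S2 1 @ letter_pow S3 a0 @ letter_pow S4 b0)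
    \<in> relations_G p (a0, a1, b0, b1, b2, b3)"
  by auto

lemma letter_pow_words: "g \<in> B \<Longrightarrow> letter_pow g k \<in> words B"
  by (rule words_word_pow) (simp add: words_def)

lemma (in prime_char) tower_G:
  assumes ab: "ab = (a0, a1, b0, b1, b2, b3)" and ab0: "a1 = 0 \<or> b3 = 0"
  shows "tower p (relations_G p ab) (e3_G p ab :: gen \<Rightarrow> 'a \<Rightarrow> 'a \<Rightarrow> 'a) (e4_G p ab) (rhs3_G p ab) (rhs4_G p ab)"
proof -
  let ?R = "relations_G p ab"
  note defs = e3_G_def e4_G_def rhs3_G_def rhs4_G_def ab prod.case
  note rel = relations_G_mem[where p = p and ?a0.0 = a0 and ?a1.0 = a1 and ?b0.0 = b0
    and ?b1.0 = b1 and ?b2.0 = b2 and ?b3.0 = b3, folded ab, THEN word_eq.rel]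
  show ?thesis
  proof unfold_locales
    fix x1 x2 x3 :: 'a
    show "e3_G p ab S3 x1 x2 = 1" "e3_G p ab S4 x1 x2 = 0" "e4_G p ab S4 x1 x2 x3 = 1"
      by (simp_all add: defs)
  next
    fix S :: "'a set" and x1 x2 x3 :: 'a and g
    assume "subring_set S" "x1 \<in> S" "x2 \<in> S"
    then interpret subring_set S by simp
    show "e3_G p ab g x1 x2 \<in> S"
      using \<open>x1 \<in> S\<close> \<open>x2 \<in> S\<close> by (cases g) (auto simp: defs intro!: closed carry_closed)
    assume "x3 \<in> S"
    then show "e4_G p ab g x1 x2 x3 \<in> S"
      using \<open>x1 \<in> S\<close> \<open>x2 \<in> S\<close> by (cases g) (auto simp: defs intro!: closed carry_closed)
  next
    fix S :: "'a set" and \<beta>2 x1 :: 'a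
    assume *: "subring_set S" "\<beta>2 \<in> S" "x1 \<in> S"
    then interpret subring_set S by simp
    show "rhs3_G p ab \<beta>2 x1 \<in> S"
      using * by (auto simp: defs intro!: closed D1_closed)
  next
    fix S :: "'a set" and \<beta>2 \<beta>3 x1 x2 x3 :: 'a
    assume *: "subfield S top_field" "\<beta>2 \<in> S" "\<beta>3 \<in> S" "x1 \<in> S" "x2 \<in> S" "x3 \<in> S"
    then interpret subring_set S by (simp add: subring_set_subfield)
    show "rhs4_G p ab \<beta>2 \<beta>3 x1 x2 x3 \<in> S"
      unfolding defs by (intro closed D1_closed half_closed subring_set_axioms *)
  next
    fix S :: "'a set" and h :: "'a \<Rightarrow> 'a" and \<beta>2 x1 x2 :: 'a and g
    assume hh: "ring_hom_on S h" and m: "\<beta>2 \<in> S" "x1 \<in> S" "x2 \<in> S"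
      and e: "h \<beta>2 = \<beta>2" "h x1 = x1 + e1 g" "h x2 = x2 + e2 g" "AS p x2 = \<beta>2"
    interpret ring_hom_on S h by (fact hh)
    have "h (rhs3_G p ab \<beta>2 x1) = of_int a0 * \<beta>2 * (x1 + e1 g) + of_int a1 * D1 p (x1 + e1 g)"
      unfolding defs using m
      by (simp add: hom closed D1_closed subring_set_axioms hom_D1[OF hh] e)
    then show "h (rhs3_G p ab \<beta>2 x1) = rhs3_G p ab \<beta>2 x1 + AS p (e3_G p ab g x1 x2)"
      by (cases g; simp add: defs e1_def AS_add AS_mult_of_int AS_0 AS_1 D1_shift e(4); simp add: ring_distribs)
  next
    fix S :: "'a set" and h :: "'a \<Rightarrow> 'a" and \<beta>2 \<beta>3 x1 x2 x3 :: 'a and g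
    assume sub: "subfield S top_field" and hh: "ring_hom_on S h"
      and m: "\<beta>2 \<in> S" "\<beta>3 \<in> S" "x1 \<in> S" "x2 \<in> S" "x3 \<in> S"
      and e: "h \<beta>2 = \<beta>2" "h \<beta>3 = \<beta>3" "h x1 = x1 + e1 g" "h x2 = x2 + e2 g"
        "h x3 = x3 + e3_G p ab g x1 x2"
      and AS2: "AS p x2 = \<beta>2" and AS3: "AS p x3 = rhs3_G p ab \<beta>2 x1 + \<beta>3"
    interpret ring_hom_on S h by (fact hh)
    have half: "x1 * (x1 - 1) / 2 \<in> S"
      "h (x1 * (x1 - 1) / 2) = (x1 + e1 g) * (x1 + e1 g - 1) / 2"
      using m half_closed[OF sub, of "x1 * (x1 - 1)"] hom_half[OF hh sub, of "x1 * (x1 - 1)"]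
      by (simp_all add: hom closed e)
    have hr: "h (rhs4_G p ab \<beta>2 \<beta>3 x1 x2 x3) = of_int b0 * \<beta>2 * (x1 + e1 g) + of_int b1 * D1 p (x1 + e1 g)
        + of_int b2 * D1 p (x2 + e2 g)
        + of_int b3 * (of_int a0 * \<beta>2 * ((x1 + e1 g) * (x1 + e1 g - 1) / 2) + \<beta>3 * (x1 + e1 g))"
      unfolding defs using m half
      by (simp add: hom closed D1_closed subring_set_axioms hom_D1[OF hh] e del: times_divide_eq_right)
    have bin: "(x1 + 1) * (x1 + 1 - 1) / 2 = x1 * (x1 - 1) / 2 + x1"
      using two_neq_0 by (simp add: field_simps)
    \<comment> \<open>Either b3 = 0, or a1 = 0 and the equation of x3 has no D1 term.\<close>
    have AS3': "of_int b3 * AS p x3 = of_int b3 * (of_int a0 * \<beta>2 * x1 + \<beta>3)"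
      using ab0 unfolding AS3 by (auto simp: defs)
    show "h (rhs4_G p ab \<beta>2 \<beta>3 x1 x2 x3) = rhs4_G p ab \<beta>2 \<beta>3 x1 x2 x3 + AS p (e4_G p ab g x1 x2 x3)"
    proof (cases g)
      case S1
      show ?thesis
        unfolding hr S1
        by (simp only: defs e1_def e2_def gen.case simp_thms if_True if_False bin AS_add AS_mult_of_int
            AS3' AS2 D1_shift gen.distinct add_0_right) (simp add: ring_distribs mult.assoc)
    next
      case S2
      show ?thesis
        unfolding hr S2
        by (simp only: defs e1_def e2_def gen.case simp_thms if_True if_False AS_mult_of_int
            D1_shift gen.distinct add_0_right) (simp add: ring_distribs)
    qed (simp_all only: hr, simp_all add: defs e1_def e2_def AS_0 AS_1)
  next
    fix \<sigma> :: "gen \<Rightarrow> 'a \<Rightarrow> 'a" and u v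
    assume \<sigma>: "field_auts \<sigma>" and uv: "(u, v) \<in> ?R"
    interpret field_auts \<sigma> by fact
    note hom = gen_hom ring_hom_on.hom[OF funpow_gen_hom]
    note cr = cocyc_relations_G[OF \<sigma> of_nat_p _ _ _ _ _ _ _ _ _ uv[unfolded ab]]
    show "cocyc \<sigma> e1 u = (cocyc \<sigma> e1 v :: 'a)"
      by (rule cr) (simp_all add: e1_def hom of_nat_p)
    show "cocyc \<sigma> e2 u = (cocyc \<sigma> e2 v :: 'a)"
      by (rule cr) (simp_all add: e2_def hom of_nat_p)
    fix x1 x2 :: 'a
    assume x1: "\<And>g. \<sigma> g x1 = x1 + e1 g" and x2: "\<And>g. \<sigma> g x2 = x2 + e2 g"
    have x1j: "(\<sigma> S1 ^^ j) x1 = x1 + of_nat j" for j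
      by (induction j) (auto simp: gen_hom x1 e1_def)
    have x1j2: "(\<sigma> S1 ^^ j) x2 = x2" for j
      by (induction j) (auto simp: gen_hom x2 e2_def)
    have x2j: "(\<sigma> S2 ^^ j) x2 = x2 + of_nat j" for j
      by (induction j) (auto simp: gen_hom x2 e2_def)
    note hc = ring_hom_on.hom_carry[OF ring_hom] ring_hom_on.hom_carry[OF funpow_gen_hom]
    note ss = sum.distrib sum_distrib_left[symmetric] sum_carry_1_eq_1 of_nat_p
    show "cocyc \<sigma> (\<lambda>g. e3_G p ab g x1 x2) u = cocyc \<sigma> (\<lambda>g. e3_G p ab g x1 x2) v"
      by (rule cr) (simp_all add: defs hom hc x1 x2 e1_def e2_def x1j x1j2 ss ring_distribs)
    fix x3 :: 'a
    assume x3: "\<And>g. \<sigma> g x3 = x3 + e3_G p ab g x1 x2"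
    \<comment> \<open>For a1 = 0 the shift a0 x2 of x3 is fixed by \<open>\<sigma> S1\<close>, so
      iteration is linear in j; the factor b3 makes the case a1 \<noteq> 0 trivial.\<close>
    have x3j: "of_int b3 * (\<sigma> S1 ^^ j) x3 = of_int b3 * (x3 + of_nat j * (of_int a0 * x2))" for j
    proof (cases "b3 = 0")
      case False
      then have "a1 = 0" using ab0 by simp
      then have "(\<sigma> S1 ^^ j) x3 = x3 + of_nat j * (of_int a0 * x2)"
        by (induction j) (auto simp: hom x3 x2 e2_def defs ring_distribs)
      then show ?thesis by simp
    qed simp
    have pow1: "(\<Sum>j<p. (\<sigma> S1 ^^ j) (e4_G p ab S1 x1 x2 x3)) = of_int b1"
    proof -
      have "(\<Sum>j<p. (\<sigma> S1 ^^ j) (e4_G p ab S1 x1 x2 x3))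
        = (\<Sum>j<p. of_int b0 * x2 + of_int b1 * carry p 1 (x1 + of_nat j) + of_int b3 * (x3 + of_nat j * (of_int a0 * x2)))"
        by (intro sum.cong HOL.refl) (simp add: defs hom hc x1j x1j2 x3j)
      \<comment> \<open>The carries add up to 1. The constant terms occur p times, and 0 + 1 + ... +
        (p - 1) is zero in the field because p is odd.\<close>
      also have "\<dots> = of_int b1"
        by (simp add: ss ring_distribs mult.assoc[symmetric] sum_distrib_right[symmetric])
          (simp add: sum_distrib_left[symmetric] sum_of_nat_p)
      finally show ?thesis .
    qed
    show "cocyc \<sigma> (\<lambda>g. e4_G p ab g x1 x2 x3) u = cocyc \<sigma> (\<lambda>g. e4_G p ab g x1 x2 x3) v"
    proof (rule cr)
      show "(\<Sum>j<p. (\<sigma> S1 ^^ j) (e4_G p ab S1 x1 x2 x3))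
          = of_int a1 * e4_G p ab S3 x1 x2 x3 + of_int b1 * e4_G p ab S4 x1 x2 x3"
        unfolding pow1 by (simp add: defs)
    qed (simp_all add: defs hom hc x1 x2 x3 e1_def e2_def x2j ss ring_distribs)
  next
    fix g B b
    assume "(g, B) \<in> {(S1, {S2, S3, S4}), (S2, {S3, S4}), (S3, {S4})}" "b \<in> B"
    then consider "g = S1" "B = {S2, S3, S4}" "b = S2" | "g = S1" "B = {S2, S3, S4}" "b = S3"
      | "b = S4" "S4 \<in> B" | "g = S2" "B = {S3, S4}" "b = S3" by auto
    then show "\<exists>w\<in>words B. word_eq ?R [(b, True), (g, True)] ((g, True) # w)"
    proof cases
      case 1
      have "letter_pow S2 1 @ letter_pow S3 a0 @ letter_pow S4 b0 \<in> words B"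
        using 1 by (intro words_append letter_pow_words) auto
      then show ?thesis using rel(8) 1 by (intro bexI) (auto simp: letter_pow_1)
    next
      case 2
      have "letter_pow S3 1 @ letter_pow S4 b3 \<in> words B"
        using 2 by (intro words_append letter_pow_words) auto
      then show ?thesis using rel(7) 2 by (intro bexI) (auto simp: letter_pow_1)
    next
      case 3
      have "letter_pow S4 1 \<in> words B" using 3 by (intro letter_pow_words) auto
      moreover have "word_eq ?R (letter_pow S4 1 @ letter_pow g 1) (letter_pow g 1 @ letter_pow S4 1)"
        unfolding ab by (intro word_eq.rel relations_G_mem)
      ultimately show ?thesis using 3 by (intro bexI) (auto simp: letter_pow_1)
    next
      case 4
      have "letter_pow S3 1 \<in> words B" using 4 by (intro letter_pow_words) auto
      then show ?thesis using rel(6) 4 by (intro bexI) (auto simp: letter_pow_1)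
    qed
  next
    fix g B
    assume "(g, B) \<in> {(S1, {S2, S3, S4}), (S2, {S3, S4}), (S3, {S4}), (S4, {})}"
    then consider "g = S1" "B = {S2, S3, S4}" | "g = S2" "B = {S3, S4}" | "g = S3" | "g = S4" by auto
    then show "\<exists>v\<in>words B. word_eq ?R (replicate p (g, True)) v"
    proof cases
      case 1
      have "letter_pow S3 a1 @ letter_pow S4 b1 \<in> words B"
        using 1 by (intro words_append letter_pow_words) auto
      then show ?thesis using rel(1) 1 by (intro bexI) (auto simp: letter_pow_int)
    next
      case 2
      have "letter_pow S4 b2 \<in> words B" using 2 by (intro letter_pow_words) auto
      then show ?thesis using rel(2) 2 by (intro bexI) (auto simp: letter_pow_int)
    next
      case 3
      then show ?thesis using rel(3) words_Nil by (intro bexI) (auto simp: letter_pow_int)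
    next
      case 4
      then show ?thesis using rel(4) words_Nil by (intro bexI) (auto simp: letter_pow_int)
    qed
  qed
qed

section \<open>The group \<open>H\<close>\<close>

definition e3_H :: "nat \<Rightarrow> gen \<Rightarrow> 'a::field \<Rightarrow> 'a \<Rightarrow> 'a" where
  "e3_H p g x1 x2 = (case g of S1 \<Rightarrow> carry p 1 x1 | S2 \<Rightarrow> 0 | S3 \<Rightarrow> 1 | S4 \<Rightarrow> 0)"

text \<open>Read (x1, x3, x4) as a Witt vector: S1, S3 and S4 add (1, 0, 0), (0, 1, 0) and (0, 0,
  1). The extra x2 at S1 accounts for \<beta>2 x1 and is what S2 moves, so that S1 and S2 do not
  commute.\<close>

definition e4_H :: "nat \<Rightarrow> gen \<Rightarrow> 'a::field \<Rightarrow> 'a \<Rightarrow> 'a \<Rightarrow> 'a" where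
  "e4_H p g x1 x2 x3
    = (case g of S1 \<Rightarrow> x2 + carry2 p x1 x3 1 0 | S2 \<Rightarrow> 0 | S3 \<Rightarrow> carry p 1 x3 | S4 \<Rightarrow> 1)"

definition rhs3_H :: "nat \<Rightarrow> 'a::field \<Rightarrow> 'a \<Rightarrow> 'a" where
  "rhs3_H p \<beta>2 x1 = D1 p x1"

definition rhs4_H :: "nat \<Rightarrow> 'a::field \<Rightarrow> 'a \<Rightarrow> 'a \<Rightarrow> 'a \<Rightarrow> 'a \<Rightarrow> 'a" where
  "rhs4_H p \<beta>2 \<beta>3 x1 x2 x3 = \<beta>2 * x1 + D2 p x1 x3"

abbreviation s1_pow :: "nat \<Rightarrow> gen word" where
  "s1_pow n \<equiv> replicate n (S1, True)"

lemma concat_replicate_replicate: "concat (replicate n (replicate m x)) = replicate (n * m) x"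
  by (induction n) (auto simp: replicate_add)

lemma word_eq_concat_replicate:
  "word_eq R u v \<Longrightarrow> word_eq R (concat (replicate n u)) (concat (replicate n v))"
  by (induction n) (auto intro: word_eq.refl word_eq.append)

lemma relations_H_eq:
  "relations_H p = {([(S3, True)], s1_pow p), ([(S4, True)], s1_pow (p\<^sup>2)), (s1_pow (p ^ 3), []),
    (replicate p (S2, True), []), ([(S2, True), (S1, True)], s1_pow (1 + p\<^sup>2) @ [(S2, True)])}"
proof -
  have "1 + int (p\<^sup>2) = int (1 + p\<^sup>2)" by simp
  then show ?thesis unfolding relations_H_def letter_pow_int letter_pow_1 by (simp only: letter_pow_int) simp
qed

text \<open>S3 and S4 stand for powers of S1, so the cocycle is computed along the powers of S1 with
  exponents p, p^2 and p^3, each the p-th power of the one before.\<close>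

lemma cocyc_relations_H:
  fixes f :: "gen \<Rightarrow> 'a::field" and \<sigma> :: "gen \<Rightarrow> 'a \<Rightarrow> 'a"
  assumes "field_auts \<sigma>" and p0: "of_nat p = (0::'a)"
    and const: "f S2 \<in> {0, 1}" "f S4 \<in> {0, 1}"
    and pow1: "(\<Sum>j<p. (\<sigma> S1 ^^ j) (f S1)) = f S3"
    and pow3: "(\<Sum>j<p. ((\<sigma> S1 ^^ p) ^^ j) (f S3)) = f S4"
    and c21: "\<sigma> S2 (f S1) = f S1 + f S4"
    and uv: "(u, v) \<in> relations_H p"
  shows "cocyc \<sigma> f u = cocyc \<sigma> f v"
proof -
  interpret s: field_auts \<sigma> by fact
  have hp: "ring_hom_total (\<sigma> g ^^ n)" "ring_hom_total ((\<sigma> g ^^ m) ^^ n)" for g m n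
    by (intro ring_hom_total_funpow s.ring_hom)+
  have fx: "\<sigma> g (f S2) = f S2" "\<sigma> g (f S4) = f S4" "(\<sigma> g ^^ n) (f S2) = f S2"
    "((\<sigma> g ^^ m) ^^ n) (f S4) = f S4" "act \<sigma> w (f S2) = f S2" for g m n w
    using const by (auto simp: s.gen_hom s.act_hom ring_hom_on.hom[OF hp(1)] ring_hom_on.hom[OF hp(2)])
  have act: "act \<sigma> (s1_pow n) = \<sigma> S1 ^^ n" for n
    using s.act_letter_pow_int[of S1 n] by (simp only: letter_pow_int)
  have c1: "cocyc \<sigma> f (s1_pow p) = f S3"
    using s.cocyc_letter_pow_int[of f S1 p] pow1 by (simp only: letter_pow_int)
  have c2: "cocyc \<sigma> f (s1_pow (p\<^sup>2)) = f S4"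
    using s.cocyc_concat_replicate[of f p "s1_pow p"] pow3
    by (simp only: concat_replicate_replicate power2_eq_square act c1)
  have "p ^ 3 = p * p\<^sup>2" by (simp add: power3_eq_cube power2_eq_square)
  then have c3: "cocyc \<sigma> f (s1_pow (p ^ 3)) = 0"
    using s.cocyc_concat_replicate[of f p "s1_pow (p\<^sup>2)"]
    by (simp add: concat_replicate_replicate act c2 fx p0)
  have c4: "cocyc \<sigma> f (replicate p (S2, True)) = 0"
    using s.cocyc_letter_pow_int[of f S2 p] by (simp add: letter_pow_int fx p0)
  have c5: "cocyc \<sigma> f (s1_pow (Suc (p\<^sup>2)) @ [(S2, True)]) = f S1 + f S4 + f S2"
    by (simp add: s.cocyc_append c2 fx act s.gen_hom)
  show ?thesis
    using uv c21 unfolding relations_H_eq by (auto simp: s.gen_hom c1 c2 c3 c4 c5 fx simp del: replicate_Suc)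
qed

lemma relations_H_words:
  fixes p :: nat
  defines "R \<equiv> relations_H p"
  shows "word_eq R [(S3, True)] (s1_pow p)" "word_eq R [(S4, True)] (s1_pow (p\<^sup>2))"
    "word_eq R (s1_pow (p ^ 3)) []" "word_eq R (replicate p (S2, True)) []"
    "word_eq R [(S2, True), (S1, True)] (s1_pow (1 + p\<^sup>2) @ [(S2, True)])"
  unfolding R_def relations_H_eq by (auto intro: word_eq.rel)

lemma relations_H_s1_pow_mult:
  "word_eq (relations_H p) (s1_pow (n * p ^ 3)) []"
  using word_eq_concat_replicate[OF relations_H_words(3)[of p], of n]
  by (simp add: concat_replicate_replicate)

text \<open>Conjugation by S2 raises powers of S1 to the exponent 1 + p^2.\<close>

lemma relations_H_S2_s1_pow:
  "word_eq (relations_H p) ([(S2, True)] @ s1_pow n) (s1_pow (n + n * p\<^sup>2) @ [(S2, True)])"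
proof (induction n)
  case (Suc n)
  let ?R = "relations_H p"
  have "[(S2, True)] @ s1_pow (Suc n) = ([(S2, True)] @ s1_pow n) @ [(S1, True)]"
    by (simp add: replicate_append_same)
  also have "word_eq ?R \<dots> ((s1_pow (n + n * p\<^sup>2) @ [(S2, True)]) @ [(S1, True)])"
    by (rule word_eq_append_right[OF Suc])
  also have "\<dots> = s1_pow (n + n * p\<^sup>2) @ [(S2, True), (S1, True)]" by simp
  also have "word_eq ?R \<dots> (s1_pow (n + n * p\<^sup>2) @ (s1_pow (1 + p\<^sup>2) @ [(S2, True)]))"
    by (rule word_eq_append_left[OF relations_H_words(5)])
  also have "\<dots> = s1_pow (Suc n + Suc n * p\<^sup>2) @ [(S2, True)]"
    unfolding append_assoc[symmetric] replicate_add[symmetric] by (simp add: algebra_simps)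
  finally show ?case .
qed (simp add: word_eq.refl)

text \<open>If p divides n, then n p^2 is a multiple of p^3 and the extra power of S1 is trivial.
  This covers S3 and S4.\<close>

lemma relations_H_commute_S2:
  assumes "p dvd n" and g: "word_eq (relations_H p) [(g, True)] (s1_pow n)"
  shows "word_eq (relations_H p) [(g, True), (S2, True)] [(S2, True), (g, True)]"
proof -
  let ?R = "relations_H p"
  obtain m where m: "n = m * p" using assms(1) by (metis dvdE mult.commute)
  have n: "n + n * p\<^sup>2 = n + m * p ^ 3" by (simp add: m power2_eq_square power3_eq_cube)
  have "word_eq ?R ([(g, True)] @ [(S2, True)]) (s1_pow n @ [(S2, True)])"
    by (rule word_eq_append_right[OF g])
  also have "word_eq ?R (s1_pow n @ [(S2, True)]) (s1_pow n @ (s1_pow (m * p ^ 3) @ [(S2, True)]))"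
    using word_eq_append_right[OF word_eq.sym[OF relations_H_s1_pow_mult[of p m]], of "[(S2, True)]"]
    by (intro word_eq_append_left) simp
  also have "s1_pow n @ (s1_pow (m * p ^ 3) @ [(S2, True)]) = s1_pow (n + n * p\<^sup>2) @ [(S2, True)]"
    unfolding n by (simp add: replicate_add)
  also have "word_eq ?R \<dots> ([(S2, True)] @ s1_pow n)"
    by (rule word_eq.sym[OF relations_H_S2_s1_pow])
  also have "word_eq ?R ([(S2, True)] @ s1_pow n) ([(S2, True)] @ [(g, True)])"
    by (rule word_eq_append_left[OF word_eq.sym[OF g]])
  finally show ?thesis by simp
qed

lemma relations_H_commute_s1_pow:
  assumes "word_eq (relations_H p) [(g, True)] (s1_pow m)" "word_eq (relations_H p) [(h, True)] (s1_pow n)"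
  shows "word_eq (relations_H p) [(g, True), (h, True)] [(h, True), (g, True)]"
proof -
  have "word_eq (relations_H p) ([(g, True)] @ [(h, True)]) (s1_pow m @ s1_pow n)"
    by (intro word_eq.append assms)
  also have "s1_pow m @ s1_pow n = s1_pow n @ s1_pow m"
    unfolding replicate_add[symmetric] by (simp add: add.commute)
  also have "word_eq (relations_H p) (s1_pow n @ s1_pow m) ([(h, True)] @ [(g, True)])"
    by (intro word_eq.append word_eq.sym[OF assms(1)] word_eq.sym[OF assms(2)])
  finally show ?thesis by simp
qed

lemma (in prime_char) tower_H:
  "tower p (relations_H p) (e3_H p :: gen \<Rightarrow> 'a \<Rightarrow> 'a \<Rightarrow> 'a) (e4_H p) (rhs3_H p) (rhs4_H p)"
proof -
  let ?R = "relations_H p"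
  note defs = e3_H_def e4_H_def rhs3_H_def rhs4_H_def
  note rel = relations_H_words[of p]
  have s1: "word_eq ?R [(S1, True)] (s1_pow 1)" by (simp add: word_eq.refl)
  show ?thesis
  proof unfold_locales
    fix x1 x2 x3 :: 'a
    show "e3_H p S3 x1 x2 = 1" "e3_H p S4 x1 x2 = 0" "e4_H p S4 x1 x2 x3 = 1"
      by (simp_all add: defs)
  next
    fix S :: "'a set" and x1 x2 x3 :: 'a and g
    assume S: "subring_set S" and x: "x1 \<in> S" "x2 \<in> S"
    interpret subring_set S by (fact S)
    interpret h: ring_hom_on S id by unfold_locales auto
    show "e3_H p g x1 x2 \<in> S"
      using x by (cases g) (auto simp: defs intro!: closed carry_closed)
    assume "x3 \<in> S"
    then show "e4_H p g x1 x2 x3 \<in> S"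
      using x by (cases g) (auto simp: defs intro!: closed carry_closed h.carry2_closed)
  next
    fix S :: "'a set" and \<beta>2 x1 :: 'a
    assume "subring_set S" "\<beta>2 \<in> S" "x1 \<in> S"
    then show "rhs3_H p \<beta>2 x1 \<in> S" by (simp add: defs D1_closed)
  next
    fix S :: "'a set" and \<beta>2 \<beta>3 x1 x2 x3 :: 'a
    assume *: "subfield S top_field" "\<beta>2 \<in> S" "\<beta>3 \<in> S" "x1 \<in> S" "x2 \<in> S" "x3 \<in> S"
    then interpret subring_set S by (simp add: subring_set_subfield)
    interpret h: ring_hom_on S id by unfold_locales auto
    show "rhs4_H p \<beta>2 \<beta>3 x1 x2 x3 \<in> S"
      unfolding defs by (intro closed D2_closed[OF h.ring_hom_on_axioms] *)
  next
    fix S :: "'a set" and h :: "'a \<Rightarrow> 'a" and \<beta>2 x1 x2 :: 'a and g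
    assume "ring_hom_on S h" "x1 \<in> S" "h x1 = x1 + e1 g"
    then show "h (rhs3_H p \<beta>2 x1) = rhs3_H p \<beta>2 x1 + AS p (e3_H p g x1 x2)"
      by (cases g) (simp_all add: defs hom_D1 e1_def D1_shift AS_0 AS_1)
  next
    fix S :: "'a set" and h :: "'a \<Rightarrow> 'a" and \<beta>2 \<beta>3 x1 x2 x3 :: 'a and g
    assume hh: "ring_hom_on S h" and m: "\<beta>2 \<in> S" "x1 \<in> S" "x3 \<in> S"
      and e: "h \<beta>2 = \<beta>2" "h x1 = x1 + e1 g" "h x3 = x3 + e3_H p g x1 x2" and AS2: "AS p x2 = \<beta>2"
    interpret ring_hom_on S h by (fact hh)
    have "h (rhs4_H p \<beta>2 \<beta>3 x1 x2 x3) = \<beta>2 * (x1 + e1 g) + D2 p (x1 + e1 g) (x3 + e3_H p g x1 x2)"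
      using m by (simp add: defs hom closed D2_closed[OF hh] hom_D2[OF hh] e[unfolded defs])
    then show "h (rhs4_H p \<beta>2 \<beta>3 x1 x2 x3) = rhs4_H p \<beta>2 \<beta>3 x1 x2 x3 + AS p (e4_H p g x1 x2 x3)"
      by (cases g; simp add: defs e1_def D2_shift_1 D2_shift_3 AS_0 AS_1 AS_add AS2; simp add: ring_distribs)
  next
    fix \<sigma> :: "gen \<Rightarrow> 'a \<Rightarrow> 'a" and u v
    assume \<sigma>: "field_auts \<sigma>" and uv: "(u, v) \<in> ?R"
    interpret field_auts \<sigma> by fact
    note homp = ring_hom_on.hom[OF funpow_gen_hom]
    have hpp: "ring_hom_total ((\<sigma> g ^^ m) ^^ n)" for g m n
      by (intro ring_hom_total_funpow ring_hom)
    note homs = gen_hom homp ring_hom_on.hom[OF hpp]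
    note cr = cocyc_relations_H[OF \<sigma> of_nat_p _ _ _ _ _ uv]
    show "cocyc \<sigma> e1 u = (cocyc \<sigma> e1 v :: 'a)"
      by (rule cr) (simp_all add: e1_def homs of_nat_p)
    show "cocyc \<sigma> e2 u = (cocyc \<sigma> e2 v :: 'a)"
      by (rule cr) (simp_all add: e2_def homs of_nat_p)
    fix x1 x2 :: 'a
    assume x1: "\<And>g. \<sigma> g x1 = x1 + e1 g" and x2: "\<And>g. \<sigma> g x2 = x2 + e2 g"
    have x1j: "(\<sigma> S1 ^^ j) x1 = x1 + of_nat j" for j
      by (induction j) (auto simp: gen_hom x1 e1_def)
    have x2j: "(\<sigma> S1 ^^ j) x2 = x2" for j
      by (induction j) (auto simp: gen_hom x2 e2_def)
    note hc = ring_hom_on.hom_carry[OF ring_hom] ring_hom_on.hom_carry[OF funpow_gen_hom]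
      ring_hom_on.hom_carry[OF hpp]
    note hc2 = ring_hom_on.hom_carry2[OF ring_hom] ring_hom_on.hom_carry2[OF funpow_gen_hom]
    show "cocyc \<sigma> (\<lambda>g. e3_H p g x1 x2) u = cocyc \<sigma> (\<lambda>g. e3_H p g x1 x2) v"
      by (rule cr) (simp_all add: defs homs hc x1 e1_def x1j sum_carry_1_eq_1 of_nat_p)
    fix x3 :: 'a
    assume x3: "\<And>g. \<sigma> g x3 = x3 + e3_H p g x1 x2"
    have x3j: "(\<sigma> S1 ^^ j) x3 = x3 + (\<Sum>i<j. carry p 1 (x1 + of_nat i))" for j
    proof (induction j)
      case (Suc j)
      have "(\<sigma> S1 ^^ Suc j) x3 = (\<sigma> S1 ^^ j) (\<sigma> S1 x3)" by (simp only: funpow_Suc_right o_apply)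
      then show ?case using Suc by (simp add: x3 defs homp hc x1j add_ac)
    qed simp
    have x3p: "((\<sigma> S1 ^^ p) ^^ j) x3 = x3 + of_nat j" for j
      by (induction j) (auto simp: x3j homp sum_carry_1_eq_1)
    \<comment> \<open>The fixed summand x2 occurs p times and vanishes; the rest is the p-fold
      addition of (1, 0, 0).\<close>
    have pow1: "(\<Sum>j<p. (\<sigma> S1 ^^ j) (x2 + carry2 p x1 x3 1 0)) = carry p 1 x3"
      using sum_carry2[OF prime_p odd_p of_nat_p, of x1 x3]
      by (simp add: homp hc2 x1j x2j x3j sum.distrib of_nat_p)
    show "cocyc \<sigma> (\<lambda>g. e4_H p g x1 x2 x3) u = cocyc \<sigma> (\<lambda>g. e4_H p g x1 x2 x3) v"
    proof (rule cr)
      show "(\<Sum>j<p. (\<sigma> S1 ^^ j) (e4_H p S1 x1 x2 x3)) = e4_H p S3 x1 x2 x3"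
        using pow1 by (simp only: e4_H_def gen.case)
    qed (simp_all add: e4_H_def homs hc x3p sum_carry_1_eq_1 hc2 x1 x2 x3 e1_def e2_def e3_H_def)
  next
    fix g B b
    assume gB: "(g, B) \<in> {(S1, {S2, S3, S4}), (S2, {S3, S4}), (S3, {S4})}" "b \<in> B"
    then consider "g = S1" "B = {S2, S3, S4}" "b = S2"
      | "word_eq ?R [(b, True), (g, True)] [(g, True), (b, True)]"
      using relations_H_commute_s1_pow[OF rel(1) s1] relations_H_commute_s1_pow[OF rel(2) s1]
        relations_H_commute_s1_pow[OF rel(2,1)]
        relations_H_commute_S2[OF _ rel(1)] relations_H_commute_S2[OF _ rel(2)]
      by (auto simp: power2_eq_square)
    then show "\<exists>w\<in>words B. word_eq ?R [(b, True), (g, True)] ((g, True) # w)"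
    proof cases
      case 1
      \<comment> \<open>Of the \<open>1 + p\<^sup>2\<close> letters S1 the last
        \<open>p\<^sup>2\<close> make up S4, so S2 S1 = S1 S4 S2, with both letters after S1 in
        \<open>B\<close>.\<close>
      have "word_eq ?R (s1_pow (1 + p\<^sup>2) @ [(S2, True)]) ([(S1, True)] @ [(S4, True)] @ [(S2, True)])"
        using word_eq_append_left[OF word_eq_append_right[OF word_eq.sym[OF rel(2)], of "[(S2, True)]"], of "[(S1, True)]"]
        by simp
      then have "word_eq ?R [(S2, True), (S1, True)] ([(S1, True)] @ [(S4, True)] @ [(S2, True)])"
        by (rule word_eq.trans[OF rel(5)])
      then show ?thesis
        using 1 by (intro bexI[of _ "[(S4, True), (S2, True)]"]) (auto simp: words_def)
    next
      case 2
      then show ?thesis using gB(2) by (intro bexI[of _ "[(b, True)]"]) (auto simp: words_def)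
    qed
  next
    have 3: "word_eq ?R (replicate p (S3, True)) [(S4, True)]"
      using word_eq_concat_replicate[OF rel(1), of p] word_eq.sym[OF rel(2)]
      by (simp add: concat_replicate_singleton concat_replicate_replicate power2_eq_square word_eq.trans)
    have 4: "word_eq ?R (replicate p (S4, True)) []"
    proof -
      have "p * p\<^sup>2 = p ^ 3" by (simp add: power2_eq_square power3_eq_cube)
      then show ?thesis
        using word_eq_concat_replicate[OF rel(2), of p] rel(3)
        by (simp add: concat_replicate_singleton concat_replicate_replicate word_eq.trans)
    qed
    fix g B
    assume "(g, B) \<in> {(S1, {S2, S3, S4}), (S2, {S3, S4}), (S3, {S4}), (S4, {})}"
    then consider "g = S1" "S3 \<in> B" | "g = S2" | "g = S3" "S4 \<in> B" | "g = S4" by auto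
    then show "\<exists>v\<in>words B. word_eq ?R (replicate p (g, True)) v"
    proof cases
      case 1
      then show ?thesis
        using word_eq.sym[OF rel(1)] by (intro bexI[of _ "[(S3, True)]"]) (auto simp: words_def)
    next
      case 2
      then show ?thesis using rel(4) words_Nil by blast
    next
      case 3
      then show ?thesis
        using \<open>word_eq ?R (replicate p (S3, True)) _\<close>
        by (intro bexI[of _ "[(S4, True)]"]) (auto simp: words_def)
    next
      case 4
      then show ?thesis
        using \<open>word_eq ?R (replicate p (S4, True)) _\<close> words_Nil by blast
    qed
  qed
qed

section \<open>Both directions for an arbitrary tower, and the theorem\<close>

lemma (in tower) lower_upper_gens_of_iso:
  assumes "galois_ext K" "\<phi> \<in> iso (presented_group R) (galois_group K)"
  defines "\<sigma> \<equiv> \<lambda>g. \<phi> (presented_gen R g)"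
  shows "\<exists>x1 x2. lower_gens p K \<sigma> x1 x2 \<and> AS p x1 \<in> K \<and> AS p x2 \<in> K"
    and "lower_gens p K \<sigma> x1 x2 \<and> AS p x1 \<in> K \<and> AS p x2 \<in> K \<Longrightarrow>
      \<exists>x3 x4. upper_gens p K \<sigma> x3 x4 \<and> (\<exists>\<beta>3\<in>K. \<exists>\<beta>4\<in>K.
        AS p x3 = rhs3 (AS p x2) x1 + \<beta>3 \<and> AS p x4 = rhs4 (AS p x2) \<beta>3 x1 x2 x3 + \<beta>4)"
proof -
  interpret galois_tower p ty R e3 e4 rhs3 rhs4 \<sigma> K
    unfolding \<sigma>_def by (rule galois_tower_of_iso[OF assms(1,2)])
  show "\<exists>x1 x2. lower_gens p K \<sigma> x1 x2 \<and> AS p x1 \<in> K \<and> AS p x2 \<in> K"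
    by (rule exists_lower_gens)
  show "\<exists>x3 x4. upper_gens p K \<sigma> x3 x4 \<and> (\<exists>\<beta>3\<in>K. \<exists>\<beta>4\<in>K.
      AS p x3 = rhs3 (AS p x2) x1 + \<beta>3 \<and> AS p x4 = rhs4 (AS p x2) \<beta>3 x1 x2 x3 + \<beta>4)"
    if "lower_gens p K \<sigma> x1 x2 \<and> AS p x1 \<in> K \<and> AS p x2 \<in> K"
    by (rule exists_upper_gens[OF that])
qed

lemma (in tower) galois_of_roots:
  assumes "subfield K0 top_field" "algebraic_ext K0" "ext_degree K0 (p ^ 4)"
    "generate_field top_field (K0 \<union> {x1, x2, x3, x4}) = UNIV"
    "AS p x1 \<in> K0" "\<beta>2 \<in> K0" "\<beta>3 \<in> K0" "\<beta>4 \<in> K0" "AS p x2 = \<beta>2"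
    "AS p x3 = rhs3 \<beta>2 x1 + \<beta>3" "AS p x4 = rhs4 \<beta>2 \<beta>3 x1 x2 x3 + \<beta>4"
  shows "galois_ext K0 \<and> galois_group K0 \<cong> presented_group R"
proof -
  interpret root_tower p ty R e3 e4 rhs3 rhs4 K0 x1 x2 x3 x4 \<beta>2 \<beta>3 \<beta>4
    by (intro root_tower.intro root_tower_axioms.intro tower_axioms assms)
  show ?thesis using galois_ext_K0 galois_group_iso by blast
qed

theorem theorem1p1:
  fixes p :: nat and \<alpha> :: int and K0 :: "'a::field set"
  assumes "prime p" and "odd p" and "\<not> QuadRes (int p) \<alpha>"
    and "subfield K0 top_field" and "CHAR('a) = p"
  shows
    "(galois_ext K0 \<and> ext_degree K0 (p^4) \<and> \<not> comm_group (galois_group K0) \<longrightarrow>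
       (\<forall>ab \<in> admissible_params p \<alpha>.
          \<forall>\<phi> \<in> iso (presented_group (relations_G p ab)) (galois_group K0).
          let \<sigma> = (\<lambda>g. \<phi> (presented_gen (relations_G p ab) g)) in
            (\<exists>x1 x2. lower_gens p K0 \<sigma> x1 x2 \<and> AS p x1 \<in> K0 \<and> AS p x2 \<in> K0) \<and>
            (\<forall>x1 x2. lower_gens p K0 \<sigma> x1 x2 \<and> AS p x1 \<in> K0 \<and> AS p x2 \<in> K0 \<longrightarrow>
              (\<exists>x3 x4. upper_gens p K0 \<sigma> x3 x4 \<and>
                (\<exists>\<beta>3\<in>K0. \<exists>\<beta>4\<in>K0. system_G p ab (AS p x2) \<beta>3 \<beta>4 x1 x2 x3 x4)))) \<and>
       (\<forall>\<phi> \<in> iso (presented_group (relations_H p)) (galois_group K0).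
          let \<sigma> = (\<lambda>g. \<phi> (presented_gen (relations_H p) g)) in
            (\<exists>x1 x2. lower_gens p K0 \<sigma> x1 x2 \<and> AS p x1 \<in> K0 \<and> AS p x2 \<in> K0) \<and>
            (\<forall>x1 x2. lower_gens p K0 \<sigma> x1 x2 \<and> AS p x1 \<in> K0 \<and> AS p x2 \<in> K0 \<longrightarrow>
              (\<exists>x3 x4. upper_gens p K0 \<sigma> x3 x4 \<and>
                (\<exists>\<beta>3\<in>K0. \<exists>\<beta>4\<in>K0. system_H p (AS p x2) \<beta>3 \<beta>4 x1 x3 x4)))))
     \<and>
     (algebraic_ext K0 \<and> ext_degree K0 (p^4) \<longrightarrow>
       (\<forall>x1 x2 x3 x4. \<forall>\<beta>1\<in>K0. \<forall>\<beta>2\<in>K0. \<forall>\<beta>3\<in>K0. \<forall>\<beta>4\<in>K0.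
          generate_field top_field (K0 \<union> {x1, x2, x3, x4}) = UNIV \<and>
          AS p x1 = \<beta>1 \<and> AS p x2 = \<beta>2 \<longrightarrow>
          (\<forall>ab \<in> admissible_params p \<alpha>. system_G p ab \<beta>2 \<beta>3 \<beta>4 x1 x2 x3 x4 \<longrightarrow>
             galois_ext K0 \<and> galois_group K0 \<cong> presented_group (relations_G p ab)) \<and>
          (system_H p \<beta>2 \<beta>3 \<beta>4 x1 x3 x4 \<longrightarrow>
             galois_ext K0 \<and> galois_group K0 \<cong> presented_group (relations_H p))))"
proof -
  interpret prime_char p "TYPE('a)"
    using assms by unfold_locales auto
  \<comment> \<open>Inspection of the list: a1 is nonzero in the last tuple alone, and there b3 =
    0.\<close>
  have G: "tower p (relations_G p ab) (e3_G p ab :: gen \<Rightarrow> 'a \<Rightarrow> 'a \<Rightarrow> 'a) (e4_G p ab) (rhs3_G p ab) (rhs4_G p ab)"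
    if "ab \<in> admissible_params p \<alpha>" for ab
    using that tower_G by (auto simp: admissible_params_def split: if_splits)
  note H = tower_H
  show ?thesis
  proof (intro conjI impI ballI allI; (elim conjE)?; (unfold Let_def)?)
    fix ab \<phi>
    assume gal: "galois_ext K0" and ab: "ab \<in> admissible_params p \<alpha>"
      and \<phi>: "\<phi> \<in> iso (presented_group (relations_G p ab)) (galois_group K0)"
    show "(\<exists>x1 x2. lower_gens p K0 (\<lambda>g. \<phi> (presented_gen (relations_G p ab) g)) x1 x2 \<and> AS p x1 \<in> K0 \<and> AS p x2 \<in> K0) \<and>
      (\<forall>x1 x2. lower_gens p K0 (\<lambda>g. \<phi> (presented_gen (relations_G p ab) g)) x1 x2 \<and> AS p x1 \<in> K0 \<and> AS p x2 \<in> K0 \<longrightarrow>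
        (\<exists>x3 x4. upper_gens p K0 (\<lambda>g. \<phi> (presented_gen (relations_G p ab) g)) x3 x4 \<and>
          (\<exists>\<beta>3\<in>K0. \<exists>\<beta>4\<in>K0. system_G p ab (AS p x2) \<beta>3 \<beta>4 x1 x2 x3 x4)))"
      unfolding system_G_iff using tower.lower_upper_gens_of_iso[OF G[OF ab] gal \<phi>] by blast
  next
    fix \<phi>
    assume gal: "galois_ext K0" and \<phi>: "\<phi> \<in> iso (presented_group (relations_H p)) (galois_group K0)"
    show "(\<exists>x1 x2. lower_gens p K0 (\<lambda>g. \<phi> (presented_gen (relations_H p) g)) x1 x2 \<and> AS p x1 \<in> K0 \<and> AS p x2 \<in> K0) \<and>
      (\<forall>x1 x2. lower_gens p K0 (\<lambda>g. \<phi> (presented_gen (relations_H p) g)) x1 x2 \<and> AS p x1 \<in> K0 \<and> AS p x2 \<in> K0 \<longrightarrow>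
        (\<exists>x3 x4. upper_gens p K0 (\<lambda>g. \<phi> (presented_gen (relations_H p) g)) x3 x4 \<and>
          (\<exists>\<beta>3\<in>K0. \<exists>\<beta>4\<in>K0. system_H p (AS p x2) \<beta>3 \<beta>4 x1 x3 x4)))"
      unfolding system_H_def
      using tower.lower_upper_gens_of_iso[OF H gal \<phi>] unfolding rhs3_H_def rhs4_H_def by blast
  next
    fix x1 x2 x3 x4 \<beta>1 \<beta>2 \<beta>3 \<beta>4 ab
    assume "algebraic_ext K0" "ext_degree K0 (p ^ 4)" "\<beta>1 \<in> K0" "\<beta>2 \<in> K0" "\<beta>3 \<in> K0" "\<beta>4 \<in> K0"
      "generate_field top_field (K0 \<union> {x1, x2, x3, x4}) = UNIV" "AS p x1 = \<beta>1" "AS p x2 = \<beta>2"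
      and ab: "ab \<in> admissible_params p \<alpha>" and "system_G p ab \<beta>2 \<beta>3 \<beta>4 x1 x2 x3 x4"
    then have "galois_ext K0 \<and> galois_group K0 \<cong> presented_group (relations_G p ab)"
      using assms(4) unfolding system_G_iff
      by (intro tower.galois_of_roots[OF G[OF ab], of K0 x1 x2 x3 x4 \<beta>2 \<beta>3 \<beta>4]) auto
    then show "galois_ext K0" "galois_group K0 \<cong> presented_group (relations_G p ab)" by auto
  next
    fix x1 x2 x3 x4 \<beta>1 \<beta>2 \<beta>3 \<beta>4
    assume "algebraic_ext K0" "ext_degree K0 (p ^ 4)" "\<beta>1 \<in> K0" "\<beta>2 \<in> K0" "\<beta>3 \<in> K0" "\<beta>4 \<in> K0"
      "generate_field top_field (K0 \<union> {x1, x2, x3, x4}) = UNIV" "AS p x1 = \<beta>1" "AS p x2 = \<beta>2"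
      and "system_H p \<beta>2 \<beta>3 \<beta>4 x1 x3 x4"
    then have "galois_ext K0 \<and> galois_group K0 \<cong> presented_group (relations_H p)"
      using assms(4) unfolding system_H_def rhs3_H_def rhs4_H_def
      by (intro tower.galois_of_roots[OF H, of K0 x1 x2 x3 x4 \<beta>2 \<beta>3 \<beta>4, unfolded rhs3_H_def rhs4_H_def]) auto
    then show "galois_ext K0" "galois_group K0 \<cong> presented_group (relations_H p)" by auto
  qed
qed

end
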